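(* Let $d=2$, let $\rho$ be a Borel measure on $(0,\infty)$ with unit mass and $\operatorname{supp}\rho\subset[\lambda^{-1},\lambda]$ for some $\lambda>0$, and let $\mathbb{P}$ be a product probability measure on $\Omega=\mathbb{R}^{\mathbf{E}(\mathbb{Z}^2)}$ under which the coordinates $(\xi_e)_{e\in\mathbf{E}(\mathbb{Z}^2)}$ are i.i.d. and not almost surely constant. Then the infinite volume free and wired disordered random conductance measures coincide: $$\bar\mu^0[\xi]=\bar\mu^1[\xi]\qquad\text{for }\mathbb{P}\text{-almost all }\xi\in\Omega.$$
   Context: For a finite connected graph $G$ (multi-edges and loops allowed) with vertex set $\mathbf{V}(G)$ and edge set $\mathbf{E}(G)$, and $\kappa\in(0,\infty)^{\mathbf{E}(G)}$, let $\Delta_\kappa f(x)=\sum_{y\sim x}\kappa_{\{x,y\}}(f(x)-f(y))$ (sum over edges with multiplicity) be the graph Laplacian acting on $H_0=\{f:\mathbf{V}(G)\to\mathbb{R}:\sum_xf(x)=0\}$, let $\det\Delta_\kappa>0$ be its determinant on $H_0$, and set $s_G(\kappa)=(\det\Delta_\kappa)^{-1/2}$. For $\xi\in\mathbb{R}^{\mathbf{E}(G)}$ define the probability measure on $(0,\infty)^{\mathbf{E}(G)}$ $$\bar\mu^G[\xi](\mathrm{d}\kappa)=\frac1Z s_G(\kappa)\prod_{e\in\mathbf{E}(G)}e^{\xi_e\kappa_e}\rho(\mathrm{d}\kappa_e).$$ Subsets $\Lambda\subset\mathbb{Z}^d$ are identified with the induced nearest-neighbour graph; $\mathbf{E}(\Lambda)$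 is the set of edges with both endpoints in $\Lambda$; $\partial\Lambda$ is the set of points of $\Lambda$ with a neighbour outside $\Lambda$; $\Lambda^w=\Lambda/\partial\Lambda$ is the graph obtained by identifying all vertices of $\partial\Lambda$. Let $\Lambda_n=[-n,n]^d\cap\mathbb{Z}^d$. For $\xi\in\mathbb{R}^{\mathbf{E}(\mathbb{Z}^d)}$, $\bar\mu^0[\xi]$ and $\bar\mu^1[\xi]$ are the probability measures on $(0,\infty)^{\mathbf{E}(\mathbb{Z}^d)}$ obtained as the (existing) limits, in the topology of local convergence (convergence on events depending on finitely many edges), of $\bar\mu^{\Lambda_n}[\xi]$ and $\bar\mu^{\Lambda_n^w}[\xi]$ respectively (with $\xi$ restricted to $\mathbf{E}(\Lambda_n)$) as $n\to\infty$. *)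

theory Defs
  imports "HOL-Probability.Probability" "Jordan_Normal_Form.Determinant"
begin

section \<open>Multigraphs and the Laplacian\<close>

text \<open>An edge \<open>e\<close> has the set \<open>ends e\<close> of its one (loop) or two endpoints; distinct edges may
  have the same endpoints.\<close>

record ('v, 'e) multigraph =
  verts :: "'v set"
  edges :: "'e set"
  ends  :: "'e \<Rightarrow> 'v set"

text \<open>The inner sum accounts for multiplicities; loops (the terms with \<open>y = x\<close>) contribute 0.\<close>

definition laplacian :: "('v, 'e) multigraph \<Rightarrow> ('e \<Rightarrow> real) \<Rightarrow> ('v \<Rightarrow> real) \<Rightarrow> 'v \<Rightarrow> real" where
  "laplacian G \<kappa> f x =
     (if x \<in> verts G
      then \<Sum>y\<in>verts G. \<Sum>e\<in>{e \<in> edges G. ends G e = {x, y}}. \<kappa> e * (f x - f y)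
      else 0)"

text \<open>Functions on the vertex set are represented by their extension by 0 to the whole type.\<close>

definition H0 :: "('v, 'e) multigraph \<Rightarrow> ('v \<Rightarrow> real) set" where
  "H0 G = {f. (\<forall>x. x \<notin> verts G \<longrightarrow> f x = 0) \<and> (\<Sum>x\<in>verts G. f x) = 0}"

definition is_basis :: "('v \<Rightarrow> real) set \<Rightarrow> nat \<Rightarrow> (nat \<Rightarrow> 'v \<Rightarrow> real) \<Rightarrow> bool" where
  "is_basis H k b \<longleftrightarrow>
     (\<forall>i<k. b i \<in> H) \<and>
     (\<forall>f\<in>H. \<exists>!c. c \<in> carrier_vec k \<and> f = (\<lambda>x. \<Sum>i<k. c $ i * b i x))"

text \<open>The determinant of a linear endomorphism \<open>T\<close> of a finite-dimensional space \<open>H\<close> of functions: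
  the determinant of the matrix of \<open>T\<close> in any basis of \<open>H\<close>. It does not depend on the basis.\<close>

definition det_on :: "('v \<Rightarrow> real) set \<Rightarrow> (('v \<Rightarrow> real) \<Rightarrow> 'v \<Rightarrow> real) \<Rightarrow> real" where
  "det_on H T = (THE D. \<exists>k b A. is_basis H k b \<and> A \<in> carrier_mat k k \<and>
     (\<forall>j<k. T (b j) = (\<lambda>x. \<Sum>i<k. A $$ (i, j) * b i x)) \<and> D = Determinant.det A)"

definition s_weight :: "('v, 'e) multigraph \<Rightarrow> ('e \<Rightarrow> real) \<Rightarrow> real" where
  "s_weight G \<kappa> = det_on (H0 G) (laplacian G \<kappa>) powr (- 1 / 2)"


section \<open>Disordered random conductance measures on finite graphs\<close>

definition pos_borel :: "real measure" where
  "pos_borel = restrict_space borel {0<..}"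

text \<open>The support of a Borel measure on a subspace \<open>space M\<close> of the real line.\<close>

definition msupport :: "real measure \<Rightarrow> real set" where
  "msupport M = {x \<in> space M. \<forall>U. open U \<longrightarrow> x \<in> U \<longrightarrow> emeasure M (U \<inter> space M) > 0}"

definition gibbs_weight ::
  "('v, 'e) multigraph \<Rightarrow> ('e \<Rightarrow> real) \<Rightarrow> ('e \<Rightarrow> real) \<Rightarrow> real" where
  "gibbs_weight G \<xi> \<kappa> = s_weight G \<kappa> * (\<Prod>e\<in>edges G. exp (\<xi> e * \<kappa> e))"

definition partition_fun :: "real measure \<Rightarrow> ('v, 'e) multigraph \<Rightarrow> ('e \<Rightarrow> real) \<Rightarrow> real" where
  "partition_fun \<rho> G \<xi> = (\<integral>\<kappa>. gibbs_weight G \<xi> \<kappa> \<partial>(\<Pi>\<^sub>M e\<in>edges G. \<rho>))"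

definition conductance_measure ::
  "real measure \<Rightarrow> ('v, 'e) multigraph \<Rightarrow> ('e \<Rightarrow> real) \<Rightarrow> ('e \<Rightarrow> real) measure" where
  "conductance_measure \<rho> G \<xi> =
     density (\<Pi>\<^sub>M e\<in>edges G. \<rho>) (\<lambda>\<kappa>. ennreal (1 / partition_fun \<rho> G \<xi> * gibbs_weight G \<xi> \<kappa>))"


section \<open>The square lattice\<close>

type_synonym site = "int \<times> int"
type_synonym bond = "site set"

definition neighbours :: "site \<Rightarrow> site \<Rightarrow> bool" where
  "neighbours x y \<longleftrightarrow> \<bar>fst x - fst y\<bar> + \<bar>snd x - snd y\<bar> = 1"

definition bonds :: "site set \<Rightarrow> bond set" where
  "bonds \<Lambda> = {{x, y} | x y. x \<in> \<Lambda> \<and> y \<in> \<Lambda> \<and> neighbours x y}"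

abbreviation lattice_bonds :: "bond set" where
  "lattice_bonds \<equiv> bonds UNIV"

definition boundary :: "site set \<Rightarrow> site set" where
  "boundary \<Lambda> = {x \<in> \<Lambda>. \<exists>y. y \<notin> \<Lambda> \<and> neighbours x y}"

definition induced_graph :: "site set \<Rightarrow> (site, bond) multigraph" where
  "induced_graph \<Lambda> = \<lparr>verts = \<Lambda>, edges = bonds \<Lambda>, ends = (\<lambda>e. e)\<rparr>"

text \<open>The vertices of \<open>\<Lambda> / \<partial>\<Lambda>\<close> are the classes of the relation identifying all points of \<open>\<partial>\<Lambda>\<close>.
  All bonds of \<open>\<Lambda>\<close> are kept as edges; those inside \<open>\<partial>\<Lambda>\<close> become loops.\<close>

definition wired_class :: "site set \<Rightarrow> site \<Rightarrow> site set" where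
  "wired_class \<Lambda> x = (if x \<in> boundary \<Lambda> then boundary \<Lambda> else {x})"

definition wired_graph :: "site set \<Rightarrow> (site set, bond) multigraph" where
  "wired_graph \<Lambda> =
     \<lparr>verts = wired_class \<Lambda> ` \<Lambda>, edges = bonds \<Lambda>, ends = (\<lambda>e. wired_class \<Lambda> ` e)\<rparr>"

definition lattice_box :: "nat \<Rightarrow> site set" where
  "lattice_box n = {- int n..int n} \<times> {- int n..int n}"


section \<open>Infinite volume measures\<close>

text \<open>Convergence on all events depending on a finite set \<open>F\<close> of bonds. The measures \<open>M n\<close> live on
  configurations on bond sets that contain \<open>F\<close> for large \<open>n\<close>; the finitely many
  other terms do not matter for the limit.\<close>

definition local_limit :: "(nat \<Rightarrow> (bond \<Rightarrow> real) measure) \<Rightarrow> (bond \<Rightarrow> real) measure \<Rightarrow> bool" where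
  "local_limit M \<mu> \<longleftrightarrow>
     prob_space \<mu> \<and> sets \<mu> = sets (\<Pi>\<^sub>M e\<in>lattice_bonds. pos_borel) \<and>
     (\<forall>F A. finite F \<longrightarrow> F \<subseteq> lattice_bonds \<longrightarrow> A \<in> sets (\<Pi>\<^sub>M e\<in>F. pos_borel) \<longrightarrow>
        (\<lambda>n. measure (M n) {\<kappa> \<in> space (M n). restrict \<kappa> F \<in> A})
          \<longlonglongrightarrow> measure \<mu> {\<kappa> \<in> space \<mu>. restrict \<kappa> F \<in> A})"

definition free_box_measure :: "real measure \<Rightarrow> (bond \<Rightarrow> real) \<Rightarrow> nat \<Rightarrow> (bond \<Rightarrow> real) measure" where
  "free_box_measure \<rho> \<xi> n = conductance_measure \<rho> (induced_graph (lattice_box n)) \<xi>"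

definition wired_box_measure :: "real measure \<Rightarrow> (bond \<Rightarrow> real) \<Rightarrow> nat \<Rightarrow> (bond \<Rightarrow> real) measure" where
  "wired_box_measure \<rho> \<xi> n = conductance_measure \<rho> (wired_graph (lattice_box n)) \<xi>"

definition free_measure :: "real measure \<Rightarrow> (bond \<Rightarrow> real) \<Rightarrow> (bond \<Rightarrow> real) measure" where
  "free_measure \<rho> \<xi> = (THE \<mu>. local_limit (free_box_measure \<rho> \<xi>) \<mu>)"

definition wired_measure :: "real measure \<Rightarrow> (bond \<Rightarrow> real) \<Rightarrow> (bond \<Rightarrow> real) measure" where
  "wired_measure \<rho> \<xi> = (THE \<mu>. local_limit (wired_box_measure \<rho> \<xi>) \<mu>)"

end

(* Adding t to the conductance of an edge multiplies det Delta by 1 + t R, where R is the effective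
   resistance between its endpoints. By Rayleigh monotonicity R decreases when conductances grow or
   vertices are glued, so Holley's criterion (from the four functions theorem) applies: free measures
   are stochastically below wired ones, free measures increase and wired ones decrease with the box.

   Hence the difference G of the wired and free log partition functions is increasing in each xi_e.
   The weight ratio of wired to free is monotone and homogeneous of degree O(n) in kappa, so the
   oscillation of G over all disorders is O(n). As in the Aizenman--Wehr argument, shift a small mass of
   the law of xi_e upwards, with parameter K/n, on all O(n^2) bonds: the density has bounded second
   moment, while the mean of G would rise by about K n delta if the mean response D of G to a
   change of a single xi_e stayed above delta. For K large this contradicts the oscillation bound, so
   D tends to 0, almost surely by monotonicity.

   D dominates the difference of the wired and free means of kappa_e, and for stochastically ordered
   measures equal means of the coordinates force equal laws. Densities of marginals with respect to
   products of rho are bounded uniformly in the box, so the limits exist and coincide. *)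
theory Submission
  imports Defs
begin


section \<open>Determinants and effective resistance\<close>

text \<open>The tilted disorder is neither translation invariant nor close to the original law, so a
  lower bound on the mean response does not carry over to it directly. The response of a bond is
  therefore compared with that of the same bond in a fixed small box around it. The latter depends
  on boundedly many bonds, each of which feels the tilt only by O(1/n). The difference of the two
  responses has small mean, because mean responses decrease to a limit, and the bounded second
  moment of the tilt keeps it small.

  The response is measured with \<open>\<xi> e\<close> forced to A and then to B, whereas
  conductances are compared at the actual \<open>\<xi> e\<close>. The bridge is a comparison of the
  increments of a smooth function of \<open>\<kappa> e\<close> with those of
  \<open>exp (t * \<kappa> e)\<close>; by stochastic order, one small gap in an exponential moment
  then controls the gaps of all such functions.

  Free and wired box measures are merged into one alternating sequence, so that a single
  construction of a limit yields both existence and equality. Determinants enter through absolute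
  values, so it is their nonvanishing that has to be proved.\<close>

lemma det_one_plus_rank_one:
  fixes u w :: "nat \<Rightarrow> real"
  shows "Determinant.det (1\<^sub>m n + mat n n (\<lambda>(i, j). u i * w j)) = 1 + (\<Sum>j<n. w j * u j)"
proof -
  define U where "U = mat n 1 (\<lambda>(i, j). u i)"
  define W where "W = mat 1 n (\<lambda>(i, j). - w j)"
  have U[simp]: "U \<in> carrier_mat n 1" and W[simp]: "W \<in> carrier_mat 1 n"
    by (auto simp: U_def W_def)
  have UW: "U * W = mat n n (\<lambda>(i, j). - (u i * w j))"
    by (rule eq_matI) (auto simp: U_def W_def scalar_prod_def)
  have WU: "W * U = mat 1 1 (\<lambda>_. - (\<Sum>j<n. w j * u j))"
    by (rule eq_matI) (auto simp: U_def W_def scalar_prod_def sum_negf atLeast0LessThan)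
  have UWc: "U * W \<in> carrier_mat n n" and WUc: "W * U \<in> carrier_mat 1 1"
    using mult_carrier_mat[OF U W] mult_carrier_mat[OF W U] by blast+
  \<comment> \<open>Matrix determinant lemma: the bordered matrix factors into block triangular
    matrices in two ways, one for each diagonal block, so det (1 - UW) = det (1 - WU), and the right
    side is a 1 by 1 determinant. The sign in \<open>W\<close> turns 1 - UW into the required
    sum.\<close>
  let ?X = "four_block_mat (1\<^sub>m n) U W (1\<^sub>m 1)"
  have c1: "four_block_mat (1\<^sub>m n) (0\<^sub>m n 1) W (1\<^sub>m 1) \<in> carrier_mat (n+1) (n+1)"
    and c2: "four_block_mat (1\<^sub>m n) U (0\<^sub>m 1 n) (1\<^sub>m 1 - W * U) \<in> carrier_mat (n+1) (n+1)"
    and c3: "four_block_mat (1\<^sub>m n - U * W) U (0\<^sub>m 1 n) (1\<^sub>m 1) \<in> carrier_mat (n+1) (n+1)"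
    by (rule four_block_carrier_mat; use UWc WUc in \<open>auto intro!: minus_carrier_mat\<close>)+
  have "?X = four_block_mat (1\<^sub>m n) (0\<^sub>m n 1) W (1\<^sub>m 1) *
    four_block_mat (1\<^sub>m n) U (0\<^sub>m 1 n) (1\<^sub>m 1 - W * U)"
    apply (subst mult_four_block_mat[where ?nr1.0 = n and ?n1.0 = n and ?n2.0 = 1 and ?nr2.0 = 1 and ?nc1.0 = n and ?nc2.0 = 1])
    using UWc WUc U W by (auto intro!: minus_carrier_mat cong_four_block_mat)
  then have "Determinant.det ?X = Determinant.det (1\<^sub>m n) * Determinant.det (1\<^sub>m 1) *
     (Determinant.det (1\<^sub>m n) * Determinant.det (1\<^sub>m 1 - W * U))"
    apply simp
    apply (subst det_mult[OF c1[simplified] c2[simplified]])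
    apply (subst det_four_block_mat_upper_right_zero[of _ n _ 1])
    using UWc WUc U W apply (auto intro!: minus_carrier_mat)
    apply (subst det_four_block_mat_lower_left_zero[of _ n _ 1])
    by (auto intro!: minus_carrier_mat)
  moreover have "Determinant.det (1\<^sub>m 1 - W * U) = 1 + (\<Sum>j<n. w j * u j)"
    by (subst det_single) (auto simp: WU)
  ultimately have 1: "Determinant.det ?X = 1 + (\<Sum>j<n. w j * u j)"
    by simp
  have "?X = four_block_mat (1\<^sub>m n - U * W) U (0\<^sub>m 1 n) (1\<^sub>m 1) *
    four_block_mat (1\<^sub>m n) (0\<^sub>m n 1) W (1\<^sub>m 1)"
    apply (subst mult_four_block_mat[where ?nr1.0 = n and ?n1.0 = n and ?n2.0 = 1 and ?nr2.0 = 1 and ?nc1.0 = n and ?nc2.0 = 1])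
    using UWc WUc U W by (auto intro!: minus_carrier_mat cong_four_block_mat)
  moreover have "Determinant.det (four_block_mat (1\<^sub>m n - U * W) U (0\<^sub>m 1 n) (1\<^sub>m 1))
      = Determinant.det (1\<^sub>m n - U * W)"
    using UWc U by (subst det_four_block_mat_lower_left_zero[of _ n _ 1]) (auto intro!: minus_carrier_mat)
  moreover have "Determinant.det (four_block_mat (1\<^sub>m n) (0\<^sub>m n 1) W (1\<^sub>m 1)) = 1"
    using W by (subst det_four_block_mat_upper_right_zero[of _ n _ 1]) auto
  ultimately have "Determinant.det ?X = Determinant.det (1\<^sub>m n - U * W)"
    using det_mult[OF c3 c1] by simp
  moreover have "1\<^sub>m n - U * W = 1\<^sub>m n + mat n n (\<lambda>(i, j). u i * w j)"
    by (rule eq_matI) (auto simp: UW)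
  ultimately show ?thesis using 1 by simp
qed

text \<open>A solution \<open>c\<close> of M c = u lets the perturbed matrix factor as M (1 + t c
  w^T), which reduces the formula to a perturbation of the identity.\<close>

lemma det_rank_one_update:
  fixes u w c :: "nat \<Rightarrow> real"
  assumes M: "M \<in> carrier_mat n n" and c: "\<And>i. i < n \<Longrightarrow> (\<Sum>l<n. M $$ (i, l) * c l) = u i"
  shows "Determinant.det (mat n n (\<lambda>(i, j). M $$ (i, j) + t * u i * w j)) =
    Determinant.det M * (1 + t * (\<Sum>j<n. w j * c j))"
proof -
  let ?N = "1\<^sub>m n + mat n n (\<lambda>(i, j). (t * c i) * w j)"
  have "mat n n (\<lambda>(i, j). M $$ (i, j) + t * u i * w j) = M * ?N"
  proof (rule eq_matI)
    fix i j assume "i < dim_row (M * ?N)" "j < dim_col (M * ?N)"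
    then have ij: "i < n" "j < n" using M by auto
    have "(M * ?N) $$ (i, j) = (\<Sum>l<n. M $$ (i, l) * ((if l = j then 1 else 0) + t * c l * w j))"
      using ij M by (auto simp: scalar_prod_def atLeast0LessThan intro!: sum.cong)
    also have "\<dots> = M $$ (i, j) + t * (\<Sum>l<n. M $$ (i, l) * c l) * w j"
      using ij by (simp add: distrib_left sum.distrib sum_distrib_left sum_distrib_right mult.assoc
          mult.left_commute if_distrib[where f="\<lambda>x. _ * x"] sum.delta cong: if_cong)
    finally show "mat n n (\<lambda>(i, j). M $$ (i, j) + t * u i * w j) $$ (i, j) = (M * ?N) $$ (i, j)"
      using c ij by simp
  qed (use M in auto)
  moreover have "?N \<in> carrier_mat n n" by auto
  ultimately show ?thesis
    using det_mult[OF M, of ?N] det_one_plus_rank_one[of n "\<lambda>i. t * c i" w]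
    by (simp add: sum_distrib_left mult.left_commute)
qed

text \<open>\<open>det_on\<close> is a definite description over all bases, so every other
  admissible matrix must be shown to have the same determinant; it is conjugate by the transition
  matrix. The last two assumptions are closure of \<open>H\<close> under linear combinations and
  linearity of \<open>T\<close>.\<close>

lemma det_on_eqI:
  fixes T :: "('v \<Rightarrow> real) \<Rightarrow> 'v \<Rightarrow> real"
  assumes b: "is_basis H k b" and A: "A \<in> carrier_mat k k"
    and TA: "\<And>j. j < k \<Longrightarrow> T (b j) = (\<lambda>x. \<Sum>i<k. A $$ (i, j) * b i x)"
    and H: "\<And>m c f. (\<And>i. i < (m::nat) \<Longrightarrow> f i \<in> H) \<Longrightarrow> (\<lambda>x. \<Sum>i<m. c i * f i x) \<in> H"
    and T: "\<And>m c f. T (\<lambda>x. \<Sum>i<(m::nat). c i * f i x) = (\<lambda>x. \<Sum>i<m. c i * T (f i) x)"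
  shows "det_on H T = Determinant.det A"
  unfolding det_on_def
proof (rule the_equality)
  show "\<exists>k b Aa. is_basis H k b \<and> Aa \<in> carrier_mat k k \<and>
      (\<forall>j<k. T (b j) = (\<lambda>x. \<Sum>i<k. Aa $$ (i, j) * b i x)) \<and> Determinant.det A = Determinant.det Aa"
    using b A TA by blast
next
  have uniq: "x i = y i" if b: "is_basis H k b" and e: "(\<lambda>z. \<Sum>i<k. x i * b i z) = (\<lambda>z. \<Sum>i<k. y i * b i z)"
    and i: "i < k" for k b x y i
  proof -
    have "(\<lambda>z. \<Sum>i<k. x i * b i z) \<in> H" using b by (intro H) (auto simp: is_basis_def)
    then have "\<exists>!c. c \<in> carrier_vec k \<and> (\<lambda>z. \<Sum>i<k. x i * b i z) = (\<lambda>x. \<Sum>i<k. vec_index c i * b i x)"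
      using b by (auto simp: is_basis_def)
    moreover have "(\<lambda>z. \<Sum>i<k. x i * b i z) = (\<lambda>z. \<Sum>i<k. vec_index (Matrix.vec k x) i * b i z)"
      by (auto intro!: sum.cong)
    moreover have "(\<lambda>z. \<Sum>i<k. x i * b i z) = (\<lambda>z. \<Sum>i<k. vec_index (Matrix.vec k y) i * b i z)"
      unfolding e by (auto intro!: sum.cong)
    ultimately have "Matrix.vec k x = Matrix.vec k y"
      by (elim ex1E) (blast intro: vec_carrier)
    then have "vec_index (Matrix.vec k x) i = vec_index (Matrix.vec k y) i" by simp
    then show ?thesis using i by simp
  qed
  have coord: "\<exists>P. \<forall>j<l. b' j = (\<lambda>x. \<Sum>i<k. P i j * b i x)" if "is_basis H k b" "is_basis H l b'"
    for k l b b'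
  proof -
    have "\<exists>c. b' j = (\<lambda>x. \<Sum>i<k. c i * b i x)" if "j < l" for j
    proof -
      have "b' j \<in> H" using \<open>is_basis H l b'\<close> that by (simp add: is_basis_def)
      then obtain c where "b' j = (\<lambda>x. \<Sum>i<k. vec_index c i * b i x)"
        using \<open>is_basis H k b\<close> unfolding is_basis_def by blast
      then show ?thesis by blast
    qed
    then have "\<forall>j. \<exists>c. j < l \<longrightarrow> b' j = (\<lambda>x. \<Sum>i<k. c i * b i x)" by blast
    from choice[OF this] obtain P where "\<forall>j. j < l \<longrightarrow> b' j = (\<lambda>x. \<Sum>i<k. P j i * b i x)" by blast
    then show ?thesis by (intro exI[of _ "\<lambda>i j. P j i"]) simp
  qed
  have comp: "(\<Sum>m<l. P i m * Q m j) = (if i = j then 1 else 0)"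
    if b: "is_basis H k b" and P: "\<forall>j<l. b' j = (\<lambda>x. \<Sum>i<k. P i j * b i x)"
      and Q: "\<forall>j<k. b j = (\<lambda>x. \<Sum>i<l. Q i j * b' i x)" and i: "i < k" and j: "j < k"
    for k l b b' i j and P Q :: "nat \<Rightarrow> nat \<Rightarrow> real"
  proof (rule uniq[OF b _ i, where x = "\<lambda>i. \<Sum>m<l. P i m * Q m j" and y = "\<lambda>i. if i = j then 1 else 0"])
    have "(\<Sum>i<k. (\<Sum>m<l. P i m * Q m j) * b i z) = (\<Sum>m<l. Q m j * (\<Sum>i<k. P i m * b i z))" for z
      by (simp add: sum_distrib_left sum_distrib_right mult_ac, rule sum.swap)
    also have "\<dots> z = b j z" for z using Q j P by simp
    finally show "(\<lambda>z. \<Sum>i<k. (\<Sum>m<l. P i m * Q m j) * b i z) = (\<lambda>z. \<Sum>i<k. (if i = j then 1 else 0) * b i z)"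
      using j by (auto simp: if_distrib[where f="\<lambda>x. x * _"] sum.delta cong: if_cong)
  qed
  fix D assume "\<exists>k b A. is_basis H k b \<and> A \<in> carrier_mat k k \<and>
      (\<forall>j<k. T (b j) = (\<lambda>x. \<Sum>i<k. A $$ (i, j) * b i x)) \<and> D = Determinant.det A"
  then obtain l b' A' where b': "is_basis H l b'" and A': "A' \<in> carrier_mat l l"
    and TA': "\<forall>j<l. T (b' j) = (\<lambda>x. \<Sum>i<l. A' $$ (i, j) * b' i x)" and D: "D = Determinant.det A'" by blast
  obtain P where P: "\<forall>j<l. b' j = (\<lambda>x. \<Sum>i<k. P i j * b i x)" using coord[OF b b'] by blast
  obtain Q where Q: "\<forall>j<k. b j = (\<lambda>x. \<Sum>i<l. Q i j * b' i x)" using coord[OF b' b] by blast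
  note PQ = comp[OF b P Q] and QP = comp[OF b' Q P]
  \<comment> \<open>Two bases have the same length: both products of the transition matrices are
    identities, and PQ and QP have the same trace.\<close>
  have "real k = (\<Sum>i<k. \<Sum>m<l. P i m * Q m i)" using PQ by simp
  also have "\<dots> = (\<Sum>m<l. \<Sum>i<k. Q m i * P i m)" by (subst sum.swap) (simp add: mult.commute)
  also have "\<dots> = real l" using QP by simp
  finally have kl: "l = k" by simp
  define p where "p = mat k k (\<lambda>(i, j). P i j)"
  define q where "q = mat k k (\<lambda>(i, j). Q i j)"
  have pc: "p \<in> carrier_mat k k" and qc: "q \<in> carrier_mat k k" by (auto simp: p_def q_def)
  have pq: "p * q = 1\<^sub>m k"
    by (rule eq_matI) (auto simp: p_def q_def scalar_prod_def atLeast0LessThan PQ[unfolded kl])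
  \<comment> \<open>Compare the coefficients of \<open>T (b' j)\<close> in the basis
    \<open>b\<close>, computed by changing basis before applying \<open>T\<close> and after.\<close>
  have "A * p = p * A'"
  proof (rule eq_matI)
    fix i j assume "i < dim_row (p * A')" "j < dim_col (p * A')"
    then have ij: "i < k" "j < k" using A' by (auto simp: p_def kl)
    have "(\<Sum>m<k. A $$ (i, m) * P m j) = (\<Sum>m<k. P i m * A' $$ (m, j))"
    proof (rule uniq[OF b _ ij(1), where x = "\<lambda>i. \<Sum>m<k. A $$ (i, m) * P m j"
            and y = "\<lambda>i. \<Sum>m<k. P i m * A' $$ (m, j)"])
      have "T (b' j) = (\<lambda>x. \<Sum>m<k. P m j * T (b m) x)"
        using P ij kl by (simp add: T)
      also have "\<dots> = (\<lambda>x. \<Sum>m<k. P m j * (\<Sum>i<k. A $$ (i, m) * b i x))"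
        using TA by simp
      also have "\<dots> = (\<lambda>x. \<Sum>i<k. (\<Sum>m<k. A $$ (i, m) * P m j) * b i x)"
        by (rule ext, simp add: sum_distrib_left sum_distrib_right mult_ac, rule sum.swap)
      finally have 1: "T (b' j) = \<dots>" .
      have "T (b' j) = (\<lambda>x. \<Sum>m<k. A' $$ (m, j) * (\<Sum>i<k. P i m * b i x))"
        using P TA' ij kl by simp
      also have "\<dots> = (\<lambda>x. \<Sum>i<k. (\<Sum>m<k. P i m * A' $$ (m, j)) * b i x)"
        by (rule ext, simp add: sum_distrib_left sum_distrib_right mult_ac, rule sum.swap)
      finally show "(\<lambda>z. \<Sum>i<k. (\<Sum>m<k. A $$ (i, m) * P m j) * b i z) =
        (\<lambda>z. \<Sum>i<k. (\<Sum>m<k. P i m * A' $$ (m, j)) * b i z)" using 1 by simp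
    qed
    then show "(A * p) $$ (i, j) = (p * A') $$ (i, j)"
      using ij A A' by (simp add: p_def kl scalar_prod_def atLeast0LessThan)
  qed (use A A' in \<open>auto simp: p_def kl\<close>)
  then have "Determinant.det A * Determinant.det p = Determinant.det p * Determinant.det A'"
    using A A' pc kl by (metis det_mult)
  moreover have "Determinant.det p * Determinant.det q = 1"
    using pq pc qc by (metis det_mult det_one)
  ultimately show "D = Determinant.det A" unfolding D by auto
qed


section \<open>Gradients, energy and the matrix of the Laplacian\<close>

definition orient :: "('v, 'e) multigraph \<Rightarrow> 'e \<Rightarrow> 'v \<times> 'v" where
  "orient G e = (SOME p. ends G e = {fst p, snd p})"

text \<open>The arbitrary orientation affects only a sign, which cancels in products of two
  gradients along the same edge.\<close>

definition grad :: "('v, 'e) multigraph \<Rightarrow> ('v \<Rightarrow> real) \<Rightarrow> 'e \<Rightarrow> real" where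
  "grad G f e = f (fst (orient G e)) - f (snd (orient G e))"

definition energy :: "('v, 'e) multigraph \<Rightarrow> ('e \<Rightarrow> real) \<Rightarrow> ('v \<Rightarrow> real) \<Rightarrow> real" where
  "energy G \<kappa> f = (\<Sum>e\<in>edges G. \<kappa> e * (grad G f e)\<^sup>2)"

definition lap_det :: "('v, 'e) multigraph \<Rightarrow> ('e \<Rightarrow> real) \<Rightarrow> real" where
  "lap_det G \<kappa> = det_on (H0 G) (laplacian G \<kappa>)"

abbreviation dirac :: "'v \<Rightarrow> 'v \<Rightarrow> real" where
  "dirac x z \<equiv> if z = x then 1 else 0"

abbreviation root_diff :: "(nat \<Rightarrow> 'v) \<Rightarrow> nat \<Rightarrow> 'v \<Rightarrow> real" where
  "root_diff v i z \<equiv> dirac (v (Suc i)) z - dirac (v 0) z"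

text \<open>The matrix of the Laplacian in the basis of \<open>H0\<close> formed by the differences
  of point masses \<open>root_diff\<close>, with \<open>v 0\<close> as root. The coordinates of a
  function in this basis are its values at the other vertices.\<close>

definition lap_mat :: "('v, 'e) multigraph \<Rightarrow> ('e \<Rightarrow> real) \<Rightarrow> (nat \<Rightarrow> 'v) \<Rightarrow> real mat" where
  "lap_mat G \<kappa> v = mat (card (verts G) - 1) (card (verts G) - 1)
     (\<lambda>(i, j). laplacian G \<kappa> (root_diff v j) (v (Suc i)))"

lemma laplacian_cong:
  "(\<And>e. e \<in> edges G \<Longrightarrow> \<kappa> e = \<kappa>' e) \<Longrightarrow> laplacian G \<kappa> = laplacian G \<kappa>'"
  unfolding laplacian_def by (intro ext if_cong refl sum.cong) auto

lemma lap_det_cong: "(\<And>e. e \<in> edges G \<Longrightarrow> \<kappa> e = \<kappa>' e) \<Longrightarrow> lap_det G \<kappa> = lap_det G \<kappa>'"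
  unfolding lap_det_def using laplacian_cong by metis

lemma laplacian_lincomb:
  "laplacian G \<kappa> (\<lambda>x. \<Sum>i<(m::nat). c i * f i x) = (\<lambda>x. \<Sum>i<m. c i * laplacian G \<kappa> (f i) x)"
proof
  fix x
  have "(\<Sum>y\<in>verts G. \<Sum>e\<in>{e \<in> edges G. ends G e = {x, y}}. \<kappa> e * ((\<Sum>i<m. c i * f i x) - (\<Sum>i<m. c i * f i y)))
    = (\<Sum>y\<in>verts G. \<Sum>e\<in>{e \<in> edges G. ends G e = {x, y}}. \<Sum>i<m. c i * (\<kappa> e * (f i x - f i y)))"
    by (intro sum.cong refl) (simp add: sum_subtractf[symmetric] sum_distrib_left algebra_simps)
  also have "\<dots> = (\<Sum>y\<in>verts G. \<Sum>i<m. \<Sum>e\<in>{e \<in> edges G. ends G e = {x, y}}. c i * (\<kappa> e * (f i x - f i y)))"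
    by (intro sum.cong refl sum.swap)
  also have "\<dots> = (\<Sum>i<m. \<Sum>y\<in>verts G. \<Sum>e\<in>{e \<in> edges G. ends G e = {x, y}}. c i * (\<kappa> e * (f i x - f i y)))"
    by (rule sum.swap)
  finally show "laplacian G \<kappa> (\<lambda>x. \<Sum>i<m. c i * f i x) x = (\<Sum>i<m. c i * laplacian G \<kappa> (f i) x)"
    by (simp add: laplacian_def sum_distrib_left)
qed

lemma grad_lincomb: "grad G (\<lambda>x. \<Sum>i<(m::nat). c i * f i x) e = (\<Sum>i<m. c i * grad G (f i) e)"
  by (simp add: grad_def sum_subtractf right_diff_distrib)

text \<open>Connectivity is stated through functions: whatever is constant along edges is constant.
  This is the form in which it determines the kernel of the Laplacian, and it avoids paths.\<close>

locale connected_multigraph =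
  fixes G :: "('v, 'e) multigraph"
  assumes finite_verts: "finite (verts G)" and finite_edges: "finite (edges G)"
    and verts_ne: "verts G \<noteq> {}"
    and ends_ex: "e \<in> edges G \<Longrightarrow> \<exists>x\<in>verts G. \<exists>y\<in>verts G. ends G e = {x, y}"
    and connected: "\<lbrakk>\<And>e x y. \<lbrakk>e \<in> edges G; x \<in> ends G e; y \<in> ends G e\<rbrakk> \<Longrightarrow> f x = (f y :: real);
       x \<in> verts G; y \<in> verts G\<rbrakk> \<Longrightarrow> f x = f y"
begin

lemma ends_orient: "e \<in> edges G \<Longrightarrow> ends G e = {fst (orient G e), snd (orient G e)}"
  unfolding orient_def by (rule someI_ex) (use ends_ex in fastforce)

lemma orient_verts:
  assumes "e \<in> edges G"
  shows "fst (orient G e) \<in> verts G" "snd (orient G e) \<in> verts G"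
  using ends_ex[OF assms] ends_orient[OF assms] by (metis insert_iff singletonD)+

text \<open>After exchanging the sums, an edge at \<open>x\<close> has exactly one opposite
  endpoint. A loop has opposite endpoint \<open>x\<close> itself, where both sides vanish.\<close>

lemma laplacian_eq:
  assumes x: "x \<in> verts G"
  shows "laplacian G \<kappa> f x = (\<Sum>e\<in>edges G. \<kappa> e * grad G f e * grad G (dirac x) e)"
proof -
  have "laplacian G \<kappa> f x = (\<Sum>y\<in>verts G. \<Sum>e\<in>{e \<in> edges G. ends G e = {x, y}}. \<kappa> e * (f x - f y))"
    using x by (simp add: laplacian_def)
  also have "\<dots> = (\<Sum>e\<in>edges G. \<Sum>y\<in>{y \<in> verts G. ends G e = {x, y}}. \<kappa> e * (f x - f y))"
    by (rule sum.swap_restrict[OF finite_verts finite_edges])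
  also have "\<dots> = (\<Sum>e\<in>edges G. \<kappa> e * grad G f e * grad G (dirac x) e)"
  proof (rule sum.cong[OF refl])
    fix e assume e: "e \<in> edges G"
    obtain s t where o: "orient G e = (s, t)" by force
    have st: "ends G e = {s, t}" "s \<in> verts G" "t \<in> verts G"
      using ends_orient[OF e] orient_verts[OF e] o by auto
    have "{y \<in> verts G. ends G e = {x, y}} = (if x = s then {t} else if x = t then {s} else {})"
      using st by (auto simp: doubleton_eq_iff)
    then show "(\<Sum>y\<in>{y \<in> verts G. ends G e = {x, y}}. \<kappa> e * (f x - f y)) = \<kappa> e * grad G f e * grad G (dirac x) e"
      by (auto simp: grad_def o algebra_simps)
  qed
  finally show ?thesis .
qed

lemma sum_grad_dirac:
  assumes e: "e \<in> edges G" shows "(\<Sum>x\<in>verts G. h x * grad G (dirac x) e) = grad G h e"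
  using orient_verts[OF e] finite_verts
  by (simp add: grad_def right_diff_distrib sum_subtractf if_distrib[where f="\<lambda>x. _ * x"] cong: if_cong)

text \<open>Summation by parts; with \<open>h = f\<close> the right side is the Dirichlet
  energy.\<close>

lemma sum_laplacian:
  "(\<Sum>x\<in>verts G. h x * laplacian G \<kappa> f x) = (\<Sum>e\<in>edges G. \<kappa> e * grad G f e * grad G h e)"
proof -
  have "(\<Sum>x\<in>verts G. h x * laplacian G \<kappa> f x) =
      (\<Sum>x\<in>verts G. \<Sum>e\<in>edges G. \<kappa> e * grad G f e * (h x * grad G (dirac x) e))"
    by (intro sum.cong refl) (simp add: laplacian_eq sum_distrib_left mult_ac)
  also have "\<dots> = (\<Sum>e\<in>edges G. \<Sum>x\<in>verts G. \<kappa> e * grad G f e * (h x * grad G (dirac x) e))"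
    by (rule sum.swap)
  finally show ?thesis by (simp add: sum_distrib_left[symmetric] sum_grad_dirac)
qed

lemma sum_laplacian_zero: "(\<Sum>x\<in>verts G. laplacian G \<kappa> f x) = 0"
  using sum_laplacian[of "\<lambda>_. 1" \<kappa> f] by (simp add: grad_def)

lemma energy_nonneg: "(\<And>e. e \<in> edges G \<Longrightarrow> \<kappa> e \<ge> 0) \<Longrightarrow> energy G \<kappa> f \<ge> 0"
  unfolding energy_def by (intro sum_nonneg) auto

context
  fixes v :: "nat \<Rightarrow> 'v" and k :: nat
  assumes v: "bij_betw v {..<card (verts G)} (verts G)" and k: "k = card (verts G) - 1"
begin

lemma card_Suc: "card (verts G) = Suc k"
  using k verts_ne finite_verts by (simp add: card_gt_0_iff)

lemma v_verts: "i \<le> k \<Longrightarrow> v i \<in> verts G"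
  using v card_Suc by (auto simp: bij_betw_def)

lemma v_inj: "i \<le> k \<Longrightarrow> j \<le> k \<Longrightarrow> v i = v j \<longleftrightarrow> i = j"
  using v card_Suc by (auto simp: bij_betw_def inj_on_def)

lemma sum_verts: "(\<Sum>x\<in>verts G. f x) = f (v 0) + (\<Sum>i<k. f (v (Suc i)))" for f :: "'v \<Rightarrow> real"
  using sum.reindex_bij_betw[OF v, of f] unfolding card_Suc sum.lessThan_Suc_shift by simp

lemma root_diff_H0: "i < k \<Longrightarrow> root_diff v i \<in> H0 G"
  using v_verts[of 0] v_verts[of "Suc i"] finite_verts by (auto simp: H0_def sum_subtractf)

lemma lincomb_H0: "(\<And>i. i < (m::nat) \<Longrightarrow> f i \<in> H0 G) \<Longrightarrow> (\<lambda>x. \<Sum>i<m. c i * f i x) \<in> H0 G"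
proof -
  assume *: "\<And>i. i < m \<Longrightarrow> f i \<in> H0 G"
  have "(\<Sum>x\<in>verts G. \<Sum>i<m. c i * f i x) = (\<Sum>i<m. c i * (\<Sum>x\<in>verts G. f i x))"
    by (simp add: sum_distrib_left, rule sum.swap)
  then show ?thesis using * by (simp add: H0_def)
qed

lemma coeff_root_diff: "j < k \<Longrightarrow> (\<Sum>i<k. c i * root_diff v i (v (Suc j))) = c j"
proof -
  assume j: "j < k"
  have "(\<Sum>i<k. c i * root_diff v i (v (Suc j))) = (\<Sum>i<k. if i = j then c i else 0)"
    using j by (intro sum.cong refl) (auto simp: v_inj)
  then show ?thesis using j by simp
qed

lemma H0_expand:
  assumes f: "f \<in> H0 G" shows "f = (\<lambda>x. \<Sum>i<k. f (v (Suc i)) * root_diff v i x)"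
proof
  fix x
  let ?g = "\<lambda>x. \<Sum>i<k. f (v (Suc i)) * root_diff v i x"
  have g: "?g \<in> H0 G" by (intro lincomb_H0 root_diff_H0)
  show "f x = ?g x"
  proof (cases "x \<in> verts G")
    case True
    then obtain i where i: "i \<le> k" "x = v i"
      using v card_Suc unfolding bij_betw_def by (metis imageE lessThan_iff less_Suc_eq_le)
    have e: "f (v (Suc j)) = ?g (v (Suc j))" if "j < k" for j by (simp only: coeff_root_diff[OF that])
    show ?thesis
    proof (cases i)
      case 0
      \<comment> \<open>The value at the root is not a coordinate; it is recovered from the
        vanishing sum over all vertices.\<close>
      have "f (v 0) = - (\<Sum>i<k. f (v (Suc i)))" "?g (v 0) = - (\<Sum>i<k. ?g (v (Suc i)))"
        using f g unfolding H0_def sum_verts by (simp_all only: mem_Collect_eq) linarith+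
      then show ?thesis using e i 0 by simp
    next
      case (Suc j) then show ?thesis using e[of j] i by simp
    qed
  next
    case False then show ?thesis using f g by (simp add: H0_def)
  qed
qed

lemma lap_H0: "laplacian G \<kappa> f \<in> H0 G"
  by (simp add: H0_def sum_laplacian_zero) (simp add: laplacian_def)

lemma root_diff_basis: "is_basis (H0 G) k (root_diff v)"
  unfolding is_basis_def
proof (intro conjI allI impI ballI)
  fix f assume f: "f \<in> H0 G"
  show "\<exists>!c. c \<in> carrier_vec k \<and> f = (\<lambda>x. \<Sum>i<k. vec_index c i * root_diff v i x)"
  proof (rule ex1I[of _ "Matrix.vec k (\<lambda>i. f (v (Suc i)))"])
    show "Matrix.vec k (\<lambda>i. f (v (Suc i))) \<in> carrier_vec k \<and>
      f = (\<lambda>x. \<Sum>i<k. vec_index (Matrix.vec k (\<lambda>i. f (v (Suc i)))) i * root_diff v i x)"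
      using H0_expand[OF f] by simp
    fix c assume c: "c \<in> carrier_vec k \<and> f = (\<lambda>x. \<Sum>i<k. vec_index c i * root_diff v i x)"
    show "c = Matrix.vec k (\<lambda>i. f (v (Suc i)))"
    proof (rule eq_vecI)
      fix i assume "i < dim_vec (Matrix.vec k (\<lambda>i. f (v (Suc i))))"
      then have i: "i < k" by simp
      have "f (v (Suc i)) = (\<Sum>j<k. vec_index c j * root_diff v j (v (Suc i)))" using c by metis
      then show "vec_index c i = vec_index (Matrix.vec k (\<lambda>i. f (v (Suc i)))) i"
        using i by (simp only: coeff_root_diff[OF i] index_vec)
    qed (use c in auto)
  qed
qed (rule root_diff_H0)

lemma lap_mat_k: "lap_mat G \<kappa> v = mat k k (\<lambda>(i, j). laplacian G \<kappa> (root_diff v j) (v (Suc i)))"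
  unfolding lap_mat_def k ..

lemma lap_det_eq: "lap_det G \<kappa> = Determinant.det (lap_mat G \<kappa> v)"
  unfolding lap_det_def
proof (rule det_on_eqI[OF root_diff_basis])
  fix j assume j: "j < k"
  show "laplacian G \<kappa> (root_diff v j) = (\<lambda>x. \<Sum>i<k. lap_mat G \<kappa> v $$ (i, j) * root_diff v i x)"
    using j by (subst H0_expand[OF lap_H0]) (simp add: lap_mat_k)
qed (simp_all add: lap_mat_k laplacian_lincomb lincomb_H0)

end

lemma lap_mat_mult:
  assumes k: "k = card (verts G) - 1" and i: "i < k"
  shows "(\<Sum>j<k. lap_mat G \<kappa> v $$ (i, j) * c j) =
    laplacian G \<kappa> (\<lambda>x. \<Sum>j<k. c j * root_diff v j x) (v (Suc i))"
  using i unfolding laplacian_lincomb lap_mat_def k[symmetric] by (simp add: mult.commute)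

end


section \<open>Invertibility on mean zero functions and effective resistance\<close>

context connected_multigraph
begin

lemma vertex_enum: "\<exists>v. bij_betw v {..<card (verts G)} (verts G)"
  using ex_bij_betw_nat_finite[OF finite_verts] by (simp add: atLeast0LessThan)

lemma verts_induct:
  assumes v: "bij_betw v {..<card (verts G)} (verts G)" and k: "k = card (verts G) - 1"
    and "P (v 0)" "\<And>i. i < k \<Longrightarrow> P (v (Suc i))" "x \<in> verts G"
  shows "P x"
proof -
  obtain i where "i < Suc k" "x = v i" using assms(5) v unfolding bij_betw_def card_Suc[OF v k] by auto
  then show ?thesis using assms(3,4) by (cases i) auto
qed

text \<open>A harmonic function has zero energy, hence zero gradient on every edge; by connectivity
  it is constant, and mean zero makes the constant vanish.\<close>

lemma harmonic_zero:
  assumes \<kappa>: "\<And>e. e \<in> edges G \<Longrightarrow> \<kappa> e > 0" and f: "f \<in> H0 G"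
    and h: "\<And>x. x \<in> verts G \<Longrightarrow> laplacian G \<kappa> f x = 0"
  shows "f = (\<lambda>_. 0)"
proof -
  have "energy G \<kappa> f = 0"
    using sum_laplacian[of f \<kappa> f] h by (simp add: energy_def power2_eq_square mult.assoc)
  then have "\<forall>e\<in>edges G. \<kappa> e * (grad G f e)\<^sup>2 = 0"
    unfolding energy_def using \<kappa> by (subst (asm) sum_nonneg_eq_0_iff[OF finite_edges]) (auto simp: less_imp_le)
  then have g: "grad G f e = 0" if "e \<in> edges G" for e using \<kappa>[OF that] that by auto
  have const: "f x = f y" if "x \<in> verts G" "y \<in> verts G" for x y
  proof (rule connected[OF _ that])
    fix e x y assume "e \<in> edges G" "x \<in> ends G e" "y \<in> ends G e"
    then show "f x = f y" using g[of e] ends_orient[of e] by (auto simp: grad_def)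
  qed
  obtain x0 where x0: "x0 \<in> verts G" using verts_ne by blast
  have "(\<Sum>x\<in>verts G. f x) = real (card (verts G)) * f x0"
    using const[OF _ x0] by simp
  then have "f x0 = 0" using f finite_verts verts_ne by (simp add: H0_def)
  show ?thesis
  proof
    fix x show "f x = 0"
    proof (cases "x \<in> verts G")
      case True show ?thesis using const[OF True x0] \<open>f x0 = 0\<close> by simp
    next
      case False then show ?thesis using f by (simp add: H0_def)
    qed
  qed
qed

lemma lap_det_nonzero:
  assumes \<kappa>: "\<forall>e\<in>edges G. \<kappa> e > 0"
  shows "lap_det G \<kappa> \<noteq> 0"
proof
  obtain v where v: "bij_betw v {..<card (verts G)} (verts G)" using vertex_enum by blast
  define k where k: "k = card (verts G) - 1"
  have M: "lap_mat G \<kappa> v \<in> carrier_mat k k" by (simp add: lap_mat_def k)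
  assume "lap_det G \<kappa> = 0"
  then have "Determinant.det (lap_mat G \<kappa> v) = 0" using lap_det_eq[OF v refl] by simp
  then obtain c where c: "c \<in> carrier_vec k" "c \<noteq> 0\<^sub>v k" "lap_mat G \<kappa> v *\<^sub>v c = 0\<^sub>v k"
    using det_0_iff_vec_prod_zero_field[OF M] by blast
  define g where "g = (\<lambda>x. \<Sum>j<k. vec_index c j * root_diff v j x)"
  have g: "g \<in> H0 G" unfolding g_def by (intro lincomb_H0[OF v k] root_diff_H0[OF v k])
  have i: "laplacian G \<kappa> g (v (Suc i)) = 0" if "i < k" for i
  proof -
    have "vec_index (lap_mat G \<kappa> v *\<^sub>v c) i = (\<Sum>j<k. lap_mat G \<kappa> v $$ (i, j) * vec_index c j)"
      using c(1) that M by (auto simp: scalar_prod_def atLeast0LessThan row_def intro!: sum.cong)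
    moreover have "vec_index (lap_mat G \<kappa> v *\<^sub>v c) i = 0" unfolding c(3) using that by simp
    ultimately show ?thesis
      using lap_mat_mult[OF k that, of \<kappa> v "vec_index c"] by (simp add: g_def)
  qed
  \<comment> \<open>The rows of the matrix cover all vertices except the root; the equation there
    follows because the values of a Laplacian sum to zero.\<close>
  have "laplacian G \<kappa> g (v 0) = 0"
    using sum_laplacian_zero[of \<kappa> g] i sum_verts[OF v k, of "laplacian G \<kappa> g"] by simp
  then have "laplacian G \<kappa> g x = 0" if "x \<in> verts G" for x
    by - (rule verts_induct[OF v k, where P = "\<lambda>x. laplacian G \<kappa> g x = 0"]; use that i in simp)
  then have "g = (\<lambda>_. 0)" using harmonic_zero[of \<kappa> g] \<kappa> g by blast
  then have "vec_index c j = 0" if "j < k" for j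
    using coeff_root_diff[OF v k that, of "vec_index c"] unfolding g_def by metis
  then have "c = 0\<^sub>v k" using c by (intro eq_vecI) auto
  with c show False by simp
qed

lemma laplacian_upd:
  assumes "e \<in> edges G" "x \<in> verts G"
  shows "laplacian G (\<kappa>(e := \<kappa> e + t)) f x = laplacian G \<kappa> f x + t * grad G f e * grad G (dirac x) e"
  using assms finite_edges
  by (simp add: laplacian_eq sum.remove[of _ e] distrib_right cong: sum.cong_simp)

text \<open>The number \<open>R\<close> below is the effective resistance between the endpoints of \<open>e\<close>, and \<open>g\<close> is
  the potential of the unit current flow.\<close>

lemma effective_resistance:
  assumes \<kappa>: "\<forall>e\<in>edges G. \<kappa> e > 0" and e: "e \<in> edges G"
  obtains R g where "R \<ge> 0" "grad G g e = R" "energy G \<kappa> g = R"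
    "\<And>f. (grad G f e)\<^sup>2 \<le> R * energy G \<kappa> f"
    "\<And>t. lap_det G (\<kappa>(e := \<kappa> e + t)) = lap_det G \<kappa> * (1 + t * R)"
proof -
  obtain v where v: "bij_betw v {..<card (verts G)} (verts G)" using vertex_enum by blast
  define k where k: "k = card (verts G) - 1"
  let ?M = "lap_mat G \<kappa> v"
  have M: "?M \<in> carrier_mat k k" by (simp add: lap_mat_def k)
  have d: "Determinant.det ?M \<noteq> 0" using lap_det_nonzero[OF \<kappa>] lap_det_eq[OF v refl] by simp
  define u where "u i = grad G (dirac (v (Suc i))) e" for i
  \<comment> \<open>Cramer's rule through the adjugate: \<open>c\<close> solves the linear system
    whose right side \<open>u\<close> is the unit dipole across \<open>e\<close>.\<close>
  define c where "c j = (\<Sum>i<k. adj_mat ?M $$ (j, i) * u i) / Determinant.det ?M" for j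
  have adj: "adj_mat ?M \<in> carrier_mat k k" "?M * adj_mat ?M = Determinant.det ?M \<cdot>\<^sub>m 1\<^sub>m k"
    using adj_mat[OF M] by auto
  have Mc: "(\<Sum>l<k. ?M $$ (i, l) * c l) = u i" if i: "i < k" for i
  proof -
    have en: "(\<Sum>l<k. ?M $$ (i, l) * adj_mat ?M $$ (l, m)) = (if i = m then Determinant.det ?M else 0)"
      if "m < k" for m
    proof -
      have "(\<Sum>l<k. ?M $$ (i, l) * adj_mat ?M $$ (l, m)) = (?M * adj_mat ?M) $$ (i, m)"
        using i that M adj(1) by (simp add: scalar_prod_def atLeast0LessThan)
      also have "\<dots> = (if i = m then Determinant.det ?M else 0)" unfolding adj(2) using i that by simp
      finally show ?thesis .
    qed
    have "(\<Sum>l<k. ?M $$ (i, l) * (\<Sum>m<k. adj_mat ?M $$ (l, m) * u m)) =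
      (\<Sum>m<k. (\<Sum>l<k. ?M $$ (i, l) * adj_mat ?M $$ (l, m)) * u m)"
      by (simp add: sum_distrib_left sum_distrib_right mult.assoc, rule sum.swap)
    also have "\<dots> = (\<Sum>m<k. if m = i then Determinant.det ?M * u i else 0)"
      by (intro sum.cong refl) (auto simp: en)
    also have "\<dots> = Determinant.det ?M * u i" using i by simp
    finally show ?thesis using d by (simp add: c_def flip: sum_divide_distrib)
  qed
  define g where "g = (\<lambda>x. \<Sum>j<k. c j * root_diff v j x)"
  have gS: "laplacian G \<kappa> g (v (Suc i)) = grad G (dirac (v (Suc i))) e" if "i < k" for i
    using lap_mat_mult[OF k that, of \<kappa> v c] Mc[OF that] by (simp add: g_def u_def)
  have one: "(\<Sum>x\<in>verts G. grad G (dirac x) e) = 0"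
    using sum_grad_dirac[OF e, of "\<lambda>_. 1"] by (simp add: grad_def)
  have "laplacian G \<kappa> g (v 0) = grad G (dirac (v 0)) e"
    using sum_laplacian_zero[of \<kappa> g] one gS
      sum_verts[OF v k, of "laplacian G \<kappa> g"] sum_verts[OF v k, of "\<lambda>x. grad G (dirac x) e"]
    by simp
  then have lg: "laplacian G \<kappa> g x = grad G (dirac x) e" if "x \<in> verts G" for x
    by - (rule verts_induct[OF v k, where P = "\<lambda>x. laplacian G \<kappa> g x = grad G (dirac x) e"];
      use that gS in simp)
  have bil: "(\<Sum>e\<in>edges G. \<kappa> e * grad G g e * grad G f e) = grad G f e" for f
    using sum_laplacian[of f \<kappa> g] lg sum_grad_dirac[OF e, of f] by simp
  define R where "R = grad G g e"
  have E: "energy G \<kappa> g = R"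
    using bil[of g] by (simp add: R_def energy_def power2_eq_square mult.assoc)
  have R: "R \<ge> 0" using energy_nonneg[of \<kappa> g] \<kappa> E by (simp add: less_imp_le)
  show thesis
  proof
    show "R \<ge> 0" "grad G g e = R" "energy G \<kappa> g = R" using R E by (auto simp: R_def)
    fix f
    \<comment> \<open>Cauchy-Schwarz for the energy inner product, in which \<open>g\<close>
      represents the functional sending f to its gradient along \<open>e\<close> (this is
      \<open>bil\<close>). Hence \<open>R\<close> is the best constant in the variational
      description of the resistance.\<close>
    let ?a = "\<lambda>e. sqrt (\<kappa> e) * grad G g e" and ?b = "\<lambda>e. sqrt (\<kappa> e) * grad G f e"
    have "(\<Sum>e\<in>edges G. ?a e * ?b e) = (\<Sum>e\<in>edges G. \<kappa> e * grad G g e * grad G f e)"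
    proof (rule sum.cong[OF refl])
      fix e' assume "e' \<in> edges G"
      then have "sqrt (\<kappa> e') * sqrt (\<kappa> e') = \<kappa> e'" using \<kappa> by (simp add: less_imp_le)
      moreover have "?a e' * ?b e' = (sqrt (\<kappa> e') * sqrt (\<kappa> e')) * grad G g e' * grad G f e'"
        by (simp only: mult_ac)
      ultimately show "?a e' * ?b e' = \<kappa> e' * grad G g e' * grad G f e'" by simp
    qed
    then have "grad G f e = (\<Sum>e\<in>edges G. ?a e * ?b e)" using bil[of f] by simp
    then have "(grad G f e)\<^sup>2 \<le> (\<Sum>e\<in>edges G. (?a e)\<^sup>2) * (\<Sum>e\<in>edges G. (?b e)\<^sup>2)"
      using Cauchy_Schwarz_ineq_sum[of ?a ?b "edges G"] by simp
    also have "(\<Sum>e\<in>edges G. (?a e)\<^sup>2) = energy G \<kappa> g"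
      using \<kappa> by (auto simp: energy_def power_mult_distrib less_imp_le intro!: sum.cong)
    also have "(\<Sum>e\<in>edges G. (?b e)\<^sup>2) = energy G \<kappa> f"
      using \<kappa> by (auto simp: energy_def power_mult_distrib less_imp_le intro!: sum.cong)
    finally show "(grad G f e)\<^sup>2 \<le> R * energy G \<kappa> f" by (simp add: E)
  next
    fix t
    have "lap_mat G (\<kappa>(e := \<kappa> e + t)) v = mat k k (\<lambda>(i, j). ?M $$ (i, j) + t * u i * grad G (root_diff v j) e)"
      using e by (auto simp: lap_mat_def u_def laplacian_upd v_verts[OF v k] k intro!: eq_matI)
    then have "lap_det G (\<kappa>(e := \<kappa> e + t)) = lap_det G \<kappa> * (1 + t * (\<Sum>j<k. grad G (root_diff v j) e * c j))"
      unfolding lap_det_eq[OF v refl] by (simp add: det_rank_one_update[OF M Mc])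
    also have "(\<Sum>j<k. grad G (root_diff v j) e * c j) = R"
      by (simp add: R_def g_def grad_lincomb mult.commute)
    finally show "lap_det G (\<kappa>(e := \<kappa> e + t)) = lap_det G \<kappa> * (1 + t * R)" .
  qed
qed

text \<open>The exponent is the dimension of \<open>H0\<close>. This homogeneity is what later ties
  the surface free energy to the number of vertices lost by wiring.\<close>

lemma lap_det_scale: "lap_det G (\<lambda>e. c * \<kappa> e) = c ^ (card (verts G) - 1) * lap_det G \<kappa>"
proof -
  obtain v where v: "bij_betw v {..<card (verts G)} (verts G)" using vertex_enum by blast
  have "lap_mat G (\<lambda>e. c * \<kappa> e) v = c \<cdot>\<^sub>m lap_mat G \<kappa> v"
    by (rule eq_matI) (auto simp: lap_mat_def laplacian_def sum_distrib_left mult.assoc)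
  then show ?thesis unfolding lap_det_eq[OF v refl] by (simp add: lap_mat_def)
qed

lemma lap_det_measurable:
  assumes "\<And>e. e \<in> edges G \<Longrightarrow> (\<lambda>\<kappa>. \<kappa> e) \<in> borel_measurable M"
  shows "lap_det G \<in> borel_measurable M"
proof -
  obtain v where v: "bij_betw v {..<card (verts G)} (verts G)" using vertex_enum by blast
  have [measurable]: "(\<lambda>\<kappa>. laplacian G \<kappa> f x) \<in> borel_measurable M" for f x
    unfolding laplacian_def using assms by measurable
  have "lap_det G = (\<lambda>\<kappa>. Determinant.det (lap_mat G \<kappa> v))" using lap_det_eq[OF v refl] by blast
  also have "\<dots> \<in> borel_measurable M"
  proof -
    let ?n = "card (verts G) - 1"
    have "(\<lambda>\<kappa>. lap_mat G \<kappa> v $$ (i, p i)) \<in> borel_measurable M"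
      if "p permutes {0..<?n}" "i \<in> {0..<?n}" for p i
    proof -
      have "p i \<in> {0..<?n}" using that by (simp only: permutes_in_image)
      then show ?thesis using that by (simp add: lap_mat_def)
    qed
    then have "(\<lambda>\<kappa>. \<Sum>p\<in>{p. p permutes {0..<?n}}. signof p * (\<Prod>i = 0..<?n. lap_mat G \<kappa> v $$ (i, p i)))
      \<in> borel_measurable M"
      by (intro borel_measurable_sum borel_measurable_times borel_measurable_prod borel_measurable_const) auto
    then show ?thesis by (subst det_def'[where n = ?n]) (simp_all add: lap_mat_def)
  qed
  finally show ?thesis .
qed


text \<open>Keeping only the term of \<open>e\<close> in the energy of its potential gives
  \<kappa>_e R^2 \<le> R, so the resistance is at most that of the edge alone, 1/\<kappa>_e. The
  number \<open>r\<close> is 1 + t R.\<close>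

lemma effective_resistance_le:
  assumes \<kappa>: "\<forall>e\<in>edges G. \<kappa> e > 0" and e: "e \<in> edges G" and t: "t \<ge> 0"
  obtains r where "r \<ge> 1" "r * \<kappa> e \<le> \<kappa> e + t"
    "\<bar>lap_det G (\<kappa>(e := \<kappa> e + t))\<bar> = \<bar>lap_det G \<kappa>\<bar> * r"
proof -
  obtain R g where R: "R \<ge> 0" "grad G g e = R" "energy G \<kappa> g = R"
    "\<And>f. (grad G f e)\<^sup>2 \<le> R * energy G \<kappa> f"
    "\<And>t. lap_det G (\<kappa>(e := \<kappa> e + t)) = lap_det G \<kappa> * (1 + t * R)"
    using effective_resistance[OF \<kappa> e] by blast
  have "\<kappa> e * (grad G g e)\<^sup>2 \<le> energy G \<kappa> g"
    unfolding energy_def using \<kappa> e finite_edges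
    by (intro member_le_sum[where f = "\<lambda>e. \<kappa> e * (grad G g e)\<^sup>2"]) (auto simp: less_imp_le)
  then have "R * (\<kappa> e * R) \<le> R * 1" using R by (simp add: power2_eq_square mult_ac)
  then have "\<kappa> e * R \<le> 1" using R(1) by (cases "R = 0") (auto simp: mult_le_cancel_left)
  then have "t * (\<kappa> e * R) \<le> t * 1" using t by (rule mult_left_mono)
  then have "(1 + t * R) * \<kappa> e \<le> \<kappa> e + t" by (simp add: algebra_simps)
  moreover have "1 + t * R \<ge> 1" using t R by simp
  moreover have "\<bar>lap_det G (\<kappa>(e := \<kappa> e + t))\<bar> = \<bar>lap_det G \<kappa>\<bar> * (1 + t * R)"
    unfolding R(5) abs_mult using calculation(2) by simp
  ultimately show thesis using that by blast
qed

text \<open>The real logarithm is extended evenly to negative arguments, so \<open>powr\<close> sees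
  only the absolute value of the determinant. Nonvanishing therefore already makes the weight
  positive.\<close>

lemma s_weight_eq: "s_weight G \<kappa> = \<bar>lap_det G \<kappa>\<bar> powr (-1/2)"
  by (cases "lap_det G \<kappa> < 0") (simp_all add: s_weight_def lap_det_def[symmetric] powr_def ln_minus)

lemma s_weight_pos: "\<forall>e\<in>edges G. \<kappa> e > 0 \<Longrightarrow> s_weight G \<kappa> > 0"
  using lap_det_nonzero[of \<kappa>] by (simp add: s_weight_eq)

lemma s_weight_measurable:
  assumes "\<And>e. e \<in> edges G \<Longrightarrow> (\<lambda>\<kappa>. \<kappa> e) \<in> borel_measurable M"
  shows "s_weight G \<in> borel_measurable M"
proof -
  have [measurable]: "lap_det G \<in> borel_measurable M" by (rule lap_det_measurable[OF assms])
  have "s_weight G = (\<lambda>\<kappa>. \<bar>lap_det G \<kappa>\<bar> powr (-1/2))" using s_weight_eq by blast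
  then show ?thesis by simp
qed

lemma s_weight_upd:
  assumes \<kappa>: "\<forall>e\<in>edges G. \<kappa> e > 0" and e: "e \<in> edges G" and t: "t \<ge> 0"
  shows "s_weight G (\<kappa>(e := \<kappa> e + t)) \<le> s_weight G \<kappa>"
    "s_weight G \<kappa> \<le> sqrt ((\<kappa> e + t) / \<kappa> e) * s_weight G (\<kappa>(e := \<kappa> e + t))"
proof -
  obtain r where r: "r \<ge> 1" "r * \<kappa> e \<le> \<kappa> e + t"
    "\<bar>lap_det G (\<kappa>(e := \<kappa> e + t))\<bar> = \<bar>lap_det G \<kappa>\<bar> * r"
    using effective_resistance_le[OF assms] by blast
  have s: "s_weight G (\<kappa>(e := \<kappa> e + t)) = s_weight G \<kappa> * r powr (-1/2)"
    using r by (simp add: s_weight_eq powr_mult)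
  have p: "s_weight G \<kappa> > 0" by (rule s_weight_pos[OF \<kappa>])
  have rp: "r powr (-1/2) = 1 / sqrt r" using r(1) by (simp add: powr_minus_divide powr_half_sqrt)
  have "1 / sqrt r \<le> 1" using r(1) by simp
  then show "s_weight G (\<kappa>(e := \<kappa> e + t)) \<le> s_weight G \<kappa>"
    using mult_left_mono[of "1 / sqrt r" 1 "s_weight G \<kappa>"] p unfolding s rp by simp
  have "r \<le> (\<kappa> e + t) / \<kappa> e" using r(2) bspec[OF \<kappa> e] by (simp add: pos_le_divide_eq)
  then have "sqrt r \<le> sqrt ((\<kappa> e + t) / \<kappa> e)" by simp
  then have "s_weight G \<kappa> * (sqrt r / sqrt r) \<le> s_weight G \<kappa> * (sqrt ((\<kappa> e + t) / \<kappa> e) / sqrt r)"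
    using p r(1) by (intro mult_left_mono divide_right_mono) auto
  then show "s_weight G \<kappa> \<le> sqrt ((\<kappa> e + t) / \<kappa> e) * s_weight G (\<kappa>(e := \<kappa> e + t))"
    using r(1) unfolding s rp by (simp add: mult_ac)
qed

lemma s_weight_cong: "(\<And>e. e \<in> edges G \<Longrightarrow> \<kappa> e = \<kappa>' e) \<Longrightarrow> s_weight G \<kappa> = s_weight G \<kappa>'"
  unfolding s_weight_eq by (subst lap_det_cong[of G \<kappa> \<kappa>']) auto

lemma s_weight_scale:
  "c > 0 \<Longrightarrow> s_weight G (\<lambda>e. c * \<kappa> e) = c powr (- real (card (verts G) - 1) / 2) * s_weight G \<kappa>"
  unfolding s_weight_eq lap_det_scale
  by (simp add: abs_mult powr_mult powr_powr flip: powr_realpow)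

text \<open>Edges of \<open>F\<close> are altered one at a time, each at the cost of a factor
  \<open>sqrt (b / a)\<close>. The bound does not involve the graph, which later makes densities of
  marginals bounded uniformly in the box.\<close>

lemma s_weight_local_change:
  assumes F: "finite F" and l: "0 < a" "a \<le> b"
    and x: "\<And>e. e \<in> edges G \<Longrightarrow> a \<le> x e \<and> x e \<le> b" and y: "\<And>e. e \<in> edges G \<Longrightarrow> a \<le> y e \<and> y e \<le> b"
    and xy: "\<And>e. e \<in> edges G - F \<Longrightarrow> x e = y e"
  shows "s_weight G x \<le> sqrt (b / a) ^ card F * s_weight G y"
  using F x xy
proof (induction F arbitrary: x)
  case empty
  then have "s_weight G x = s_weight G y" by (intro s_weight_cong) auto
  then show ?case by simp
next
  case (insert e F)
  show ?case
  proof (cases "e \<in> edges G")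
    case False
    have ypos: "s_weight G y > 0" using y l by (intro s_weight_pos) (auto intro: less_le_trans)
    have "s_weight G x \<le> sqrt (b / a) ^ card F * s_weight G y"
      using insert.prems False by (intro insert.IH) auto
    also have "\<dots> \<le> sqrt (b / a) ^ card (insert e F) * s_weight G y"
      using insert.hyps l s_weight_pos[of y] y l by (intro mult_right_mono power_increasing)
        (auto intro!: less_imp_le[OF s_weight_pos] dest!: y intro: less_le_trans)
    finally show ?thesis .
  next
    case True
    let ?z = "x(e := y e)"
    have pos: "\<forall>f\<in>edges G. x f > 0" "\<forall>f\<in>edges G. ?z f > 0"
      using insert.prems(1) y l by (auto intro: less_le_trans)
    have ab: "1 \<le> sqrt (b / a)" using l by simp
    have zp: "s_weight G ?z > 0" by (rule s_weight_pos[OF pos(2)])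
    have "s_weight G x \<le> sqrt (b / a) * s_weight G ?z"
    proof (cases "x e \<le> y e")
      case T: True
      have "s_weight G x \<le> sqrt (y e / x e) * s_weight G ?z"
        using s_weight_upd(2)[OF pos(1) True, where t = "y e - x e"] T by simp
      also have "\<dots> \<le> sqrt (b / a) * s_weight G ?z"
        using y[OF True] insert.prems(1)[OF True] l
        by (intro mult_right_mono real_sqrt_le_mono frac_le less_imp_le[OF zp]) auto
      finally show ?thesis .
    next
      case T: False
      have "s_weight G x \<le> s_weight G ?z"
        using s_weight_upd(1)[of ?z, OF pos(2) True, of "x e - y e"] T by simp
      also have "\<dots> \<le> sqrt (b / a) * s_weight G ?z"
        using mult_right_mono[OF ab less_imp_le[OF zp]] by simp
      finally show ?thesis .
    qed
    also have "s_weight G ?z \<le> sqrt (b / a) ^ card F * s_weight G y"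
      using insert.prems y by (intro insert.IH) auto
    finally show ?thesis using ab insert.hyps by (simp add: mult.assoc)
  qed
qed

end

section \<open>Contractions of graphs and Rayleigh monotonicity\<close>

definition collapses :: "('v \<Rightarrow> 'w) \<Rightarrow> ('v, 'e) multigraph \<Rightarrow> ('w, 'e) multigraph \<Rightarrow> 'e set \<Rightarrow> bool" where
  "collapses \<phi> G1 G2 E \<longleftrightarrow> E \<subseteq> edges G1 \<and> E \<subseteq> edges G2 \<and> (\<forall>e\<in>E. ends G2 e = \<phi> ` ends G1 e) \<and>
     (\<forall>e\<in>edges G1 - E. \<exists>z. \<phi> ` ends G1 e = {z})"

text \<open>One notion covers three comparisons: a box inside a larger free box (identity map, extra
  edges in \<open>G2\<close>), a free box and its wiring, and a large wired box mapped onto a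
  smaller one (edges outside \<open>E\<close> become loops). In each case \<open>G2\<close> conducts
  better across the edges of \<open>E\<close>.\<close>

locale collapse = G1: connected_multigraph G1 + G2: connected_multigraph G2
  for G1 :: "('v, 'e) multigraph" and G2 :: "('w, 'e) multigraph" +
  fixes \<phi> E
  assumes collapses: "collapses \<phi> G1 G2 E"
begin

lemma E_sub: "E \<subseteq> edges G1" "E \<subseteq> edges G2"
  using collapses by (auto simp: collapses_def)

lemma grad_collapse:
  assumes "e \<in> E" shows "(grad G1 (f \<circ> \<phi>) e)\<^sup>2 = (grad G2 f e)\<^sup>2"
proof -
  have e: "e \<in> edges G1" "e \<in> edges G2" using assms E_sub by auto
  have "{fst (orient G2 e), snd (orient G2 e)} = {\<phi> (fst (orient G1 e)), \<phi> (snd (orient G1 e))}"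
    using collapses assms G1.ends_orient[OF e(1)] G2.ends_orient[OF e(2)] by (auto simp: collapses_def)
  then show ?thesis by (auto simp: grad_def doubleton_eq_iff power2_commute)
qed

lemma grad_loop:
  assumes "e \<in> edges G1 - E" shows "grad G1 (f \<circ> \<phi>) e = 0"
proof -
  obtain z where "\<phi> ` ends G1 e = {z}" using collapses assms unfolding collapses_def by blast
  then show ?thesis using G1.ends_orient[of e] assms by (auto simp: grad_def)
qed

lemma energy_collapse:
  assumes 2: "\<forall>e\<in>edges G2. \<kappa>2 e > 0" and 12: "\<forall>e\<in>E. \<kappa>1 e \<le> \<kappa>2 e"
  shows "energy G1 \<kappa>1 (f \<circ> \<phi>) \<le> energy G2 \<kappa>2 f"
proof -
  have "energy G1 \<kappa>1 (f \<circ> \<phi>) = (\<Sum>e\<in>E. \<kappa>1 e * (grad G1 (f \<circ> \<phi>) e)\<^sup>2)"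
    unfolding energy_def using E_sub grad_loop G1.finite_edges by (intro sum.mono_neutral_right) auto
  also have "\<dots> \<le> (\<Sum>e\<in>E. \<kappa>2 e * (grad G2 f e)\<^sup>2)"
    by (intro sum_mono) (simp add: grad_collapse 12 mult_right_mono)
  also have "\<dots> \<le> energy G2 \<kappa>2 f"
    unfolding energy_def using E_sub G2.finite_edges 2 by (intro sum_mono2) (auto simp: less_imp_le)
  finally show ?thesis .
qed

text \<open>The two ratios are \<open>1 + t R\<close> with \<open>R\<close> the effective resistance, so this is Rayleigh monotonicity.\<close>

lemma lap_det_ratio:
  assumes 1: "\<forall>e\<in>edges G1. \<kappa>1 e > 0" and 2: "\<forall>e\<in>edges G2. \<kappa>2 e > 0"
    and 12: "\<forall>e\<in>E. \<kappa>1 e \<le> \<kappa>2 e" and e: "e \<in> E" and t: "t \<ge> 0"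
  obtains r1 r2 where "1 \<le> r2" "r2 \<le> r1"
    "\<bar>lap_det G1 (\<kappa>1(e := \<kappa>1 e + t))\<bar> = \<bar>lap_det G1 \<kappa>1\<bar> * r1"
    "\<bar>lap_det G2 (\<kappa>2(e := \<kappa>2 e + t))\<bar> = \<bar>lap_det G2 \<kappa>2\<bar> * r2"
proof -
  have ee: "e \<in> edges G1" "e \<in> edges G2" using e E_sub by auto
  obtain R1 g1 where R1: "R1 \<ge> 0" "grad G1 g1 e = R1" "energy G1 \<kappa>1 g1 = R1" "\<And>f. (grad G1 f e)\<^sup>2 \<le> R1 * energy G1 \<kappa>1 f"
    "\<And>t. lap_det G1 (\<kappa>1(e := \<kappa>1 e + t)) = lap_det G1 \<kappa>1 * (1 + t * R1)"
    using G1.effective_resistance[OF 1 ee(1)] by blast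
  obtain R2 g where R2: "R2 \<ge> 0" "grad G2 g e = R2" "energy G2 \<kappa>2 g = R2"
    "\<And>f. (grad G2 f e)\<^sup>2 \<le> R2 * energy G2 \<kappa>2 f"
    "\<And>t. lap_det G2 (\<kappa>2(e := \<kappa>2 e + t)) = lap_det G2 \<kappa>2 * (1 + t * R2)"
    using G2.effective_resistance[OF 2 ee(2)] by blast
  have "R2\<^sup>2 = (grad G1 (g \<circ> \<phi>) e)\<^sup>2" using grad_collapse[OF e] R2 by simp
  \<comment> \<open>The potential of \<open>G2\<close>, pulled back along the contraction, is a test
    function for the resistance in \<open>G1\<close>; its energy there is at most R2.\<close>
  also have "\<dots> \<le> R1 * energy G1 \<kappa>1 (g \<circ> \<phi>)" by (rule R1(4))
  also have "\<dots> \<le> R1 * R2" using energy_collapse[OF 2 12, of g] R1(1) R2(3) by (intro mult_left_mono) auto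
  finally have "R2 * R2 \<le> R1 * R2" by (simp add: power2_eq_square)
  then have "R2 \<le> R1" using R1(1) R2(1) by (cases "R2 = 0") (auto simp: mult_le_cancel_right)
  then have "t * R2 \<le> t * R1" using t by (rule mult_left_mono)
  then have r: "1 + t * R2 \<le> 1 + t * R1" "1 \<le> 1 + t * R2" using t R2(1) by auto
  show thesis
    by (rule that[OF r(2,1)]) (use r in \<open>auto simp: R1(5) R2(5) abs_mult\<close>)
qed

text \<open>On \<open>E\<close> one has x - min x y = max x y - y, so the minimum is raised to x in
  \<open>G1\<close> and y to the maximum in \<open>G2\<close> by the same increments. They are
  carried out edge by edge; the configuration on \<open>G1\<close> stays below the one on
  \<open>G2\<close> on \<open>E\<close>, so each increment multiplies the determinant of
  \<open>G1\<close> by at least as much as that of \<open>G2\<close>. The power -1/2 reverses the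
  inequality.\<close>

lemma s_weight_lattice:
  assumes x: "\<forall>e\<in>edges G1. x e > 0" and y: "\<forall>e\<in>edges G2. y e > 0"
  shows "s_weight G1 x * s_weight G2 y \<le>
    s_weight G1 (\<lambda>e. if e \<in> E then min (x e) (y e) else x e) *
    s_weight G2 (\<lambda>e. if e \<in> E then max (x e) (y e) else y e)"
proof -
  define lo where "lo = (\<lambda>e. if e \<in> E then min (x e) (y e) else x e)"
  define hi where "hi = (\<lambda>e. if e \<in> E then max (x e) (y e) else y e)"
  define xx where "xx A e = (if e \<in> A then x e else lo e)" for A e
  define yy where "yy A e = (if e \<in> A then hi e else y e)" for A e
  have lox: "\<forall>e\<in>edges G1. lo e > 0" using x y E_sub by (auto simp: lo_def min_def)
  have hiy: "\<forall>e\<in>edges G2. hi e > 0" using x y E_sub by (auto simp: hi_def max_def)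
  have "finite E" using E_sub G1.finite_edges finite_subset by blast
  then have "\<bar>lap_det G1 lo\<bar> * \<bar>lap_det G2 (yy E)\<bar> \<le> \<bar>lap_det G1 (xx E)\<bar> * \<bar>lap_det G2 y\<bar>"
  proof (induction rule: finite_subset_induct[where A = E, consumes 1, case_names subset 1 2])
    case subset show ?case by simp
  next
    case 1 then show ?case by (simp add: xx_def[abs_def] yy_def[abs_def])
  next
    case (2 e A)
    define t where "t = x e - lo e"
    have t: "t \<ge> 0" by (simp add: t_def lo_def)
    have X: "xx (insert e A) = (xx A)(e := xx A e + t)"
      using 2 by (auto simp: xx_def t_def)
    have Y: "yy (insert e A) = (yy A)(e := yy A e + t)"
      using 2 by (auto simp: fun_eq_iff yy_def t_def hi_def lo_def min_def max_def)
    obtain r1 r2 where r: "1 \<le> r2" "r2 \<le> r1"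
      "\<bar>lap_det G1 (xx (insert e A))\<bar> = \<bar>lap_det G1 (xx A)\<bar> * r1"
      "\<bar>lap_det G2 (yy (insert e A))\<bar> = \<bar>lap_det G2 (yy A)\<bar> * r2"
      unfolding X Y
    proof (rule lap_det_ratio[of "xx A" "yy A" e t])
      show "\<forall>e\<in>edges G1. xx A e > 0" using lox x by (auto simp: xx_def)
      show "\<forall>e\<in>edges G2. yy A e > 0" using hiy y by (auto simp: yy_def)
      show "\<forall>f\<in>E. xx A f \<le> yy A f" by (auto simp: xx_def yy_def hi_def lo_def)
    qed (use 2 t in auto)
    have "\<bar>lap_det G1 lo\<bar> * \<bar>lap_det G2 (yy A)\<bar> * r2 \<le> \<bar>lap_det G1 (xx A)\<bar> * \<bar>lap_det G2 y\<bar> * r1"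
      by (rule mult_mono) (use 2 r in auto)
    then show ?case unfolding r(3,4) by (simp add: mult_ac)
  qed
  moreover have "xx E = x" by (auto simp: xx_def lo_def)
  moreover have "yy E = hi" by (auto simp: yy_def hi_def)
  ultimately have le: "\<bar>lap_det G1 lo\<bar> * \<bar>lap_det G2 hi\<bar> \<le> \<bar>lap_det G1 x\<bar> * \<bar>lap_det G2 y\<bar>" by simp
  have "0 < \<bar>lap_det G1 lo\<bar> * \<bar>lap_det G2 hi\<bar>"
    using G1.lap_det_nonzero[OF lox] G2.lap_det_nonzero[OF hiy] by simp
  then have "(\<bar>lap_det G1 x\<bar> * \<bar>lap_det G2 y\<bar>) powr (-1/2) \<le> (\<bar>lap_det G1 lo\<bar> * \<bar>lap_det G2 hi\<bar>) powr (-1/2)"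
    using le by (intro powr_mono2') auto
  then show ?thesis
    unfolding lo_def[symmetric] hi_def[symmetric] by (simp add: G1.s_weight_eq G2.s_weight_eq powr_mult)
qed

end

lemma lap_det_iso:
  assumes G1: "connected_multigraph G1" and G2: "connected_multigraph G2"
    and \<phi>: "inj_on \<phi> (verts G1)" "verts G2 = \<phi> ` verts G1"
    and \<psi>: "inj_on \<psi> (edges G1)" "edges G2 = \<psi> ` edges G1"
    and ends: "\<And>e. e \<in> edges G1 \<Longrightarrow> ends G2 (\<psi> e) = \<phi> ` ends G1 e"
  shows "lap_det G2 \<kappa> = lap_det G1 (\<kappa> \<circ> \<psi>)"
proof -
  interpret G1: connected_multigraph G1 by fact
  interpret G2: connected_multigraph G2 by fact
  have lap: "laplacian G2 \<kappa> f (\<phi> x) = laplacian G1 (\<kappa> \<circ> \<psi>) h x"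
    if x: "x \<in> verts G1" and h: "\<And>y. y \<in> verts G1 \<Longrightarrow> h y = f (\<phi> y)" for f h x
  proof -
    have "(\<Sum>e\<in>{e \<in> edges G2. ends G2 e = {\<phi> x, \<phi> y}}. \<kappa> e * (f (\<phi> x) - f (\<phi> y))) =
      (\<Sum>e\<in>{e \<in> edges G1. ends G1 e = {x, y}}. (\<kappa> \<circ> \<psi>) e * (h x - h y))" (is "sum _ ?A = sum _ ?B")
      if y: "y \<in> verts G1" for y
    proof -
      have "ends G2 (\<psi> e) = {\<phi> x, \<phi> y} \<longleftrightarrow> ends G1 e = {x, y}" if "e \<in> edges G1" for e
      proof -
        have "ends G1 e \<subseteq> verts G1" using G1.ends_ex[OF that] by auto
        moreover have "{x, y} \<subseteq> verts G1" using x y by simp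
        ultimately have "\<phi> ` ends G1 e = \<phi> ` {x, y} \<longleftrightarrow> ends G1 e = {x, y}"
          by (rule inj_on_image_eq_iff[OF \<phi>(1)])
        then show ?thesis unfolding ends[OF that] by simp
      qed
      then have "?A = \<psi> ` ?B" unfolding \<psi>(2) by blast
      moreover have "inj_on \<psi> ?B" using \<psi>(1) by (rule inj_on_subset) blast
      ultimately show ?thesis unfolding h[OF x] h[OF y] by (simp only: sum.reindex o_def)
    qed
    then show ?thesis using x unfolding laplacian_def \<phi>(2) by (simp add: sum.reindex[OF \<phi>(1)])
  qed
  obtain v where v: "bij_betw v {..<card (verts G1)} (verts G1)" using G1.vertex_enum by blast
  have card: "card (verts G2) = card (verts G1)" using \<phi> by (simp add: card_image)
  have v2: "bij_betw (\<phi> \<circ> v) {..<card (verts G2)} (verts G2)"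
    unfolding card using v \<phi> by (intro bij_betw_trans[OF v]) (simp add: bij_betw_def)
  have "lap_mat G2 \<kappa> (\<phi> \<circ> v) = lap_mat G1 (\<kappa> \<circ> \<psi>) v"
  proof (rule eq_matI)
    fix i j assume "i < dim_row (lap_mat G1 (\<kappa> \<circ> \<psi>) v)" "j < dim_col (lap_mat G1 (\<kappa> \<circ> \<psi>) v)"
    then have ij: "i < card (verts G1) - 1" "j < card (verts G1) - 1" by (auto simp: lap_mat_def)
    then have vs: "v (Suc i) \<in> verts G1" "v (Suc j) \<in> verts G1" "v 0 \<in> verts G1"
      using G1.v_verts[OF v refl] by auto
    have "laplacian G2 \<kappa> (root_diff (\<phi> \<circ> v) j) (\<phi> (v (Suc i))) =
      laplacian G1 (\<kappa> \<circ> \<psi>) (root_diff v j) (v (Suc i))"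
    proof (rule lap[OF vs(1)])
      fix y assume "y \<in> verts G1"
      then show "root_diff v j y = root_diff (\<phi> \<circ> v) j (\<phi> y)"
        using vs by (simp add: inj_on_eq_iff[OF \<phi>(1)])
    qed
    then show "lap_mat G2 \<kappa> (\<phi> \<circ> v) $$ (i, j) = lap_mat G1 (\<kappa> \<circ> \<psi>) v $$ (i, j)"
      using ij by (simp add: lap_mat_def card)
  qed (auto simp: lap_mat_def card)
  then show ?thesis by (simp add: G1.lap_det_eq[OF v refl] G2.lap_det_eq[OF v2 refl])
qed


section \<open>The four functions theorem and Holley's inequality\<close>

text \<open>Numerical core of the four functions theorem: (M - p)(M - q) \<ge> 0 gives M (p + q)
  \<le> M M + p q \<le> M (M + N), and M cancels.\<close>

lemma ennreal_add_le_of_mult_le: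
  fixes p q M N :: ennreal
  assumes "p \<le> M" "q \<le> M" "p * q \<le> M * N"
  shows "p + q \<le> M + N"
proof (cases "M = \<top> \<or> N = \<top>")
  case False
  have "p < \<top>" "q < \<top>" using assms False by (auto simp: less_top le_less_trans)
  then obtain p' q' where p: "p = ennreal p'" "p' \<ge> 0" and q: "q = ennreal q'" "q' \<ge> 0"
    by (metis ennreal_cases less_top)
  obtain m n where m: "M = ennreal m" "m \<ge> 0" and n: "N = ennreal n" "n \<ge> 0"
    using False by (metis ennreal_cases)
  have *: "p' \<le> m" "q' \<le> m" "p' * q' \<le> m * n"
    using assms p q m n by (auto simp: ennreal_mult[symmetric])
  have "p' + q' \<le> m + n"
  proof (cases "m = 0")
    case True then show ?thesis using * p q n by auto
  next
    case False
    have "0 \<le> (m - p') * (m - q')" using * by simp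
    then have "m * (p' + q') \<le> m * (m + n)" using *(3) by (simp add: algebra_simps)
    then show ?thesis using False m by simp
  qed
  then show ?thesis using p q m n by (simp flip: ennreal_plus)
qed auto

text \<open>Twice a product of integrals is the integral of the symmetrized product over pairs. For
  s \<le> t both f1 s f2 t and f1 t f2 s lie below f3 t f4 s, and their product is bounded by means
  of the two diagonal inequalities, so the numerical lemma applies pointwise.\<close>

lemma four_functions_1d:
  fixes M :: "real measure" and f1 f2 f3 f4 :: "real \<Rightarrow> ennreal"
  assumes M: "sigma_finite_measure M"
    and [measurable]: "f1 \<in> borel_measurable M" "f2 \<in> borel_measurable M"
      "f3 \<in> borel_measurable M" "f4 \<in> borel_measurable M"
    and le: "\<And>s t. s \<in> space M \<Longrightarrow> t \<in> space M \<Longrightarrow> f1 s * f2 t \<le> f3 (max s t) * f4 (min s t)"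
  shows "(\<integral>\<^sup>+x. f1 x \<partial>M) * (\<integral>\<^sup>+x. f2 x \<partial>M) \<le> (\<integral>\<^sup>+x. f3 x \<partial>M) * (\<integral>\<^sup>+x. f4 x \<partial>M)"
proof -
  interpret sigma_finite_measure M by fact
  have pt: "f1 s * f2 t + f1 t * f2 s \<le> f3 s * f4 t + f3 t * f4 s"
    if "s \<in> space M" "t \<in> space M" "s \<le> t" for s t
  proof -
    have "(f1 s * f2 t) * (f1 t * f2 s) = (f1 s * f2 s) * (f1 t * f2 t)" by (simp only: mult_ac)
    also have "\<dots> \<le> (f3 s * f4 s) * (f3 t * f4 t)"
      by (rule mult_mono) (use le[of s s] le[of t t] that in auto)
    finally have "(f1 s * f2 t) * (f1 t * f2 s) \<le> (f3 t * f4 s) * (f3 s * f4 t)" by (simp only: mult_ac)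
    from ennreal_add_le_of_mult_le[OF _ _ this] show ?thesis
      using le[of s t] le[of t s] that by (simp add: max_def min_def add.commute split: if_splits)
  qed
  have pt2: "f1 s * f2 t + f1 t * f2 s \<le> f3 s * f4 t + f3 t * f4 s"
    if "s \<in> space M" "t \<in> space M" for s t
    using pt[of s t] pt[of t s] that by (cases "s \<le> t") (auto simp: add.commute)
  have dbl: "(\<integral>\<^sup>+s. \<integral>\<^sup>+t. (f s * g t + f t * g s) \<partial>M \<partial>M) = 2 * ((\<integral>\<^sup>+x. f x \<partial>M) * (\<integral>\<^sup>+x. g x \<partial>M))"
    if [measurable]: "f \<in> borel_measurable M" "g \<in> borel_measurable M" for f g :: "real \<Rightarrow> ennreal"
  proof -
    have "(\<integral>\<^sup>+s. \<integral>\<^sup>+t. (f s * g t + f t * g s) \<partial>M \<partial>M) =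
      (\<integral>\<^sup>+s. (f s * (\<integral>\<^sup>+x. g x \<partial>M) + (\<integral>\<^sup>+x. f x \<partial>M) * g s) \<partial>M)"
      by (simp add: nn_integral_add nn_integral_cmult nn_integral_multc)
    also have "\<dots> = (\<integral>\<^sup>+x. f x \<partial>M) * (\<integral>\<^sup>+x. g x \<partial>M) + (\<integral>\<^sup>+x. f x \<partial>M) * (\<integral>\<^sup>+x. g x \<partial>M)"
      by (simp add: nn_integral_add nn_integral_cmult nn_integral_multc)
    finally show ?thesis by (simp add: mult_2)
  qed
  have "(\<integral>\<^sup>+s. \<integral>\<^sup>+t. (f1 s * f2 t + f1 t * f2 s) \<partial>M \<partial>M) \<le> (\<integral>\<^sup>+s. \<integral>\<^sup>+t. (f3 s * f4 t + f3 t * f4 s) \<partial>M \<partial>M)"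
    by (intro nn_integral_mono pt2)
  then show ?thesis by (simp add: dbl ennreal_mult_le_mult_iff)
qed

text \<open>The Ahlswede-Daykin theorem, by induction on the coordinates: integrating out one of
  them preserves the hypothesis, by the one-dimensional case.\<close>

lemma four_functions:
  fixes \<rho> :: "real measure" and f1 f2 f3 f4 :: "('i \<Rightarrow> real) \<Rightarrow> ennreal"
  assumes \<rho>: "prob_space \<rho>" and I: "finite I"
    and "f1 \<in> borel_measurable (\<Pi>\<^sub>M i\<in>I. \<rho>)" "f2 \<in> borel_measurable (\<Pi>\<^sub>M i\<in>I. \<rho>)"
      "f3 \<in> borel_measurable (\<Pi>\<^sub>M i\<in>I. \<rho>)" "f4 \<in> borel_measurable (\<Pi>\<^sub>M i\<in>I. \<rho>)"
    and "\<And>x y. x \<in> space (\<Pi>\<^sub>M i\<in>I. \<rho>) \<Longrightarrow> y \<in> space (\<Pi>\<^sub>M i\<in>I. \<rho>) \<Longrightarrow>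
      f1 x * f2 y \<le> f3 (\<lambda>i\<in>I. max (x i) (y i)) * f4 (\<lambda>i\<in>I. min (x i) (y i))"
  shows "(\<integral>\<^sup>+x. f1 x \<partial>(\<Pi>\<^sub>M i\<in>I. \<rho>)) * (\<integral>\<^sup>+x. f2 x \<partial>(\<Pi>\<^sub>M i\<in>I. \<rho>)) \<le>
    (\<integral>\<^sup>+x. f3 x \<partial>(\<Pi>\<^sub>M i\<in>I. \<rho>)) * (\<integral>\<^sup>+x. f4 x \<partial>(\<Pi>\<^sub>M i\<in>I. \<rho>))"
  using I assms(3-)
proof (induction I arbitrary: f1 f2 f3 f4)
  interpret prob_space \<rho> by fact
  interpret product_sigma_finite "\<lambda>_::'i. \<rho>" ..
  case empty
  have "restrict x {} = (\<lambda>_. undefined)" for x :: "'i \<Rightarrow> real" by (simp add: restrict_def)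
  then show ?case using empty(5)[of "\<lambda>_. undefined" "\<lambda>_. undefined"]
    by (simp add: PiM_empty nn_integral_count_space_finite)
next
  interpret prob_space \<rho> by fact
  interpret product_sigma_finite "\<lambda>_::'i. \<rho>" ..
  case (insert j I)
  note [measurable] = insert.prems(1-4)
  have upd: "x(j := s) \<in> space (\<Pi>\<^sub>M i\<in>insert j I. \<rho>)" if "x \<in> space (\<Pi>\<^sub>M i\<in>I. \<rho>)" "s \<in> space \<rho>" for x s
    using that by (auto simp: space_PiM PiE_iff extensional_def)
  have meas: "(\<lambda>s. f (x(j := s))) \<in> borel_measurable \<rho>"
    if "f \<in> borel_measurable (\<Pi>\<^sub>M i\<in>insert j I. \<rho>)" "x \<in> space (\<Pi>\<^sub>M i\<in>I. \<rho>)"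
    for f :: "_ \<Rightarrow> ennreal" and x
    using measurable_comp[OF measurable_component_update[OF that(2) insert.hyps(2)] that(1)]
    by (simp add: comp_def)
  have M: "(\<lambda>x. \<integral>\<^sup>+s. f (x(j := s)) \<partial>\<rho>) \<in> borel_measurable (\<Pi>\<^sub>M i\<in>I. \<rho>)"
    if [measurable]: "f \<in> borel_measurable (\<Pi>\<^sub>M i\<in>insert j I. \<rho>)" for f :: "_ \<Rightarrow> ennreal"
    by measurable
  show ?case
    unfolding insert.prems(1-4)[THEN product_nn_integral_insert[OF insert.hyps]]
  proof (rule insert.IH)
    fix x y assume x: "x \<in> space (\<Pi>\<^sub>M i\<in>I. \<rho>)" and y: "y \<in> space (\<Pi>\<^sub>M i\<in>I. \<rho>)"
    let ?u = "\<lambda>i\<in>I. max (x i) (y i)" and ?l = "\<lambda>i\<in>I. min (x i) (y i)"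
    have ul: "?u \<in> space (\<Pi>\<^sub>M i\<in>I. \<rho>)" "?l \<in> space (\<Pi>\<^sub>M i\<in>I. \<rho>)"
      using x y by (auto simp: space_PiM PiE_iff max_def min_def)
    show "(\<integral>\<^sup>+s. f1 (x(j := s)) \<partial>\<rho>) * (\<integral>\<^sup>+s. f2 (y(j := s)) \<partial>\<rho>) \<le>
      (\<integral>\<^sup>+s. f3 (?u(j := s)) \<partial>\<rho>) * (\<integral>\<^sup>+s. f4 (?l(j := s)) \<partial>\<rho>)"
    proof (rule four_functions_1d)
      show "sigma_finite_measure \<rho>" ..
      fix s t assume st: "s \<in> space \<rho>" "t \<in> space \<rho>"
      have e1: "(\<lambda>i\<in>insert j I. max ((x(j := s)) i) ((y(j := t)) i)) = ?u(j := max s t)"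
        and e2: "(\<lambda>i\<in>insert j I. min ((x(j := s)) i) ((y(j := t)) i)) = ?l(j := min s t)"
        using insert.hyps by (auto simp: fun_eq_iff)
      show "f1 (x(j := s)) * f2 (y(j := t)) \<le> f3 (?u(j := max s t)) * f4 (?l(j := min s t))"
        using insert.prems(5)[OF upd[OF x st(1)] upd[OF y st(2)]] unfolding e1 e2 .
    qed (use insert.prems x y ul meas in auto)
  qed (rule M[OF insert.prems(1)] M[OF insert.prems(2)] M[OF insert.prems(3)] M[OF insert.prems(4)])+
qed

text \<open>The four functions are f w1, w2, f w2 and w1. Monotonicity of \<open>f\<close> is asked
  only on the supports of the weights, because test functions will be monotone only on the cube that
  carries the conductances.\<close>

lemma holley:
  fixes \<rho> :: "real measure" and w1 w2 f :: "('i \<Rightarrow> real) \<Rightarrow> ennreal"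
  assumes \<rho>: "prob_space \<rho>" and I: "finite I"
    and [measurable]: "w1 \<in> borel_measurable (\<Pi>\<^sub>M i\<in>I. \<rho>)" "w2 \<in> borel_measurable (\<Pi>\<^sub>M i\<in>I. \<rho>)"
      "f \<in> borel_measurable (\<Pi>\<^sub>M i\<in>I. \<rho>)"
    and w: "\<And>x y. x \<in> space (\<Pi>\<^sub>M i\<in>I. \<rho>) \<Longrightarrow> y \<in> space (\<Pi>\<^sub>M i\<in>I. \<rho>) \<Longrightarrow>
      w1 x * w2 y \<le> w1 (\<lambda>i\<in>I. min (x i) (y i)) * w2 (\<lambda>i\<in>I. max (x i) (y i))"
    and f: "\<And>x y. x \<in> space (\<Pi>\<^sub>M i\<in>I. \<rho>) \<Longrightarrow> y \<in> space (\<Pi>\<^sub>M i\<in>I. \<rho>) \<Longrightarrow> w1 x \<noteq> 0 \<Longrightarrow> w2 y \<noteq> 0 \<Longrightarrow>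
      f x \<le> f (\<lambda>i\<in>I. max (x i) (y i))"
  shows "(\<integral>\<^sup>+x. f x * w1 x \<partial>(\<Pi>\<^sub>M i\<in>I. \<rho>)) * (\<integral>\<^sup>+x. w2 x \<partial>(\<Pi>\<^sub>M i\<in>I. \<rho>)) \<le>
    (\<integral>\<^sup>+x. f x * w2 x \<partial>(\<Pi>\<^sub>M i\<in>I. \<rho>)) * (\<integral>\<^sup>+x. w1 x \<partial>(\<Pi>\<^sub>M i\<in>I. \<rho>))"
proof (rule four_functions[OF \<rho> I])
  fix x y assume xy: "x \<in> space (\<Pi>\<^sub>M i\<in>I. \<rho>)" "y \<in> space (\<Pi>\<^sub>M i\<in>I. \<rho>)"
  let ?u = "\<lambda>i\<in>I. max (x i) (y i)" and ?l = "\<lambda>i\<in>I. min (x i) (y i)"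
  have "f x * w1 x * w2 y \<le> f ?u * (w1 ?l * w2 ?u)"
  proof (cases "w1 x = 0 \<or> w2 y = 0")
    case False
    then have "f x * (w1 x * w2 y) \<le> f ?u * (w1 ?l * w2 ?u)"
      by - (rule mult_mono[OF f[OF xy] w[OF xy]], auto)
    then show ?thesis by (simp add: mult.assoc)
  qed auto
  then show "f x * w1 x * w2 y \<le> f ?u * w2 ?u * w1 ?l" by (simp add: mult_ac)
qed measurable


section \<open>Stochastic ordering of conductance measures\<close>

locale bounded_reference =
  fixes \<rho> :: "real measure" and lam :: real
  assumes sets_\<rho>: "sets \<rho> = sets pos_borel" and mass_\<rho>: "emeasure \<rho> (space \<rho>) = 1"
    and lam_pos: "lam > 0" and supp_\<rho>: "msupport \<rho> \<subseteq> {inverse lam..lam}"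
begin

lemma space_\<rho>: "space \<rho> = {0<..}"
  using sets_eq_imp_space_eq[OF sets_\<rho>] by (simp add: pos_borel_def space_restrict_space)

sublocale \<rho>: prob_space \<rho>
  by (rule prob_spaceI) (rule mass_\<rho>)

sublocale \<Pi>: product_prob_space "\<lambda>_::'e. \<rho>" I for I :: "'e set" ..

lemma id_measurable: "(\<lambda>x. x) \<in> borel_measurable \<rho>"
  unfolding measurable_cong_sets[OF sets_\<rho> refl] pos_borel_def
  by (intro measurable_restrict_space1) simp

text \<open>The complement of the support is null because countably many null sets of a basis cover
  it.\<close>

lemma AE_\<rho>_range: "AE x in \<rho>. inverse lam \<le> x \<and> x \<le> lam"
proof -
  obtain B :: "real set set" where B: "countable B" "topological_basis B"
    using ex_countable_basis by blast
  define C where "C = {b \<in> B. emeasure \<rho> (b \<inter> space \<rho>) = 0}"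
  have s: "b \<inter> space \<rho> \<in> sets \<rho>" if "b \<in> B" for b
    using topological_basis_open[OF B(2) that]
    by (auto simp: sets_\<rho> space_\<rho> pos_borel_def sets_restrict_space)
  have "(\<Union>b\<in>C. b \<inter> space \<rho>) \<in> null_sets \<rho>"
    using B(1) s by (intro null_sets_UN') (auto simp: C_def null_sets_def intro: countable_subset)
  then show ?thesis
  proof (rule AE_I')
    show "{x \<in> space \<rho>. \<not> (inverse lam \<le> x \<and> x \<le> lam)} \<subseteq> (\<Union>b\<in>C. b \<inter> space \<rho>)"
    proof
      fix x assume x: "x \<in> {x \<in> space \<rho>. \<not> (inverse lam \<le> x \<and> x \<le> lam)}"
      then have "x \<notin> msupport \<rho>" using supp_\<rho> by auto
      then obtain U where U: "open U" "x \<in> U" "emeasure \<rho> (U \<inter> space \<rho>) = 0"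
        using x by (auto simp: msupport_def)
      obtain b where b: "b \<in> B" "x \<in> b" "b \<subseteq> U" using topological_basisE[OF B(2) U(1,2)] by metis
      have "U \<inter> space \<rho> \<in> sets \<rho>"
        using U by (auto simp: sets_\<rho> space_\<rho> pos_borel_def sets_restrict_space)
      then have "emeasure \<rho> (b \<inter> space \<rho>) = 0"
        using emeasure_mono[of "b \<inter> space \<rho>" "U \<inter> space \<rho>" \<rho>] U(3) b(3) by auto
      then show "x \<in> (\<Union>b\<in>C. b \<inter> space \<rho>)" using b x by (auto simp: C_def)
    qed
  qed
qed

text \<open>Otherwise the interval containing the support would be empty and could not carry mass
  one.\<close>

lemma lam_ge_1: "1 \<le> lam"
proof (rule ccontr)
  assume "\<not> 1 \<le> lam"
  then have "1 < inverse lam" using lam_pos by (simp add: one_less_inverse)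
  have "AE x in \<rho>. False"
    using AE_\<rho>_range by (rule eventually_mono) (use \<open>\<not> 1 \<le> lam\<close> \<open>1 < inverse lam\<close> in linarith)
  then show False by (simp add: \<rho>.AE_False)
qed

definition cube :: "'e set \<Rightarrow> ('e \<Rightarrow> real) set" where
  "cube E = {\<kappa>. \<forall>e\<in>E. inverse lam \<le> \<kappa> e \<and> \<kappa> e \<le> lam}"

lemma cube_pos: "\<kappa> \<in> cube E \<Longrightarrow> \<forall>e\<in>E. 0 < \<kappa> e"
  using lam_pos by (auto simp: cube_def intro: less_le_trans[of 0 "inverse lam"])

lemma one_cube: "(\<lambda>_. 1) \<in> cube E"
  using lam_ge_1 lam_pos by (auto simp: cube_def inverse_le_1_iff)

lemma AE_cube:
  assumes "finite E" shows "AE \<kappa> in (\<Pi>\<^sub>M e\<in>E. \<rho>). \<kappa> \<in> cube E"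
proof -
  have "AE \<kappa> in (\<Pi>\<^sub>M e\<in>E. \<rho>). inverse lam \<le> \<kappa> e \<and> \<kappa> e \<le> lam" if "e \<in> E" for e
    by (rule \<Pi>.AE_component[OF that AE_\<rho>_range])
  then show ?thesis
    using AE_ball_countable[of E "\<lambda>\<kappa> e. inverse lam \<le> \<kappa> e \<and> \<kappa> e \<le> lam" "\<Pi>\<^sub>M e\<in>E. \<rho>"] assms
    by (simp add: cube_def countable_finite)
qed

lemma component_measurable: "e \<in> E \<Longrightarrow> (\<lambda>\<kappa>. \<kappa> e) \<in> borel_measurable (\<Pi>\<^sub>M e\<in>E. \<rho>)"
  by (rule measurable_compose[OF _ id_measurable]) (rule measurable_component_singleton)

lemma space_PiM_pos: "\<kappa> \<in> space (\<Pi>\<^sub>M e\<in>E. \<rho>) \<Longrightarrow> \<forall>e\<in>E. 0 < \<kappa> e"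
  by (auto simp: space_PiM space_\<rho>)

lemma cube_measurable: "finite E \<Longrightarrow> E \<subseteq> L \<Longrightarrow> Measurable.pred (\<Pi>\<^sub>M e\<in>L. \<rho>) (\<lambda>\<kappa>. \<kappa> \<in> cube E)"
proof -
  assume E: "finite E" "E \<subseteq> L"
  have "Measurable.pred (\<Pi>\<^sub>M e\<in>L. \<rho>) (\<lambda>\<kappa>. \<kappa> e \<in> {inverse lam..lam})" if "e \<in> E" for e
    by (rule pred_sets2[OF _ component_measurable]) (use E that in auto)
  then have "Measurable.pred (\<Pi>\<^sub>M e\<in>L. \<rho>) (\<lambda>\<kappa>. \<forall>e\<in>E. \<kappa> e \<in> {inverse lam..lam})"
    by (rule pred_intros_finite(3)[OF E(1)])
  then show ?thesis by (simp add: cube_def)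
qed

text \<open>The largest factor by which a Gibbs weight can change when conductances on
  \<open>F\<close> move inside the cube: each edge contributes the square root of
  \<open>lam / inverse lam\<close>, which is \<open>lam\<close>, from the determinant, and an
  exponential from the disorder.\<close>

definition change_const :: "'e set \<Rightarrow> ('e \<Rightarrow> real) \<Rightarrow> real" where
  "change_const F \<xi> = lam ^ card F * exp (lam * (\<Sum>e\<in>F. \<bar>\<xi> e\<bar>))"

lemma change_const_pos: "change_const F \<xi> > 0"
  using lam_pos by (simp add: change_const_def)

end

section \<open>Gibbs weights and partition functions on one finite graph\<close>

locale rc_graph = bounded_reference + connected_multigraph G for G :: "('v, 'e) multigraph"
begin

abbreviation "PE \<equiv> (\<Pi>\<^sub>M e\<in>edges G. \<rho>)"

lemma prob_PE: "prob_space PE"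
  by (rule prob_space_PiM) (rule \<rho>.prob_space_axioms)

lemma gibbs_weight_cong:
  "(\<And>e. e \<in> edges G \<Longrightarrow> \<kappa> e = \<kappa>' e) \<Longrightarrow> gibbs_weight G \<xi> \<kappa> = gibbs_weight G \<xi> \<kappa>'"
  unfolding gibbs_weight_def by (intro arg_cong2[where f = "(*)"] s_weight_cong prod.cong) auto

lemma gibbs_weight_exp: "gibbs_weight G \<xi> \<kappa> = s_weight G \<kappa> * exp (\<Sum>e\<in>edges G. \<xi> e * \<kappa> e)"
  by (simp add: gibbs_weight_def exp_sum finite_edges)

lemma gibbs_weight_measurable_pair:
  assumes [measurable]: "\<And>e. e \<in> edges G \<Longrightarrow> (\<lambda>\<omega>. \<kappa> \<omega> e) \<in> borel_measurable M"
    "\<And>e. e \<in> edges G \<Longrightarrow> (\<lambda>\<omega>. \<xi> \<omega> e) \<in> borel_measurable M"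
  shows "(\<lambda>\<omega>. gibbs_weight G (\<xi> \<omega>) (\<kappa> \<omega>)) \<in> borel_measurable M"
proof -
  have "(\<lambda>\<omega>. \<lambda>e\<in>edges G. \<kappa> \<omega> e) \<in> measurable M (\<Pi>\<^sub>M e\<in>edges G. borel)"
    by (rule measurable_restrict) (rule assms)
  moreover have "s_weight G \<in> borel_measurable (\<Pi>\<^sub>M e\<in>edges G. borel)"
    by (rule s_weight_measurable) (rule measurable_component_singleton)
  ultimately have "(\<lambda>\<omega>. s_weight G (\<lambda>e\<in>edges G. \<kappa> \<omega> e)) \<in> borel_measurable M"
    by (rule measurable_compose)
  moreover have "s_weight G (\<lambda>e\<in>edges G. \<kappa> \<omega> e) = s_weight G (\<kappa> \<omega>)" for \<omega>
    by (rule s_weight_cong) simp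
  ultimately have [measurable]: "(\<lambda>\<omega>. s_weight G (\<kappa> \<omega>)) \<in> borel_measurable M" by simp
  show ?thesis unfolding gibbs_weight_exp by measurable
qed

lemma gibbs_weight_measurable[measurable]: "gibbs_weight G \<xi> \<in> borel_measurable PE"
  by (rule gibbs_weight_measurable_pair[of "\<lambda>\<kappa>. \<kappa>" _ "\<lambda>_. \<xi>"]) (auto intro: component_measurable)

lemma gibbs_weight_pos: "\<forall>e\<in>edges G. 0 < \<kappa> e \<Longrightarrow> gibbs_weight G \<xi> \<kappa> > 0"
  by (simp add: gibbs_weight_exp s_weight_pos)

lemma gibbs_weight_local_change:
  assumes F: "finite F" and x: "x \<in> cube (edges G)" and y: "y \<in> cube (edges G)"
    and xy: "\<And>e. e \<in> edges G - F \<Longrightarrow> x e = y e"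
  shows "gibbs_weight G \<xi> x \<le> change_const F \<xi> * gibbs_weight G \<xi> y"
proof -
  have "s_weight G x \<le> sqrt (lam / inverse lam) ^ card F * s_weight G y"
  proof (rule s_weight_local_change[OF F])
    show "inverse lam \<le> lam" using lam_pos lam_ge_1 by (meson inverse_le_1_iff order_trans)
  qed (use x y xy lam_pos in \<open>auto simp: cube_def\<close>)
  moreover have "sqrt (lam / inverse lam) = lam" using lam_pos by (simp add: divide_inverse)
  ultimately have s: "s_weight G x \<le> lam ^ card F * s_weight G y" by simp
  have "(\<Sum>e\<in>edges G. \<xi> e * x e) - (\<Sum>e\<in>edges G. \<xi> e * y e) = (\<Sum>e\<in>edges G. \<xi> e * (x e - y e))"
    by (simp add: sum_subtractf right_diff_distrib)
  also have "\<dots> = (\<Sum>e\<in>edges G \<inter> F. \<xi> e * (x e - y e))"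
    using finite_edges xy by (intro sum.mono_neutral_right) auto
  also have "\<dots> \<le> (\<Sum>e\<in>edges G \<inter> F. lam * \<bar>\<xi> e\<bar>)"
  proof (rule sum_mono)
    fix e assume "e \<in> edges G \<inter> F"
    then have e: "0 < x e" "x e \<le> lam" "0 < y e" "y e \<le> lam"
      using x y cube_pos[OF x] cube_pos[OF y] by (auto simp: cube_def)
    have "\<xi> e * (x e - y e) \<le> \<bar>\<xi> e\<bar> * \<bar>x e - y e\<bar>" by (metis abs_ge_self abs_mult)
    also have "\<dots> \<le> \<bar>\<xi> e\<bar> * lam" using e by (intro mult_left_mono) auto
    finally show "\<xi> e * (x e - y e) \<le> lam * \<bar>\<xi> e\<bar>" by (simp add: mult.commute)
  qed
  also have "\<dots> \<le> (\<Sum>e\<in>F. lam * \<bar>\<xi> e\<bar>)"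
    using F lam_pos by (intro sum_mono2) auto
  finally have "exp (\<Sum>e\<in>edges G. \<xi> e * x e) \<le> exp (lam * (\<Sum>e\<in>F. \<bar>\<xi> e\<bar>)) * exp (\<Sum>e\<in>edges G. \<xi> e * y e)"
    by (simp add: sum_distrib_left flip: exp_add)
  then have "gibbs_weight G \<xi> x \<le>
    (lam ^ card F * s_weight G y) * (exp (lam * (\<Sum>e\<in>F. \<bar>\<xi> e\<bar>)) * exp (\<Sum>e\<in>edges G. \<xi> e * y e))"
    unfolding gibbs_weight_exp using s s_weight_pos[OF cube_pos[OF y]] lam_pos
    by (intro mult_mono) auto
  then show ?thesis by (simp add: change_const_def gibbs_weight_exp mult_ac)
qed

lemma gibbs_weight_bounds:
  obtains c C where "0 < c" "\<And>\<kappa>. \<kappa> \<in> cube (edges G) \<Longrightarrow> c \<le> gibbs_weight G \<xi> \<kappa> \<and> gibbs_weight G \<xi> \<kappa> \<le> C"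
proof
  let ?K = "change_const (edges G) \<xi>" and ?w = "gibbs_weight G \<xi> (\<lambda>_. 1)"
  have w: "?w > 0" by (rule gibbs_weight_pos) simp
  show "0 < ?w / ?K" using w change_const_pos[of "edges G" \<xi>] by simp
  show "?w / ?K \<le> gibbs_weight G \<xi> \<kappa> \<and> gibbs_weight G \<xi> \<kappa> \<le> ?K * ?w" if "\<kappa> \<in> cube (edges G)" for \<kappa>
    using gibbs_weight_local_change[OF finite_edges that one_cube] 
      gibbs_weight_local_change[OF finite_edges one_cube that, of \<xi>] change_const_pos[of "edges G" \<xi>]
    by (simp add: pos_divide_le_eq mult.commute)
qed

lemma integrable_gibbs: "integrable PE (gibbs_weight G \<xi>)"
proof -
  obtain c C where "0 < c" "\<And>\<kappa>. \<kappa> \<in> cube (edges G) \<Longrightarrow> c \<le> gibbs_weight G \<xi> \<kappa> \<and> gibbs_weight G \<xi> \<kappa> \<le> C"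
    using gibbs_weight_bounds[of \<xi>] by blast
  then have "norm (gibbs_weight G \<xi> \<kappa>) \<le> C" if "\<kappa> \<in> cube (edges G)" for \<kappa>
    using that by (force simp: less_imp_le)
  then have "AE \<kappa> in PE. norm (gibbs_weight G \<xi> \<kappa>) \<le> C"
    using AE_cube[OF finite_edges] by (rule eventually_mono[rotated])
  then show ?thesis by (rule \<Pi>.integrable_const_bound) simp
qed

lemma partition_fun_pos: "partition_fun \<rho> G \<xi> > 0"
proof -
  obtain c C where c: "0 < c" "\<And>\<kappa>. \<kappa> \<in> cube (edges G) \<Longrightarrow> c \<le> gibbs_weight G \<xi> \<kappa> \<and> gibbs_weight G \<xi> \<kappa> \<le> C"
    using gibbs_weight_bounds[of \<xi>] by blast
  have "AE \<kappa> in PE. c \<le> gibbs_weight G \<xi> \<kappa>"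
    using AE_cube[OF finite_edges] by (rule eventually_mono) (use c in blast)
  then have "(\<integral>\<kappa>. c \<partial>PE) \<le> partition_fun \<rho> G \<xi>"
    unfolding partition_fun_def by (intro integral_mono_AE integrable_gibbs) auto
  then have "c \<le> partition_fun \<rho> G \<xi>" by (simp add: prob_space.prob_space[OF prob_PE])
  then show ?thesis using c by simp
qed

definition cdens :: "('e \<Rightarrow> real) \<Rightarrow> ('e \<Rightarrow> real) \<Rightarrow> real" where
  "cdens \<xi> \<kappa> = 1 / partition_fun \<rho> G \<xi> * gibbs_weight G \<xi> \<kappa>"

abbreviation "CM \<xi> \<equiv> conductance_measure \<rho> G \<xi>"

lemma CM_eq: "CM \<xi> = density PE (\<lambda>\<kappa>. ennreal (cdens \<xi> \<kappa>))"
  by (simp add: conductance_measure_def cdens_def)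

lemma sets_CM: "sets (CM \<xi>) = sets PE" by (simp add: CM_eq)
lemma space_CM: "space (CM \<xi>) = space PE" by (simp add: CM_eq)

lemma cdens_measurable[measurable]: "cdens \<xi> \<in> borel_measurable PE"
  unfolding cdens_def[abs_def] by measurable

lemma cdens_pos: "\<kappa> \<in> space PE \<Longrightarrow> 0 < cdens \<xi> \<kappa>"
  using gibbs_weight_pos[OF space_PiM_pos] partition_fun_pos by (simp add: cdens_def)

lemma integrable_cdens: "integrable PE (cdens \<xi>)"
  unfolding cdens_def[abs_def] by (intro integrable_mult_right integrable_gibbs)

lemma nn_integral_cdens: "(\<integral>\<^sup>+\<kappa>. ennreal (cdens \<xi> \<kappa>) \<partial>PE) = 1"
proof -
  have "(\<integral>\<^sup>+\<kappa>. ennreal (cdens \<xi> \<kappa>) \<partial>PE) = ennreal (\<integral>\<kappa>. cdens \<xi> \<kappa> \<partial>PE)"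
    using cdens_pos by (intro nn_integral_eq_integral integrable_cdens AE_I2) (simp add: less_imp_le)
  also have "(\<integral>\<kappa>. cdens \<xi> \<kappa> \<partial>PE) = 1"
    using partition_fun_pos[of \<xi>] by (simp add: cdens_def[abs_def] partition_fun_def)
  finally show ?thesis by simp
qed

lemma prob_CM: "prob_space (CM \<xi>)"
proof (rule prob_spaceI)
  have "emeasure (CM \<xi>) (space (CM \<xi>)) = (\<integral>\<^sup>+\<kappa>. ennreal (cdens \<xi> \<kappa>) * indicator (space PE) \<kappa> \<partial>PE)"
    unfolding CM_eq space_density by (rule emeasure_density) auto
  also have "\<dots> = (\<integral>\<^sup>+\<kappa>. ennreal (cdens \<xi> \<kappa>) \<partial>PE)"
    by (rule nn_integral_cong) simp
  finally show "emeasure (CM \<xi>) (space (CM \<xi>)) = 1" by (simp only: nn_integral_cdens)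
qed

lemma AE_CM_cube: "AE \<kappa> in CM \<xi>. \<kappa> \<in> cube (edges G)"
  unfolding CM_eq by (subst AE_density) (use AE_cube[OF finite_edges] in \<open>auto elim: eventually_mono\<close>)

lemma integral_CM:
  fixes f :: "('e \<Rightarrow> real) \<Rightarrow> real"
  assumes [measurable]: "f \<in> borel_measurable PE"
  shows "integral\<^sup>L (CM \<xi>) f = (\<integral>\<kappa>. f \<kappa> * gibbs_weight G \<xi> \<kappa> \<partial>PE) / partition_fun \<rho> G \<xi>"
proof -
  have "integral\<^sup>L (CM \<xi>) f = (\<integral>\<kappa>. cdens \<xi> \<kappa> *\<^sub>R f \<kappa> \<partial>PE)"
    unfolding CM_eq using cdens_pos by (intro integral_density AE_I2) (auto simp: less_imp_le)
  also have "\<dots> = (\<integral>\<kappa>. f \<kappa> * gibbs_weight G \<xi> \<kappa> / partition_fun \<rho> G \<xi> \<partial>PE)"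
    by (simp add: cdens_def mult_ac)
  finally show ?thesis by simp
qed

end


section \<open>Comparison of expectations of increasing functions\<close>

context bounded_reference
begin

text \<open>Monotonicity is restricted to the cube, which has full measure. Its two extreme corners
  then bound the function, so integrability needs no separate assumption.\<close>

definition incr :: "'e set \<Rightarrow> (('e \<Rightarrow> real) \<Rightarrow> real) \<Rightarrow> bool" where
  "incr E f \<longleftrightarrow> f \<in> borel_measurable (\<Pi>\<^sub>M e\<in>E. \<rho>) \<and>
     (\<forall>x\<in>cube E \<inter> space (\<Pi>\<^sub>M e\<in>E. \<rho>). \<forall>y\<in>cube E \<inter> space (\<Pi>\<^sub>M e\<in>E. \<rho>).
        (\<forall>e\<in>E. x e \<le> y e) \<longrightarrow> f x \<le> f y)"

lemma incr_bounded:
  assumes "incr E f"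
  obtains B where "\<forall>x\<in>cube E \<inter> space (\<Pi>\<^sub>M e\<in>E. \<rho>). \<bar>f x\<bar> \<le> B"
proof (rule that, rule ballI)
  let ?a = "\<lambda>e\<in>E. inverse lam" and ?b = "\<lambda>e\<in>E. lam"
  have le: "inverse lam \<le> lam" using lam_ge_1 lam_pos by (meson inverse_le_1_iff order_trans)
  have ab: "?a \<in> cube E \<inter> space (\<Pi>\<^sub>M e\<in>E. \<rho>)" "?b \<in> cube E \<inter> space (\<Pi>\<^sub>M e\<in>E. \<rho>)"
    using lam_pos le by (auto simp: cube_def space_PiM space_\<rho>)
  fix x assume x: "x \<in> cube E \<inter> space (\<Pi>\<^sub>M e\<in>E. \<rho>)"
  then have "f ?a \<le> f x" "f x \<le> f ?b"
    using assms ab unfolding incr_def by (auto simp: cube_def)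
  then show "\<bar>f x\<bar> \<le> \<bar>f ?a\<bar> + \<bar>f ?b\<bar>" by linarith
qed

end

context rc_graph
begin

lemma restrict_measurable:
  assumes "E \<subseteq> edges G" "f \<in> borel_measurable (\<Pi>\<^sub>M e\<in>E. \<rho>)"
  shows "(\<lambda>\<kappa>. f (restrict \<kappa> E)) \<in> borel_measurable PE"
  by (rule measurable_compose[OF measurable_restrict_subset[OF assms(1)] assms(2)])

lemma restrict_cube:
  assumes "E \<subseteq> edges G" "\<kappa> \<in> space PE" "\<kappa> \<in> cube (edges G)"
  shows "restrict \<kappa> E \<in> cube E \<inter> space (\<Pi>\<^sub>M e\<in>E. \<rho>)"
  using assms by (auto simp: cube_def space_PiM)

lemma AE_CM_restrict:
  assumes "E \<subseteq> edges G"
  shows "AE \<kappa> in CM \<xi>. restrict \<kappa> E \<in> cube E \<inter> space (\<Pi>\<^sub>M e\<in>E. \<rho>)"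
  using AE_CM_cube AE_space
  by eventually_elim (rule restrict_cube[OF assms], simp_all add: space_CM)

lemma integrable_CM_bounded:
  fixes f :: "('e \<Rightarrow> real) \<Rightarrow> real"
  assumes E: "E \<subseteq> edges G" and f: "f \<in> borel_measurable (\<Pi>\<^sub>M e\<in>E. \<rho>)"
    and B: "\<forall>x\<in>cube E \<inter> space (\<Pi>\<^sub>M e\<in>E. \<rho>). \<bar>f x\<bar> \<le> B"
  shows "integrable (CM \<xi>) (\<lambda>\<kappa>. f (restrict \<kappa> E))"
proof -
  interpret prob_space "CM \<xi>" by (rule prob_CM)
  show ?thesis
  proof (rule integrable_const_bound)
  show "AE \<kappa> in CM \<xi>. norm (f (restrict \<kappa> E)) \<le> B"
    using AE_CM_restrict[OF E] by eventually_elim (use B in auto)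
  show "(\<lambda>\<kappa>. f (restrict \<kappa> E)) \<in> borel_measurable (CM \<xi>)"
    using restrict_measurable[OF E f] by (simp add: measurable_cong_sets[OF sets_CM refl])
  qed
qed

lemma nn_integral_CM:
  assumes [measurable]: "f \<in> borel_measurable PE"
  shows "(\<integral>\<^sup>+\<kappa>. f \<kappa> \<partial>CM \<xi>) = (\<integral>\<^sup>+\<kappa>. f \<kappa> * ennreal (cdens \<xi> \<kappa>) \<partial>PE)"
  unfolding CM_eq by (subst nn_integral_density) (auto simp: mult.commute)

text \<open>The configuration outside \<open>E\<close> is frozen at \<open>\<eta>\<close>, because Holley's inequality compares two weights on
  the same product space.\<close>

definition fibre :: "('e \<Rightarrow> real) \<Rightarrow> 'e set \<Rightarrow> (('e \<Rightarrow> real) \<Rightarrow> ennreal) \<Rightarrow> ('e \<Rightarrow> real) \<Rightarrow> ennreal" where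
  "fibre \<xi> E g \<eta> = (\<integral>\<^sup>+x. g x * (ennreal (cdens \<xi> (merge (edges G - E) E (\<eta>, x))) * indicator (cube E) x)
     \<partial>(\<Pi>\<^sub>M e\<in>E. \<rho>))"

lemma nn_integral_CM_fibre:
  assumes E: "E \<subseteq> edges G" and g: "g \<in> borel_measurable (\<Pi>\<^sub>M e\<in>E. \<rho>)"
  shows "fibre \<xi> E g \<in> borel_measurable (\<Pi>\<^sub>M e\<in>edges G - E. \<rho>)"
    and "(\<integral>\<^sup>+\<kappa>. g (restrict \<kappa> E) \<partial>CM \<xi>) = (\<integral>\<^sup>+\<eta>. fibre \<xi> E g \<eta> \<partial>(\<Pi>\<^sub>M e\<in>edges G - E. \<rho>))"
proof -
  have fin: "finite E" "finite (edges G - E)" using E finite_edges finite_subset by auto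
  have un: "(edges G - E) \<union> E = edges G" using E by auto
  have gm[measurable]: "(\<lambda>\<kappa>. g (restrict \<kappa> E)) \<in> borel_measurable PE"
    by (rule restrict_measurable[OF E g])
  have [measurable]: "indicator (cube E) \<in> borel_measurable PE"
    using cube_measurable[OF fin(1) E] by (simp add: borel_measurable_indicator')
  let ?h = "\<lambda>\<kappa>. g (restrict \<kappa> E) * (ennreal (cdens \<xi> \<kappa>) * indicator (cube E) \<kappa>)"
  have h[measurable]: "?h \<in> borel_measurable PE" by measurable
  have hm: "?h (merge (edges G - E) E (\<eta>, x)) =
      g x * (ennreal (cdens \<xi> (merge (edges G - E) E (\<eta>, x))) * indicator (cube E) x)"
    if "x \<in> space (\<Pi>\<^sub>M e\<in>E. \<rho>)" for \<eta> x
  proof -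
    have "restrict (merge (edges G - E) E (\<eta>, x)) E = x"
      using that by (auto simp: space_PiM merge_def PiE_iff extensional_def fun_eq_iff)
    moreover have "indicator (cube E) (merge (edges G - E) E (\<eta>, x)) = (indicator (cube E) x :: ennreal)"
      by (auto simp: cube_def indicator_def merge_def)
    ultimately show ?thesis by simp
  qed
  have f: "fibre \<xi> E g \<eta> = (\<integral>\<^sup>+x. ?h (merge (edges G - E) E (\<eta>, x)) \<partial>(\<Pi>\<^sub>M e\<in>E. \<rho>))" for \<eta>
    unfolding fibre_def by (rule nn_integral_cong) (rule hm[symmetric])
  have "(\<lambda>p. ?h (merge (edges G - E) E p)) \<in>
      borel_measurable ((\<Pi>\<^sub>M e\<in>edges G - E. \<rho>) \<Otimes>\<^sub>M (\<Pi>\<^sub>M e\<in>E. \<rho>))"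
    using measurable_compose[OF measurable_merge, of ?h "edges G - E" E "\<lambda>_. \<rho>" borel] h
    unfolding un by blast
  from \<Pi>.P.borel_measurable_nn_integral_fst[OF this]
  show "fibre \<xi> E g \<in> borel_measurable (\<Pi>\<^sub>M e\<in>edges G - E. \<rho>)" unfolding f[abs_def] .
  have "(\<integral>\<^sup>+\<kappa>. g (restrict \<kappa> E) \<partial>CM \<xi>) = (\<integral>\<^sup>+\<kappa>. ?h \<kappa> \<partial>PE)"
    unfolding nn_integral_CM[OF gm]
  proof (rule nn_integral_cong_AE)
    show "AE \<kappa> in PE. g (restrict \<kappa> E) * ennreal (cdens \<xi> \<kappa>) = ?h \<kappa>"
      using AE_cube[OF finite_edges]
    proof (rule eventually_mono)
      fix \<kappa> assume "\<kappa> \<in> cube (edges G)"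
      then have "\<kappa> \<in> cube E" using E by (auto simp: cube_def)
      then show "g (restrict \<kappa> E) * ennreal (cdens \<xi> \<kappa>) = ?h \<kappa>" by simp
    qed
  qed
  also have "\<dots> = (\<integral>\<^sup>+\<eta>. \<integral>\<^sup>+x. ?h (merge (edges G - E) E (\<eta>, x)) \<partial>(\<Pi>\<^sub>M e\<in>E. \<rho>) \<partial>(\<Pi>\<^sub>M e\<in>edges G - E. \<rho>))"
    using \<Pi>.product_nn_integral_fold[of "edges G - E" E ?h] h fin unfolding un by blast
  finally show "(\<integral>\<^sup>+\<kappa>. g (restrict \<kappa> E) \<partial>CM \<xi>) = (\<integral>\<^sup>+\<eta>. fibre \<xi> E g \<eta> \<partial>(\<Pi>\<^sub>M e\<in>edges G - E. \<rho>))"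
    unfolding f .
qed

text \<open>Holley's inequality concerns nonnegative functions; adding the bound \<open>B\<close>
  carries it over to real valued ones.\<close>

lemma expectation_restrict:
  assumes E: "E \<subseteq> edges G" and f: "f \<in> borel_measurable (\<Pi>\<^sub>M e\<in>E. \<rho>)"
    and B: "\<forall>x\<in>cube E \<inter> space (\<Pi>\<^sub>M e\<in>E. \<rho>). \<bar>f x\<bar> \<le> B"
  shows "(\<integral>\<^sup>+\<kappa>. ennreal (f (restrict \<kappa> E) + B) \<partial>CM \<xi>) = ennreal ((\<integral>\<kappa>. f (restrict \<kappa> E) \<partial>CM \<xi>) + B)"
proof -
  interpret prob_space "CM \<xi>" by (rule prob_CM)
  have int: "integrable (CM \<xi>) (\<lambda>\<kappa>. f (restrict \<kappa> E))" by (rule integrable_CM_bounded[OF assms])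
  have "(\<integral>\<^sup>+\<kappa>. ennreal (f (restrict \<kappa> E) + B) \<partial>CM \<xi>) = ennreal (\<integral>\<kappa>. f (restrict \<kappa> E) + B \<partial>CM \<xi>)"
  proof (rule nn_integral_eq_integral)
    show "AE \<kappa> in CM \<xi>. 0 \<le> f (restrict \<kappa> E) + B"
      using AE_CM_restrict[OF E] by (rule eventually_mono) (drule bspec[OF B], linarith)
  qed (use int in simp)
  then show ?thesis using int by (simp add: prob_space)
qed

end

locale rc_collapse = bounded_reference \<rho> lam + collapse G1 G2 \<phi> E
  for \<rho> lam and G1 :: "('v, 'e) multigraph" and G2 :: "('w, 'e) multigraph" and \<phi> E
begin

sublocale W1: rc_graph \<rho> lam G1 ..
sublocale W2: rc_graph \<rho> lam G2 ..

text \<open>The exponent is linear in the conductances and x + y = min x y + max x y on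
  \<open>E\<close>, so the exponential factors of the two sides are equal and only the determinants
  matter.\<close>

lemma gibbs_weight_lattice:
  assumes x: "\<forall>e\<in>edges G1. x e > 0" and y: "\<forall>e\<in>edges G2. y e > 0"
  shows "gibbs_weight G1 \<xi> x * gibbs_weight G2 \<xi> y \<le>
    gibbs_weight G1 \<xi> (\<lambda>e. if e \<in> E then min (x e) (y e) else x e) *
    gibbs_weight G2 \<xi> (\<lambda>e. if e \<in> E then max (x e) (y e) else y e)"
proof -
  let ?lo = "\<lambda>e. if e \<in> E then min (x e) (y e) else x e"
  let ?hi = "\<lambda>e. if e \<in> E then max (x e) (y e) else y e"
  have "(\<Sum>e\<in>edges G1. \<xi> e * x e) - (\<Sum>e\<in>edges G1. \<xi> e * ?lo e) = (\<Sum>e\<in>edges G1. \<xi> e * (x e - ?lo e))"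
    by (simp add: sum_subtractf right_diff_distrib)
  also have "\<dots> = (\<Sum>e\<in>E. \<xi> e * (x e - ?lo e))"
    using E_sub G1.finite_edges by (intro sum.mono_neutral_right) auto
  also have "\<dots> = (\<Sum>e\<in>E. \<xi> e * (?hi e - y e))"
    by (intro sum.cong) (auto simp: min_def max_def)
  also have "\<dots> = (\<Sum>e\<in>edges G2. \<xi> e * (?hi e - y e))"
    using E_sub G2.finite_edges by (intro sum.mono_neutral_left) auto
  also have "\<dots> = (\<Sum>e\<in>edges G2. \<xi> e * ?hi e) - (\<Sum>e\<in>edges G2. \<xi> e * y e)"
    by (simp add: sum_subtractf right_diff_distrib)
  finally have "(\<Sum>e\<in>edges G1. \<xi> e * x e) + (\<Sum>e\<in>edges G2. \<xi> e * y e) =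
    (\<Sum>e\<in>edges G1. \<xi> e * ?lo e) + (\<Sum>e\<in>edges G2. \<xi> e * ?hi e)" by linarith
  then have e: "exp (\<Sum>e\<in>edges G1. \<xi> e * x e) * exp (\<Sum>e\<in>edges G2. \<xi> e * y e) =
    exp (\<Sum>e\<in>edges G1. \<xi> e * ?lo e) * exp (\<Sum>e\<in>edges G2. \<xi> e * ?hi e)"
    by (simp only: exp_add[symmetric])
  have "(s_weight G1 x * s_weight G2 y) * (exp (\<Sum>e\<in>edges G1. \<xi> e * x e) * exp (\<Sum>e\<in>edges G2. \<xi> e * y e))
    \<le> (s_weight G1 ?lo * s_weight G2 ?hi) *
      (exp (\<Sum>e\<in>edges G1. \<xi> e * ?lo e) * exp (\<Sum>e\<in>edges G2. \<xi> e * ?hi e))"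
    unfolding e by (intro mult_right_mono s_weight_lattice x y) simp
  then show ?thesis unfolding W1.gibbs_weight_exp W2.gibbs_weight_exp by (simp only: mult_ac)
qed

lemma holley_fibre:
  fixes \<xi> :: "'e \<Rightarrow> real"
  assumes f: "incr E f"
    and \<eta>1: "\<eta>1 \<in> space (\<Pi>\<^sub>M e\<in>edges G1 - E. \<rho>)" and \<eta>2: "\<eta>2 \<in> space (\<Pi>\<^sub>M e\<in>edges G2 - E. \<rho>)"
  defines "w1 \<equiv> \<lambda>x. ennreal (W1.cdens \<xi> (merge (edges G1 - E) E (\<eta>1, x))) * indicator (cube E) x"
    and "w2 \<equiv> \<lambda>x. ennreal (W2.cdens \<xi> (merge (edges G2 - E) E (\<eta>2, x))) * indicator (cube E) x"
  shows "(\<integral>\<^sup>+x. ennreal (f x) * w1 x \<partial>(\<Pi>\<^sub>M e\<in>E. \<rho>)) * (\<integral>\<^sup>+x. w2 x \<partial>(\<Pi>\<^sub>M e\<in>E. \<rho>)) \<le>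
    (\<integral>\<^sup>+x. ennreal (f x) * w2 x \<partial>(\<Pi>\<^sub>M e\<in>E. \<rho>)) * (\<integral>\<^sup>+x. w1 x \<partial>(\<Pi>\<^sub>M e\<in>E. \<rho>))"
proof (rule holley[OF \<rho>.prob_space_axioms])
  have E: "edges G1 = (edges G1 - E) \<union> E" "edges G2 = (edges G2 - E) \<union> E" using E_sub by auto
  show fin: "finite E" using E_sub G1.finite_edges finite_subset by blast
  have m1: "(\<lambda>x. merge (edges G1 - E) E (\<eta>1, x)) \<in> measurable (\<Pi>\<^sub>M e\<in>E. \<rho>) W1.PE"
    using measurable_compose[OF measurable_Pair1'[OF \<eta>1] measurable_merge, of E]
    unfolding E(1)[symmetric] .
  have m2: "(\<lambda>x. merge (edges G2 - E) E (\<eta>2, x)) \<in> measurable (\<Pi>\<^sub>M e\<in>E. \<rho>) W2.PE"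
    using measurable_compose[OF measurable_Pair1'[OF \<eta>2] measurable_merge, of E]
    unfolding E(2)[symmetric] .
  have c: "indicator (cube E) \<in> borel_measurable (\<Pi>\<^sub>M e\<in>E. \<rho>)"
    using cube_measurable[OF fin subset_refl] by (simp add: borel_measurable_indicator')
  have "(\<lambda>x. ennreal (W1.cdens \<xi> (merge (edges G1 - E) E (\<eta>1, x)))) \<in> borel_measurable (\<Pi>\<^sub>M e\<in>E. \<rho>)"
    using measurable_compose[OF m1 W1.cdens_measurable] by measurable
  then show "w1 \<in> borel_measurable (\<Pi>\<^sub>M e\<in>E. \<rho>)" unfolding w1_def using c by measurable
  have "(\<lambda>x. ennreal (W2.cdens \<xi> (merge (edges G2 - E) E (\<eta>2, x)))) \<in> borel_measurable (\<Pi>\<^sub>M e\<in>E. \<rho>)"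
    using measurable_compose[OF m2 W2.cdens_measurable] by measurable
  then show "w2 \<in> borel_measurable (\<Pi>\<^sub>M e\<in>E. \<rho>)" unfolding w2_def using c by measurable
  show "(\<lambda>x. ennreal (f x)) \<in> borel_measurable (\<Pi>\<^sub>M e\<in>E. \<rho>)"
    using f by (intro measurable_compose[OF _ measurable_ennreal]) (simp add: incr_def)
  fix x y assume x: "x \<in> space (\<Pi>\<^sub>M e\<in>E. \<rho>)" and y: "y \<in> space (\<Pi>\<^sub>M e\<in>E. \<rho>)"
  let ?u = "\<lambda>i\<in>E. max (x i) (y i)" and ?l = "\<lambda>i\<in>E. min (x i) (y i)"
  have ul: "?u \<in> space (\<Pi>\<^sub>M i\<in>E. \<rho>)" "?l \<in> space (\<Pi>\<^sub>M i\<in>E. \<rho>)"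
    using x y by (auto simp: space_PiM PiE_iff max_def min_def)
  have cub: "?u \<in> cube E" "?l \<in> cube E" if "x \<in> cube E" "y \<in> cube E"
    using that by (auto simp: cube_def)
  show "w1 x * w2 y \<le> w1 ?l * w2 ?u"
  proof (cases "x \<in> cube E \<and> y \<in> cube E")
    case True
    let ?X = "merge (edges G1 - E) E (\<eta>1, x)" and ?Y = "merge (edges G2 - E) E (\<eta>2, y)"
    let ?L = "merge (edges G1 - E) E (\<eta>1, ?l)" and ?U = "merge (edges G2 - E) E (\<eta>2, ?u)"
    have sp: "?X \<in> space W1.PE" "?L \<in> space W1.PE" "?Y \<in> space W2.PE" "?U \<in> space W2.PE"
      by (rule measurable_space[OF m1 x] measurable_space[OF m1 ul(2)] measurable_space[OF m2 y]
        measurable_space[OF m2 ul(1)])+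
    have L: "gibbs_weight G1 \<xi> (\<lambda>e. if e \<in> E then min (?X e) (?Y e) else ?X e) = gibbs_weight G1 \<xi> ?L"
      by (rule W1.gibbs_weight_cong) (auto simp: merge_def)
    have U: "gibbs_weight G2 \<xi> (\<lambda>e. if e \<in> E then max (?X e) (?Y e) else ?Y e) = gibbs_weight G2 \<xi> ?U"
      by (rule W2.gibbs_weight_cong) (auto simp: merge_def)
    have "gibbs_weight G1 \<xi> ?X * gibbs_weight G2 \<xi> ?Y \<le> gibbs_weight G1 \<xi> ?L * gibbs_weight G2 \<xi> ?U"
      using gibbs_weight_lattice[OF space_PiM_pos[OF sp(1)] space_PiM_pos[OF sp(3)], of \<xi>]
      unfolding L U .
    moreover have "W1.cdens \<xi> a * W2.cdens \<xi> b =
      (1 / partition_fun \<rho> G1 \<xi> * (1 / partition_fun \<rho> G2 \<xi>)) * (gibbs_weight G1 \<xi> a * gibbs_weight G2 \<xi> b)" for a b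
      by (simp add: W1.cdens_def W2.cdens_def)
    ultimately have "W1.cdens \<xi> ?X * W2.cdens \<xi> ?Y \<le> W1.cdens \<xi> ?L * W2.cdens \<xi> ?U"
      using W1.partition_fun_pos[of \<xi>] W2.partition_fun_pos[of \<xi>]
      by (simp only:) (intro mult_left_mono, auto simp: less_imp_le)
    then have "ennreal (W1.cdens \<xi> ?X) * ennreal (W2.cdens \<xi> ?Y) \<le>
      ennreal (W1.cdens \<xi> ?L) * ennreal (W2.cdens \<xi> ?U)"
      using W1.cdens_pos[OF sp(1), of \<xi>] W1.cdens_pos[OF sp(2), of \<xi>]
      by (simp add: ennreal_mult'[symmetric] less_imp_le ennreal_leI)
    then show ?thesis using True cub by (simp add: w1_def w2_def)
  qed (auto simp: w1_def w2_def)
  assume "w1 x \<noteq> 0" "w2 y \<noteq> 0"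
  then have "x \<in> cube E" "y \<in> cube E" by (auto simp: w1_def w2_def indicator_def split: if_splits)
  then have "f x \<le> f ?u" using f x ul cub unfolding incr_def by auto
  then show "ennreal (f x) \<le> ennreal (f ?u)" by (rule ennreal_leI)
qed

text \<open>The fibre inequality is a relation between products, so it can be integrated over the
  two frozen configurations independently; the total masses that remain are one.\<close>

lemma nn_expectation_mono:
  assumes f: "incr E f"
  shows "(\<integral>\<^sup>+\<kappa>. ennreal (f (restrict \<kappa> E)) \<partial>W1.CM \<xi>) \<le> (\<integral>\<^sup>+\<kappa>. ennreal (f (restrict \<kappa> E)) \<partial>W2.CM \<xi>)"
proof -
  let ?P1 = "\<Pi>\<^sub>M e\<in>edges G1 - E. \<rho>" and ?P2 = "\<Pi>\<^sub>M e\<in>edges G2 - E. \<rho>"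
  let ?f = "\<lambda>x. ennreal (f x)" and ?o = "\<lambda>_. 1 :: ennreal"
  have [measurable]: "f \<in> borel_measurable (\<Pi>\<^sub>M e\<in>E. \<rho>)" using f by (simp add: incr_def)
  have fm: "?f \<in> borel_measurable (\<Pi>\<^sub>M e\<in>E. \<rho>)" and om: "?o \<in> borel_measurable (\<Pi>\<^sub>M e\<in>E. \<rho>)" by measurable
  note m1 = W1.nn_integral_CM_fibre[OF E_sub(1), of _ \<xi>] and m2 = W2.nn_integral_CM_fibre[OF E_sub(2), of _ \<xi>]
  note [measurable] = m1(1)[OF fm] m1(1)[OF om] m2(1)[OF fm] m2(1)[OF om]
  have one: "(\<integral>\<^sup>+\<eta>. W1.fibre \<xi> E ?o \<eta> \<partial>?P1) = 1" "(\<integral>\<^sup>+\<eta>. W2.fibre \<xi> E ?o \<eta> \<partial>?P2) = 1"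
    using m1(2)[OF om] m2(2)[OF om] prob_space.emeasure_space_1[OF W1.prob_CM[of \<xi>]]
      prob_space.emeasure_space_1[OF W2.prob_CM[of \<xi>]] by simp_all
  have "(\<integral>\<^sup>+\<eta>. W1.fibre \<xi> E ?f \<eta> \<partial>?P1) * (\<integral>\<^sup>+\<eta>. W2.fibre \<xi> E ?o \<eta> \<partial>?P2) =
    (\<integral>\<^sup>+\<eta>1. \<integral>\<^sup>+\<eta>2. W1.fibre \<xi> E ?f \<eta>1 * W2.fibre \<xi> E ?o \<eta>2 \<partial>?P2 \<partial>?P1)"
    by (simp add: nn_integral_cmult nn_integral_multc)
  also have "\<dots> \<le> (\<integral>\<^sup>+\<eta>1. \<integral>\<^sup>+\<eta>2. W2.fibre \<xi> E ?f \<eta>2 * W1.fibre \<xi> E ?o \<eta>1 \<partial>?P2 \<partial>?P1)"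
    using holley_fibre[OF f, of _ _ \<xi>]
    by (intro nn_integral_mono) (simp add: W1.fibre_def W2.fibre_def)
  also have "\<dots> = (\<integral>\<^sup>+\<eta>. W2.fibre \<xi> E ?f \<eta> \<partial>?P2) * (\<integral>\<^sup>+\<eta>. W1.fibre \<xi> E ?o \<eta> \<partial>?P1)"
    by (simp add: nn_integral_cmult nn_integral_multc)
  finally show ?thesis unfolding one m1(2)[OF fm] m2(2)[OF fm] by simp
qed

lemma expectation_mono:
  assumes f: "incr E f"
  shows "(\<integral>\<kappa>. f (restrict \<kappa> E) \<partial>W1.CM \<xi>) \<le> (\<integral>\<kappa>. f (restrict \<kappa> E) \<partial>W2.CM \<xi>)"
proof -
  obtain B where B: "\<forall>x\<in>cube E \<inter> space (\<Pi>\<^sub>M e\<in>E. \<rho>). \<bar>f x\<bar> \<le> B"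
    using incr_bounded[OF f] by blast
  have fm: "f \<in> borel_measurable (\<Pi>\<^sub>M e\<in>E. \<rho>)" using f by (simp add: incr_def)
  have "incr E (\<lambda>x. f x + B)" using f unfolding incr_def by auto
  from nn_expectation_mono[OF this, of \<xi>]
  have "ennreal ((\<integral>\<kappa>. f (restrict \<kappa> E) \<partial>W1.CM \<xi>) + B) \<le> ennreal ((\<integral>\<kappa>. f (restrict \<kappa> E) \<partial>W2.CM \<xi>) + B)"
    unfolding W1.expectation_restrict[OF E_sub(1) fm B] W2.expectation_restrict[OF E_sub(2) fm B] .
  moreover have "0 \<le> (\<integral>\<kappa>. f (restrict \<kappa> E) \<partial>W2.CM \<xi>) + B"
  proof -
    interpret prob_space "W2.CM \<xi>" by (rule W2.prob_CM)
    have "integrable (W2.CM \<xi>) (\<lambda>\<kappa>. f (restrict \<kappa> E))" by (rule W2.integrable_CM_bounded[OF E_sub(2) fm B])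
    moreover have "AE \<kappa> in W2.CM \<xi>. 0 \<le> f (restrict \<kappa> E) + B"
      using W2.AE_CM_restrict[OF E_sub(2)] by (rule eventually_mono) (drule bspec[OF B], linarith)
    ultimately have "0 \<le> (\<integral>\<kappa>. f (restrict \<kappa> E) + B \<partial>W2.CM \<xi>)" by (intro integral_nonneg_AE)
    then show ?thesis using \<open>integrable (W2.CM \<xi>) (\<lambda>\<kappa>. f (restrict \<kappa> E))\<close> by (simp add: prob_space)
  qed
  ultimately show ?thesis by simp
qed

end


section \<open>Boxes in the square lattice\<close>

text \<open>Arbitrary centres are needed because the response of a bond is compared with its
  response in boxes centred near that bond.\<close>

definition box :: "site \<Rightarrow> nat \<Rightarrow> site set" where
  "box c n = {fst c - int n..fst c + int n} \<times> {snd c - int n..snd c + int n}"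

lemma lattice_box_eq: "lattice_box n = box 0 n"
  by (simp add: lattice_box_def box_def zero_prod_def)

lemma finite_box: "finite (box c n)" by (simp add: box_def)

lemma bondsI: "x \<in> \<Lambda> \<Longrightarrow> y \<in> \<Lambda> \<Longrightarrow> neighbours x y \<Longrightarrow> {x, y} \<in> bonds \<Lambda>"
  unfolding bonds_def by blast

lemma bondsE:
  assumes "e \<in> bonds \<Lambda>"
  obtains x y where "e = {x, y}" "x \<in> \<Lambda>" "y \<in> \<Lambda>" "neighbours x y"
  using assms unfolding bonds_def by blast

lemma boundaryI: "x \<in> \<Lambda> \<Longrightarrow> y \<notin> \<Lambda> \<Longrightarrow> neighbours x y \<Longrightarrow> x \<in> boundary \<Lambda>"
  unfolding boundary_def by blast

lemma boundaryE:
  assumes "x \<in> boundary \<Lambda>"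
  obtains y where "x \<in> \<Lambda>" "y \<notin> \<Lambda>" "neighbours x y"
  using assms unfolding boundary_def by blast

lemma finite_bonds: "finite \<Lambda> \<Longrightarrow> finite (bonds \<Lambda>)"
  by (rule finite_subset[of _ "Pow \<Lambda>"]) (auto simp: bonds_def)

lemma bonds_mono: "\<Lambda> \<subseteq> \<Lambda>' \<Longrightarrow> bonds \<Lambda> \<subseteq> bonds \<Lambda>'"
  unfolding bonds_def by blast

lemma countable_lattice_bonds: "countable lattice_bonds"
proof -
  have "lattice_bonds \<subseteq> (\<lambda>(x, y). {x, y}) ` UNIV" by (auto simp: bonds_def)
  then show ?thesis by (rule countable_subset) simp
qed

lemma neighbours_sym: "neighbours x y \<longleftrightarrow> neighbours y x"
  by (simp add: neighbours_def abs_minus_commute)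

lemma bonds_subset: "e \<in> bonds \<Lambda> \<Longrightarrow> e \<subseteq> \<Lambda>" by (auto simp: bonds_def)

lemma box_connected:
  fixes f :: "site \<Rightarrow> real"
  assumes f: "\<And>x y. x \<in> box c n \<Longrightarrow> y \<in> box c n \<Longrightarrow> neighbours x y \<Longrightarrow> f x = f y"
    and x: "x \<in> box c n"
  shows "f x = f c"
proof -
  have ver: "f (a, snd c + j) = f (a, snd c)" if "a \<in> {fst c - int n..fst c + int n}" "\<bar>j\<bar> \<le> int n" for a j
  proof -
    have "f (a, snd c + int k) = f (a, snd c) \<and> f (a, snd c - int k) = f (a, snd c)" if "k \<le> n" for k
      using that
    proof (induction k)
      case (Suc k)
      have "f (a, snd c + int (Suc k)) = f (a, snd c + int k)" "f (a, snd c - int (Suc k)) = f (a, snd c - int k)"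
        using Suc.prems \<open>a \<in> _\<close> by (intro f; simp add: box_def neighbours_def)+
      then show ?case using Suc by simp
    qed simp
    from this[of "nat \<bar>j\<bar>"] show ?thesis using that by (cases "j \<ge> 0") auto
  qed
  have hor: "f (fst c + j, snd c) = f c" if "\<bar>j\<bar> \<le> int n" for j
  proof -
    have "f (fst c + int k, snd c) = f c \<and> f (fst c - int k, snd c) = f c" if "k \<le> n" for k
      using that
    proof (induction k)
      case (Suc k)
      have "f (fst c + int (Suc k), snd c) = f (fst c + int k, snd c)"
        "f (fst c - int (Suc k), snd c) = f (fst c - int k, snd c)"
        using Suc.prems by (intro f; simp add: box_def neighbours_def)+
      then show ?case using Suc by simp
    qed simp
    from this[of "nat \<bar>j\<bar>"] show ?thesis using that by (cases "j \<ge> 0") auto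
  qed
  obtain a b where ab: "x = (a, b)" by force
  have "f (a, snd c + (b - snd c)) = f (a, snd c)"
    using x ab by (intro ver) (auto simp: box_def)
  moreover have "f (fst c + (a - fst c), snd c) = f c"
    using x ab by (intro hor) (auto simp: box_def)
  ultimately show ?thesis by (simp add: ab)
qed

lemma center_box: "c \<in> box c n" by (simp add: box_def mem_Times_iff)

lemma induced_sel[simp]: "verts (induced_graph \<Lambda>) = \<Lambda>" "edges (induced_graph \<Lambda>) = bonds \<Lambda>"
  "ends (induced_graph \<Lambda>) e = e"
  by (simp_all add: induced_graph_def)

lemma wired_sel[simp]: "verts (wired_graph \<Lambda>) = wired_class \<Lambda> ` \<Lambda>" "edges (wired_graph \<Lambda>) = bonds \<Lambda>"
  "ends (wired_graph \<Lambda>) e = wired_class \<Lambda> ` e"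
  by (simp_all add: wired_graph_def)

lemma connected_free: "connected_multigraph (induced_graph (box c n))"
proof
  fix e assume "e \<in> edges (induced_graph (box c n))"
  then obtain x y where "e = {x, y}" "x \<in> box c n" "y \<in> box c n" by (auto elim: bondsE)
  then show "\<exists>x\<in>verts (induced_graph (box c n)). \<exists>y\<in>verts (induced_graph (box c n)). ends (induced_graph (box c n)) e = {x, y}"
    by (simp only: induced_sel) blast
next
  fix f :: "site \<Rightarrow> real" and x y
  assume f: "\<And>e x y. e \<in> edges (induced_graph (box c n)) \<Longrightarrow> x \<in> ends (induced_graph (box c n)) e \<Longrightarrow>
      y \<in> ends (induced_graph (box c n)) e \<Longrightarrow> f x = f y"
    and "x \<in> verts (induced_graph (box c n))" "y \<in> verts (induced_graph (box c n))"
  have *: "f x = f y" if "x \<in> box c n" "y \<in> box c n" "neighbours x y" for x y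
    by (rule f[of "{x, y}"]) (simp_all add: bondsI that)
  have "f z = f c" if "z \<in> box c n" for z
    using that by (rule box_connected[where f = f, rotated]) (rule *)
  from this[of x] this[of y] show "f x = f y"
    using \<open>x \<in> verts _\<close> \<open>y \<in> verts _\<close> by (simp only: induced_sel)
next
  show "verts (induced_graph (box c n)) \<noteq> {}" using center_box[of c n] by auto
qed (simp_all add: finite_box finite_bonds)

lemma connected_wired: "connected_multigraph (wired_graph (box c n))"
proof
  fix e assume "e \<in> edges (wired_graph (box c n))"
  then obtain x y where "e = {x, y}" "x \<in> box c n" "y \<in> box c n" by (auto elim: bondsE)
  then show "\<exists>x\<in>verts (wired_graph (box c n)). \<exists>y\<in>verts (wired_graph (box c n)). ends (wired_graph (box c n)) e = {x, y}"
    by (simp only: wired_sel image_insert image_empty) blast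
next
  fix f :: "site set \<Rightarrow> real" and x y
  assume f: "\<And>e x y. e \<in> edges (wired_graph (box c n)) \<Longrightarrow> x \<in> ends (wired_graph (box c n)) e \<Longrightarrow>
      y \<in> ends (wired_graph (box c n)) e \<Longrightarrow> f x = f y"
    and xy: "x \<in> verts (wired_graph (box c n))" "y \<in> verts (wired_graph (box c n))"
  let ?f = "\<lambda>x. f (wired_class (box c n) x)"
  have *: "?f x = ?f y" if "x \<in> box c n" "y \<in> box c n" "neighbours x y" for x y
    by (rule f[of "{x, y}"]) (simp_all add: bondsI that)
  have c: "?f z = ?f c" if "z \<in> box c n" for z
    using that by (rule box_connected[where f = ?f, rotated]) (rule *)
  obtain x' y' where "x = wired_class (box c n) x'" "x' \<in> box c n"
    "y = wired_class (box c n) y'" "y' \<in> box c n" using xy unfolding wired_sel by blast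
  with c[of x'] c[of y'] show "f x = f y" by (simp only:)
next
  show "verts (wired_graph (box c n)) \<noteq> {}" using center_box[of c n] by auto
qed (simp_all add: finite_box finite_bonds)

lemma collapses_free_free: "\<Lambda> \<subseteq> \<Lambda>' \<Longrightarrow>
    collapses id (induced_graph \<Lambda>) (induced_graph \<Lambda>') (bonds \<Lambda>)"
  using bonds_mono by (auto simp: collapses_def)

lemma collapses_free_wired: "collapses (wired_class \<Lambda>) (induced_graph \<Lambda>) (wired_graph \<Lambda>) (bonds \<Lambda>)"
  by (simp add: collapses_def)

text \<open>The contraction fixes the interior points of the smaller box and sends every other class
  to its boundary. A bond of the larger box that is not a bond of the smaller one has no endpoint in
  that interior, so it becomes a loop.\<close>

lemma collapses_wired_wired:
  assumes L: "\<Lambda> \<subseteq> \<Lambda>'"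
  shows "collapses (\<lambda>C. if \<exists>x\<in>\<Lambda> - boundary \<Lambda>. C = {x} then C else boundary \<Lambda>)
    (wired_graph \<Lambda>') (wired_graph \<Lambda>) (bonds \<Lambda>)"
proof -
  let ?\<phi> = "\<lambda>C. if \<exists>x\<in>\<Lambda> - boundary \<Lambda>. C = {x} then C else boundary \<Lambda>"
  have int: "x \<notin> boundary \<Lambda>'" if "x \<in> \<Lambda> - boundary \<Lambda>" for x
    using that L by (blast elim: boundaryE intro: boundaryI)
  have \<phi>i: "?\<phi> (wired_class \<Lambda>' x) = {x}" if "x \<in> \<Lambda> - boundary \<Lambda>" for x
    using that int[OF that] by (simp add: wired_class_def)
  have \<phi>o: "?\<phi> (wired_class \<Lambda>' x) = boundary \<Lambda>" if "x \<notin> \<Lambda> - boundary \<Lambda>" for x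
  proof -
    have "\<not> (\<exists>z\<in>\<Lambda> - boundary \<Lambda>. wired_class \<Lambda>' x = {z})"
      using that int by (auto simp: wired_class_def split: if_splits)
    then show ?thesis by auto
  qed
  have \<phi>: "?\<phi> (wired_class \<Lambda>' x) = wired_class \<Lambda> x" if "x \<in> \<Lambda>" for x
    using that \<phi>i[of x] \<phi>o[of x] by (cases "x \<in> boundary \<Lambda>") (simp_all add: wired_class_def)
  show ?thesis
    unfolding collapses_def wired_sel
  proof (intro conjI ballI)
    fix e assume "e \<in> bonds \<Lambda>"
    then show "wired_class \<Lambda> ` e = ?\<phi> ` wired_class \<Lambda>' ` e"
      unfolding image_image using bonds_subset by (intro image_cong refl \<phi>[symmetric]) auto
  next
    fix e assume e: "e \<in> bonds \<Lambda>' - bonds \<Lambda>"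
    then obtain x y where xy: "e = {x, y}" "neighbours x y" by (blast elim: bondsE)
    have "y \<in> \<Lambda>" if "x \<in> \<Lambda> - boundary \<Lambda>" using that xy(2) boundaryI by blast
    moreover have "x \<in> \<Lambda>" if "y \<in> \<Lambda> - boundary \<Lambda>"
      using that xy(2) neighbours_sym boundaryI by blast
    moreover have "\<not> (x \<in> \<Lambda> \<and> y \<in> \<Lambda>)" using e xy bondsI by blast
    ultimately have "x \<notin> \<Lambda> - boundary \<Lambda>" "y \<notin> \<Lambda> - boundary \<Lambda>" by auto
    then have "?\<phi> ` wired_class \<Lambda>' ` e = {boundary \<Lambda>}"
      using \<phi>o[of x] \<phi>o[of y] unfolding image_image xy(1) by (simp only: image_insert image_empty insert_absorb2) simp
    then show "\<exists>z. ?\<phi> ` wired_class \<Lambda>' ` e = {z}" by blast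
  qed (use bonds_mono[OF L] in auto)
qed

section \<open>Translations, and counting of vertices\<close>

definition shift :: "site \<Rightarrow> bond \<Rightarrow> bond" where
  "shift a e = (\<lambda>x. x + a) ` e"

lemma neighbours_shift: "neighbours (x + a) (y + a) \<longleftrightarrow> neighbours x y"
  by (simp add: neighbours_def)

lemma inj_shift: "inj (shift a)"
proof (rule injI)
  fix e e' assume "shift a e = shift a e'"
  moreover have "inj (\<lambda>x. x + a)" by (rule injI) simp
  ultimately show "e = e'" unfolding shift_def by (simp only: inj_image_eq_iff)
qed

lemma box_shift: "box (c + a) n = (\<lambda>x. x + a) ` box c n"
proof
  show "box (c + a) n \<subseteq> (\<lambda>x. x + a) ` box c n"
  proof
    fix x assume "x \<in> box (c + a) n"
    then have "x - a \<in> box c n" by (simp add: box_def mem_Times_iff algebra_simps)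
    moreover have "x = (x - a) + a" by simp
    ultimately show "x \<in> (\<lambda>x. x + a) ` box c n" by blast
  qed
  show "(\<lambda>x. x + a) ` box c n \<subseteq> box (c + a) n"
  proof
    fix y assume "y \<in> (\<lambda>x. x + a) ` box c n"
    then obtain x where "x \<in> box c n" "y = x + a" by blast
    then show "y \<in> box (c + a) n" by (simp add: box_def mem_Times_iff)
  qed
qed

lemma bonds_shift: "bonds ((\<lambda>x. x + a) ` \<Lambda>) = shift a ` bonds \<Lambda>"
proof
  show "bonds ((\<lambda>x. x + a) ` \<Lambda>) \<subseteq> shift a ` bonds \<Lambda>"
  proof
    fix e assume "e \<in> bonds ((\<lambda>x. x + a) ` \<Lambda>)"
    then obtain x y where e: "e = {x + a, y + a}" "x \<in> \<Lambda>" "y \<in> \<Lambda>" "neighbours (x + a) (y + a)"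
      by (elim bondsE) blast
    have "{x, y} \<in> bonds \<Lambda>" using e bondsI neighbours_shift by blast
    moreover have "e = shift a {x, y}" using e(1) by (simp add: shift_def)
    ultimately show "e \<in> shift a ` bonds \<Lambda>" by blast
  qed
  show "shift a ` bonds \<Lambda> \<subseteq> bonds ((\<lambda>x. x + a) ` \<Lambda>)"
  proof
    fix e assume "e \<in> shift a ` bonds \<Lambda>"
    then obtain x y where e: "e = {x + a, y + a}" "x \<in> \<Lambda>" "y \<in> \<Lambda>" "neighbours x y"
      by (elim imageE bondsE) (simp add: shift_def)
    then show "e \<in> bonds ((\<lambda>x. x + a) ` \<Lambda>)"
      unfolding e(1) by (intro bondsI) (simp_all add: neighbours_shift)
  qed
qed

lemma boundary_shift: "x + a \<in> boundary ((\<lambda>x. x + a) ` \<Lambda>) \<longleftrightarrow> x \<in> boundary \<Lambda>"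
proof
  assume "x + a \<in> boundary ((\<lambda>x. x + a) ` \<Lambda>)"
  then obtain y where y: "x + a \<in> (\<lambda>x. x + a) ` \<Lambda>" "y \<notin> (\<lambda>x. x + a) ` \<Lambda>" "neighbours (x + a) y"
    by (rule boundaryE)
  have "x \<in> \<Lambda>" using y(1) by (metis add_right_cancel imageE)
  moreover have "y - a \<notin> \<Lambda>" using y(2) by (metis diff_add_cancel imageI)
  moreover have "neighbours x (y - a)" using y(3) neighbours_shift[of x a "y - a"] by simp
  ultimately show "x \<in> boundary \<Lambda>" by (rule boundaryI)
next
  assume "x \<in> boundary \<Lambda>"
  then obtain y where y: "x \<in> \<Lambda>" "y \<notin> \<Lambda>" "neighbours x y" by (rule boundaryE)
  have "x + a \<in> (\<lambda>x. x + a) ` \<Lambda>" using y(1) by simp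
  moreover have "y + a \<notin> (\<lambda>x. x + a) ` \<Lambda>" using y(2) by (metis add_right_cancel imageE)
  moreover have "neighbours (x + a) (y + a)" using y(3) by (simp add: neighbours_shift)
  ultimately show "x + a \<in> boundary ((\<lambda>x. x + a) ` \<Lambda>)" by (rule boundaryI)
qed

lemma wired_class_shift: "wired_class ((\<lambda>x. x + a) ` \<Lambda>) (x + a) = (\<lambda>x. x + a) ` wired_class \<Lambda> x"
proof -
  have "boundary ((\<lambda>x. x + a) ` \<Lambda>) = (\<lambda>x. x + a) ` boundary \<Lambda>"
  proof
    show "boundary ((\<lambda>x. x + a) ` \<Lambda>) \<subseteq> (\<lambda>x. x + a) ` boundary \<Lambda>"
    proof
      fix z assume z: "z \<in> boundary ((\<lambda>x. x + a) ` \<Lambda>)"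
      then obtain x where "z = x + a" by (elim boundaryE) blast
      then show "z \<in> (\<lambda>x. x + a) ` boundary \<Lambda>" using z boundary_shift by auto
    qed
  qed (auto simp: boundary_shift)
  then show ?thesis unfolding wired_class_def boundary_shift by simp
qed

lemma lap_det_free_shift:
  "lap_det (induced_graph (box (c + a) n)) \<kappa> = lap_det (induced_graph (box c n)) (\<kappa> \<circ> shift a)"
proof (rule lap_det_iso[OF connected_free connected_free, of "\<lambda>x. x + a"])
  show "inj_on (shift a) (edges (induced_graph (box c n)))" using inj_shift by (rule inj_on_subset) simp
qed (simp_all add: box_shift bonds_shift inj_on_def, simp add: shift_def)

lemma lap_det_wired_shift:
  "lap_det (wired_graph (box (c + a) n)) \<kappa> = lap_det (wired_graph (box c n)) (\<kappa> \<circ> shift a)"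
proof (rule lap_det_iso[OF connected_wired connected_wired, of "shift a"])
  show "verts (wired_graph (box (c + a) n)) = shift a ` verts (wired_graph (box c n))"
    by (simp add: box_shift image_image wired_class_shift shift_def)
  show "ends (wired_graph (box (c + a) n)) (shift a e) = shift a ` ends (wired_graph (box c n)) e" for e
    by (simp add: box_shift image_image wired_class_shift shift_def)
  show "inj_on (shift a) (verts (wired_graph (box c n)))" "inj_on (shift a) (edges (wired_graph (box c n)))"
    using inj_shift by (rule inj_on_subset, simp)+
  show "edges (wired_graph (box (c + a) n)) = shift a ` edges (wired_graph (box c n))"
    by (simp add: box_shift bonds_shift)
qed

lemma card_boundary_box: "card (boundary (box c n)) \<le> 4 * (2 * n + 1)"
proof -
  let ?I = "{fst c - int n..fst c + int n}" and ?J = "{snd c - int n..snd c + int n}"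
  let ?S = "{fst c - int n, fst c + int n} \<times> ?J \<union> ?I \<times> {snd c - int n, snd c + int n}"
  have "boundary (box c n) \<subseteq> ?S"
  proof
    fix x assume "x \<in> boundary (box c n)"
    then obtain y where "x \<in> box c n" "y \<notin> box c n" "\<bar>fst x - fst y\<bar> + \<bar>snd x - snd y\<bar> = 1"
      by (elim boundaryE) (simp add: neighbours_def)
    then have "fst x = fst c - int n \<or> fst x = fst c + int n \<or> snd x = snd c - int n \<or> snd x = snd c + int n"
      unfolding box_def mem_Times_iff atLeastAtMost_iff by linarith
    then show "x \<in> ?S" using \<open>x \<in> box c n\<close> by (auto simp: box_def mem_Times_iff)
  qed
  then have "card (boundary (box c n)) \<le> card ?S" by (rule card_mono[rotated]) simp
  also have "\<dots> \<le> card ({fst c - int n, fst c + int n} \<times> ?J) + card (?I \<times> {snd c - int n, snd c + int n})"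
    by (rule card_Un_le)
  also have "\<dots> \<le> 2 * (2 * n + 1) + (2 * n + 1) * 2"
    unfolding card_cartesian_product
    by (intro add_mono mult_mono) (auto simp: card_insert_if)
  finally show ?thesis by simp
qed

lemma card_verts_wired:
  assumes "finite \<Lambda>"
  shows "card \<Lambda> \<le> card (verts (wired_graph \<Lambda>)) + card (boundary \<Lambda>)"
    "card (verts (wired_graph \<Lambda>)) \<le> card \<Lambda>"
proof -
  have f: "finite (boundary \<Lambda>)" using assms by (auto simp: boundary_def)
  have "card \<Lambda> \<le> card (\<Lambda> - boundary \<Lambda>) + card (boundary \<Lambda>)"
    using card_Un_le[of "\<Lambda> - boundary \<Lambda>" "boundary \<Lambda>"] by (simp add: Un_absorb2 boundary_def)
  also have "card (\<Lambda> - boundary \<Lambda>) = card (wired_class \<Lambda> ` (\<Lambda> - boundary \<Lambda>))"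
    by (rule card_image[symmetric]) (auto simp: inj_on_def wired_class_def)
  also have "\<dots> \<le> card (wired_class \<Lambda> ` \<Lambda>)" using assms by (intro card_mono) auto
  finally show "card \<Lambda> \<le> card (verts (wired_graph \<Lambda>)) + card (boundary \<Lambda>)" by simp
  show "card (verts (wired_graph \<Lambda>)) \<le> card \<Lambda>" using assms by (simp add: card_image_le)
qed

lemma box_mono: "\<bar>fst c - fst c'\<bar> + int n \<le> int m \<Longrightarrow> \<bar>snd c - snd c'\<bar> + int n \<le> int m \<Longrightarrow> box c n \<subseteq> box c' m"
proof
  fix x assume *: "\<bar>fst c - fst c'\<bar> + int n \<le> int m" "\<bar>snd c - snd c'\<bar> + int n \<le> int m" and "x \<in> box c n"
  then have "fst c - int n \<le> fst x" "fst x \<le> fst c + int n" "snd c - int n \<le> snd x" "snd x \<le> snd c + int n"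
    by (simp_all add: box_def mem_Times_iff)
  with * have "fst c' - int m \<le> fst x" "fst x \<le> fst c' + int m" "snd c' - int m \<le> snd x" "snd x \<le> snd c' + int m"
    by linarith+
  then show "x \<in> box c' m" by (simp add: box_def mem_Times_iff)
qed

lemma lattice_bond_in_box:
  assumes "finite F" "F \<subseteq> lattice_bonds"
  shows "\<exists>m. \<forall>n\<ge>m. F \<subseteq> bonds (box 0 n)"
  using assms
proof (induction F rule: finite_induct)
  case (insert e F)
  then obtain m where m: "\<forall>n\<ge>m. F \<subseteq> bonds (box 0 n)" by auto
  obtain x y where e: "e = {x, y}" "neighbours x y" using insert.prems by (blast elim: bondsE)
  define k where "k = nat (\<bar>fst x\<bar> + \<bar>snd x\<bar> + \<bar>fst y\<bar> + \<bar>snd y\<bar>)"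
  have "e \<in> bonds (box 0 n)" if "n \<ge> k" for n
  proof -
    have "x \<in> box 0 n" "y \<in> box 0 n" using that by (auto simp: k_def box_def mem_Times_iff)
    then show ?thesis using e bondsI by blast
  qed
  then show ?case using m by (intro exI[of _ "max m k"]) auto
qed simp


section \<open>The surface free energy\<close>

text \<open>As a function of \<open>t\<close> this is the ratio of the partition functions after and
  before raising \<open>\<xi> e\<close> by \<open>t\<close>. It turns increments of free energies in
  one disorder variable into logarithms of moments of one conductance.\<close>

definition mgf :: "real measure \<Rightarrow> ('v, 'e) multigraph \<Rightarrow> ('e \<Rightarrow> real) \<Rightarrow> 'e \<Rightarrow> real \<Rightarrow> real" where
  "mgf \<rho> G \<xi> e t = (\<integral>\<kappa>. exp (t * \<kappa> e) \<partial>conductance_measure \<rho> G \<xi>)"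

context rc_graph
begin

lemma gibbs_weight_tilt:
  assumes "e \<in> edges G"
  shows "gibbs_weight G (\<xi>(e := \<xi> e + t)) \<kappa> = exp (t * \<kappa> e) * gibbs_weight G \<xi> \<kappa>"
proof -
  have "(\<Sum>i\<in>edges G. (\<xi>(e := \<xi> e + t)) i * \<kappa> i) = (\<Sum>i\<in>edges G. \<xi> i * \<kappa> i + (if i = e then t * \<kappa> i else 0))"
    by (intro sum.cong) (auto simp: algebra_simps)
  also have "\<dots> = (\<Sum>i\<in>edges G. \<xi> i * \<kappa> i) + t * \<kappa> e"
    using assms finite_edges by (simp add: sum.distrib)
  finally show ?thesis by (simp add: gibbs_weight_exp exp_add)
qed

lemma exp_component_measurable: "e \<in> edges G \<Longrightarrow> (\<lambda>\<kappa>. exp (t * \<kappa> e)) \<in> borel_measurable PE"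
  using component_measurable[of e "edges G"] by simp

lemma mgf_eq:
  assumes e: "e \<in> edges G"
  shows "mgf \<rho> G \<xi> e t = partition_fun \<rho> G (\<xi>(e := \<xi> e + t)) / partition_fun \<rho> G \<xi>"
  unfolding mgf_def integral_CM[OF exp_component_measurable[OF e]] gibbs_weight_tilt[OF e, symmetric]
    partition_fun_def ..

lemma mgf_pos: "e \<in> edges G \<Longrightarrow> mgf \<rho> G \<xi> e t > 0"
  by (simp add: mgf_eq partition_fun_pos)

lemma integral_tilt:
  fixes f :: "('e \<Rightarrow> real) \<Rightarrow> real"
  assumes e: "e \<in> edges G" and f[measurable]: "f \<in> borel_measurable PE"
  shows "integral\<^sup>L (CM (\<xi>(e := \<xi> e + t))) f = (\<integral>\<kappa>. f \<kappa> * exp (t * \<kappa> e) \<partial>CM \<xi>) / mgf \<rho> G \<xi> e t"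
proof -
  note [measurable] = exp_component_measurable[OF e]
  have "(\<integral>\<kappa>. f \<kappa> * exp (t * \<kappa> e) \<partial>CM \<xi>) =
    (\<integral>\<kappa>. f \<kappa> * gibbs_weight G (\<xi>(e := \<xi> e + t)) \<kappa> \<partial>PE) / partition_fun \<rho> G \<xi>"
    by (subst integral_CM) (simp_all add: gibbs_weight_tilt[OF e] mult.assoc)
  then show ?thesis
    using partition_fun_pos[of \<xi>] by (simp add: integral_CM[OF f] mgf_eq[OF e])
qed

lemma mgf_bounds:
  assumes e: "e \<in> edges G" and t: "t \<ge> 0"
  shows "1 \<le> mgf \<rho> G \<xi> e t" "mgf \<rho> G \<xi> e t \<le> exp (t * lam)"
proof -
  interpret prob_space "CM \<xi>" by (rule prob_CM)
  have ae: "AE \<kappa> in CM \<xi>. 1 \<le> exp (t * \<kappa> e) \<and> exp (t * \<kappa> e) \<le> exp (t * lam)"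
    using AE_CM_cube
  proof (rule eventually_mono)
    fix \<kappa> :: "'e \<Rightarrow> real" assume \<kappa>: "\<kappa> \<in> cube (edges G)"
    then have "0 < \<kappa> e" "\<kappa> e \<le> lam" using e cube_pos[OF \<kappa>] by (auto simp: cube_def)
    then show "1 \<le> exp (t * \<kappa> e) \<and> exp (t * \<kappa> e) \<le> exp (t * lam)"
      using t by (auto intro: mult_left_mono)
  qed
  have m: "(\<lambda>\<kappa>. exp (t * \<kappa> e)) \<in> borel_measurable (CM \<xi>)"
    using exp_component_measurable[OF e] by (simp add: measurable_cong_sets[OF sets_CM refl])
  have int: "integrable (CM \<xi>) (\<lambda>\<kappa>. exp (t * \<kappa> e))"
    by (rule integrable_const_bound[OF _ m, of "exp (t * lam)"]) (use ae in \<open>rule eventually_mono\<close>, simp)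
  have "(\<integral>\<kappa>. 1 \<partial>CM \<xi>) \<le> mgf \<rho> G \<xi> e t"
    unfolding mgf_def by (rule integral_mono_AE) (use int ae in \<open>auto elim: eventually_mono\<close>)
  then show "1 \<le> mgf \<rho> G \<xi> e t" by (simp add: prob_space)
  have "mgf \<rho> G \<xi> e t \<le> (\<integral>\<kappa>. exp (t * lam) \<partial>CM \<xi>)"
    unfolding mgf_def by (rule integral_mono_AE) (use int ae in \<open>auto elim: eventually_mono\<close>)
  then show "mgf \<rho> G \<xi> e t \<le> exp (t * lam)" by (simp add: prob_space)
qed

lemma partition_fun_cong:
  assumes "\<And>e. e \<in> edges G \<Longrightarrow> \<xi> e = \<xi>' e"
  shows "partition_fun \<rho> G \<xi> = partition_fun \<rho> G \<xi>'"
proof -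
  have "gibbs_weight G \<xi> = gibbs_weight G \<xi>'"
    by (rule ext) (simp add: gibbs_weight_exp assms cong: sum.cong)
  then show ?thesis unfolding partition_fun_def by simp
qed

lemma partition_fun_measurable:
  assumes [measurable]: "\<And>e. e \<in> edges G \<Longrightarrow> (\<lambda>\<omega>. \<xi> \<omega> e) \<in> borel_measurable M"
  shows "(\<lambda>\<omega>. partition_fun \<rho> G (\<xi> \<omega>)) \<in> borel_measurable M"
  unfolding partition_fun_def
proof (rule \<Pi>.P.borel_measurable_lebesgue_integral)
  have "(\<lambda>p. gibbs_weight G (\<xi> (fst p)) (snd p)) \<in> borel_measurable (M \<Otimes>\<^sub>M PE)"
  proof (rule gibbs_weight_measurable_pair)
    fix e assume e: "e \<in> edges G"
    show "(\<lambda>p. snd p e) \<in> borel_measurable (M \<Otimes>\<^sub>M PE)"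
      by (rule measurable_compose[OF measurable_snd component_measurable[OF e]])
    show "(\<lambda>p. \<xi> (fst p) e) \<in> borel_measurable (M \<Otimes>\<^sub>M PE)"
      by (rule measurable_compose[OF measurable_fst assms[OF e]])
  qed
  then show "(\<lambda>(\<omega>, \<kappa>). gibbs_weight G (\<xi> \<omega>) \<kappa>) \<in> borel_measurable (M \<Otimes>\<^sub>M PE)"
    by (simp add: case_prod_beta)
qed

text \<open>With the outside frozen, densities at two points of the cube over \<open>F\<close>
  differ at most by the factor \<open>change_const F \<xi>\<close>. Averaging over the second point
  replaces it by the mass of the fibre, and these masses integrate to one whatever the graph
  is.\<close>

lemma marginal_density_bound:
  assumes F: "F \<subseteq> edges G" and A: "A \<in> sets (\<Pi>\<^sub>M e\<in>F. \<rho>)"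
  shows "measure (CM \<xi>) {\<kappa> \<in> space (CM \<xi>). restrict \<kappa> F \<in> A} \<le> change_const F \<xi> * measure (\<Pi>\<^sub>M e\<in>F. \<rho>) A"
proof -
  let ?D = "edges G - F" and ?PF = "\<Pi>\<^sub>M e\<in>F. \<rho>"
  interpret prob_space "CM \<xi>" by (rule prob_CM)
  have fin: "finite F" "finite ?D" using F finite_edges finite_subset by auto
  have un: "?D \<union> F = edges G" using F by auto
  have Am: "(indicator A :: _ \<Rightarrow> ennreal) \<in> borel_measurable ?PF" using A by simp
  have om: "(\<lambda>_. 1 :: ennreal) \<in> borel_measurable ?PF" by simp
  have c[measurable]: "(indicator (cube F) :: _ \<Rightarrow> ennreal) \<in> borel_measurable ?PF"
    using cube_measurable[OF fin(1) subset_refl] by (simp add: borel_measurable_indicator')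
  have P1: "emeasure ?PF (space ?PF) = 1" by (rule \<Pi>.P.emeasure_space_1)
  have K: "change_const F \<xi> \<ge> 0" using change_const_pos less_imp_le by blast
  have fib: "fibre \<xi> F (indicator A) \<eta> \<le> ennreal (change_const F \<xi>) * emeasure ?PF A * fibre \<xi> F (\<lambda>_. 1) \<eta>"
    if \<eta>: "\<eta> \<in> cube ?D" "\<eta> \<in> space (\<Pi>\<^sub>M e\<in>?D. \<rho>)" for \<eta>
  proof -
    let ?c = "\<lambda>x. ennreal (cdens \<xi> (merge ?D F (\<eta>, x)))"
    have m: "(\<lambda>x. merge ?D F (\<eta>, x)) \<in> measurable ?PF PE"
      using measurable_compose[OF measurable_Pair1'[OF \<eta>(2)] measurable_merge, of F] unfolding un .
    have [measurable]: "?c \<in> borel_measurable ?PF"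
      using measurable_compose[OF m cdens_measurable] by (rule measurable_compose) simp
    have cmp: "cdens \<xi> (merge ?D F (\<eta>, x)) \<le> change_const F \<xi> * cdens \<xi> (merge ?D F (\<eta>, y))"
      if "x \<in> cube F" "y \<in> cube F" for x y
    proof -
      have "gibbs_weight G \<xi> (merge ?D F (\<eta>, x)) \<le> change_const F \<xi> * gibbs_weight G \<xi> (merge ?D F (\<eta>, y))"
        by (rule gibbs_weight_local_change[OF fin(1)]) (use that \<eta> in \<open>auto simp: cube_def merge_def\<close>)
      from mult_left_mono[OF this, of "1 / partition_fun \<rho> G \<xi>"] show ?thesis
        using partition_fun_pos[of \<xi>] by (simp add: cdens_def mult_ac)
    qed
    \<comment> \<open>Insert a dummy average over the second point \<open>y\<close> of the
      comparison; the left side does not depend on it.\<close>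
    have "fibre \<xi> F (indicator A) \<eta> = (\<integral>\<^sup>+y. fibre \<xi> F (indicator A) \<eta> \<partial>?PF)"
      by (simp add: P1)
    also have "\<dots> \<le> (\<integral>\<^sup>+y. (ennreal (change_const F \<xi>) * emeasure ?PF A) * (1 * (?c y * indicator (cube F) y)) \<partial>?PF)"
    proof (rule nn_integral_mono_AE)
      show "AE y in ?PF. fibre \<xi> F (indicator A) \<eta> \<le>
        (ennreal (change_const F \<xi>) * emeasure ?PF A) * (1 * (?c y * indicator (cube F) y))"
        using AE_cube[OF fin(1)]
      proof (rule eventually_mono)
        fix y :: "'e \<Rightarrow> real" assume y: "y \<in> cube F"
        have "fibre \<xi> F (indicator A) \<eta> \<le> (\<integral>\<^sup>+x. (ennreal (change_const F \<xi>) * ?c y) * indicator A x \<partial>?PF)"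
          unfolding fibre_def
        proof (rule nn_integral_mono)
          fix x
          show "indicator A x * (?c x * indicator (cube F) x) \<le> ennreal (change_const F \<xi>) * ?c y * indicator A x"
            using cmp[OF _ y, of x] K
            by (cases "x \<in> A"; cases "x \<in> cube F") (auto simp: ennreal_mult'[symmetric] intro!: ennreal_leI)
        qed
        also have "\<dots> = (ennreal (change_const F \<xi>) * ?c y) * emeasure ?PF A"
          using A by (simp add: nn_integral_cmult_indicator)
        finally show "fibre \<xi> F (indicator A) \<eta> \<le>
          (ennreal (change_const F \<xi>) * emeasure ?PF A) * (1 * (?c y * indicator (cube F) y))"
          using y by (simp add: mult_ac)
      qed
    qed
    also have "\<dots> = (ennreal (change_const F \<xi>) * emeasure ?PF A) * fibre \<xi> F (\<lambda>_. 1) \<eta>"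
      unfolding fibre_def by (rule nn_integral_cmult) measurable
    finally show ?thesis .
  qed
  have "emeasure (CM \<xi>) {\<kappa> \<in> space (CM \<xi>). restrict \<kappa> F \<in> A} = (\<integral>\<^sup>+\<kappa>. indicator A (restrict \<kappa> F) \<partial>CM \<xi>)"
  proof -
    have "{\<kappa> \<in> space (CM \<xi>). restrict \<kappa> F \<in> A} \<in> sets (CM \<xi>)"
      unfolding space_CM sets_CM using measurable_sets[OF measurable_restrict_subset[OF F] A]
      by (simp add: vimage_def Int_def conj_commute)
    then have "emeasure (CM \<xi>) {\<kappa> \<in> space (CM \<xi>). restrict \<kappa> F \<in> A} =
      (\<integral>\<^sup>+\<kappa>. indicator {\<kappa> \<in> space (CM \<xi>). restrict \<kappa> F \<in> A} \<kappa> \<partial>CM \<xi>)" by simp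
    also have "\<dots> = (\<integral>\<^sup>+\<kappa>. indicator A (restrict \<kappa> F) \<partial>CM \<xi>)"
      by (rule nn_integral_cong) (simp add: indicator_def)
    finally show ?thesis .
  qed
  also have "\<dots> = (\<integral>\<^sup>+\<eta>. fibre \<xi> F (indicator A) \<eta> \<partial>(\<Pi>\<^sub>M e\<in>?D. \<rho>))"
    by (rule nn_integral_CM_fibre(2)[OF F Am])
  also have "\<dots> \<le> (\<integral>\<^sup>+\<eta>. (ennreal (change_const F \<xi>) * emeasure ?PF A) * fibre \<xi> F (\<lambda>_. 1) \<eta> \<partial>(\<Pi>\<^sub>M e\<in>?D. \<rho>))"
  proof (rule nn_integral_mono_AE)
    show "AE \<eta> in \<Pi>\<^sub>M e\<in>?D. \<rho>. fibre \<xi> F (indicator A) \<eta> \<le>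
        (ennreal (change_const F \<xi>) * emeasure ?PF A) * fibre \<xi> F (\<lambda>_. 1) \<eta>"
      using AE_cube[OF fin(2)] AE_space by eventually_elim (rule fib)
  qed
  also have "\<dots> = (ennreal (change_const F \<xi>) * emeasure ?PF A) * (\<integral>\<^sup>+\<eta>. fibre \<xi> F (\<lambda>_. 1) \<eta> \<partial>(\<Pi>\<^sub>M e\<in>?D. \<rho>))"
    by (rule nn_integral_cmult[OF nn_integral_CM_fibre(1)[OF F om]])
  also have "(\<integral>\<^sup>+\<eta>. fibre \<xi> F (\<lambda>_. 1) \<eta> \<partial>(\<Pi>\<^sub>M e\<in>?D. \<rho>)) = 1"
    using nn_integral_CM_fibre(2)[OF F om, of \<xi>] emeasure_space_1 by simp
  finally have "emeasure (CM \<xi>) {\<kappa> \<in> space (CM \<xi>). restrict \<kappa> F \<in> A} \<le> ennreal (change_const F \<xi>) * emeasure ?PF A"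
    by (simp only: mult_1_right)
  then have "ennreal (measure (CM \<xi>) {\<kappa> \<in> space (CM \<xi>). restrict \<kappa> F \<in> A}) \<le>
      ennreal (change_const F \<xi> * measure ?PF A)"
    unfolding emeasure_eq_measure \<Pi>.P.emeasure_eq_measure by (simp only: ennreal_mult'[OF K])
  moreover have "0 \<le> change_const F \<xi> * measure ?PF A" using K by simp
  ultimately show ?thesis by (simp only: ennreal_le_iff)
qed

end

context rc_collapse
begin

lemma mgf_mono:
  assumes e: "e \<in> E" and t: "t \<ge> 0"
  shows "mgf \<rho> G1 \<xi> e t \<le> mgf \<rho> G2 \<xi> e t"
proof -
  have "incr E (\<lambda>x. exp (t * x e))"
    unfolding incr_def using component_measurable[OF e] e t by (auto intro!: mult_left_mono)
  from expectation_mono[OF this, of \<xi>] show ?thesis using e by (simp add: mgf_def)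
qed

end

section \<open>Dependence of the surface free energy on the disorder and on the box\<close>

context bounded_reference
begin

abbreviation "FG c n \<equiv> induced_graph (box c n)"
abbreviation "WG c n \<equiv> wired_graph (box c n)"

lemma rc_free: "rc_graph \<rho> lam (FG c n)"
  by (intro rc_graph.intro bounded_reference_axioms connected_free)

lemma rc_wired: "rc_graph \<rho> lam (WG c n)"
  by (intro rc_graph.intro bounded_reference_axioms connected_wired)

lemma rc_collapse_free_free:
  "box c n \<subseteq> box c' n' \<Longrightarrow> rc_collapse \<rho> lam (FG c n) (FG c' n') id (bonds (box c n))"
  by (intro rc_collapse.intro bounded_reference_axioms collapse.intro connected_free collapse_axioms.intro
      collapses_free_free)

lemma rc_collapse_free_wired:
  "rc_collapse \<rho> lam (FG c n) (WG c n) (wired_class (box c n)) (bonds (box c n))"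
  by (intro rc_collapse.intro bounded_reference_axioms collapse.intro connected_free connected_wired
      collapse_axioms.intro collapses_free_wired)

lemma rc_collapse_wired_wired:
  "box c n \<subseteq> box c' n' \<Longrightarrow> rc_collapse \<rho> lam (WG c' n') (WG c n)
    (\<lambda>C. if \<exists>x\<in>box c n - boundary (box c n). C = {x} then C else boundary (box c n)) (bonds (box c n))"
  by (intro rc_collapse.intro bounded_reference_axioms collapse.intro connected_wired
      collapse_axioms.intro collapses_wired_wired)

definition G :: "site \<Rightarrow> nat \<Rightarrow> (bond \<Rightarrow> real) \<Rightarrow> real" where
  "G c n \<xi> = ln (partition_fun \<rho> (WG c n) \<xi>) - ln (partition_fun \<rho> (FG c n) \<xi>)"

lemma G_upd:
  assumes e: "e \<in> bonds (box c n)"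
  shows "G c n (\<xi>(e := b)) - G c n (\<xi>(e := a)) =
    ln (mgf \<rho> (WG c n) (\<xi>(e := a)) e (b - a)) - ln (mgf \<rho> (FG c n) (\<xi>(e := a)) e (b - a))"
proof -
  interpret F: rc_graph \<rho> lam "FG c n" by (rule rc_free)
  interpret W: rc_graph \<rho> lam "WG c n" by (rule rc_wired)
  have nz: "partition_fun \<rho> (FG c n) \<zeta> \<noteq> 0" "partition_fun \<rho> (WG c n) \<zeta> \<noteq> 0" for \<zeta>
    using F.partition_fun_pos[of \<zeta>] W.partition_fun_pos[of \<zeta>] by simp_all
  show ?thesis
    using F.mgf_eq[of e "\<xi>(e := a)" "b - a"] W.mgf_eq[of e "\<xi>(e := a)" "b - a"] e nz
    by (simp add: G_def ln_div)
qed

lemma mgf_free_wired: "e \<in> bonds (box c n) \<Longrightarrow> t \<ge> 0 \<Longrightarrow> mgf \<rho> (FG c n) \<xi> e t \<le> mgf \<rho> (WG c n) \<xi> e t"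
  using rc_collapse.mgf_mono[OF rc_collapse_free_wired] .

lemma G_incr:
  assumes e: "e \<in> bonds (box c n)" and ab: "a \<le> b"
  shows "G c n (\<xi>(e := a)) \<le> G c n (\<xi>(e := b))"
proof -
  interpret F: rc_graph \<rho> lam "FG c n" by (rule rc_free)
  have "mgf \<rho> (FG c n) (\<xi>(e := a)) e (b - a) \<le> mgf \<rho> (WG c n) (\<xi>(e := a)) e (b - a)"
    using e ab by (intro mgf_free_wired) auto
  then have "ln (mgf \<rho> (FG c n) (\<xi>(e := a)) e (b - a)) \<le> ln (mgf \<rho> (WG c n) (\<xi>(e := a)) e (b - a))"
    using F.mgf_pos[of e] e by (intro ln_mono) auto
  then show ?thesis using G_upd[OF e, of \<xi> b a] by linarith
qed

lemma G_diff_bounds: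
  assumes e: "e \<in> bonds (box c n)" and ab: "a \<le> b"
  shows "0 \<le> G c n (\<xi>(e := b)) - G c n (\<xi>(e := a))" "G c n (\<xi>(e := b)) - G c n (\<xi>(e := a)) \<le> (b - a) * lam"
proof -
  interpret F: rc_graph \<rho> lam "FG c n" by (rule rc_free)
  interpret W: rc_graph \<rho> lam "WG c n" by (rule rc_wired)
  show "0 \<le> G c n (\<xi>(e := b)) - G c n (\<xi>(e := a))" using G_incr[OF assms] by simp
  have "1 \<le> mgf \<rho> (FG c n) (\<xi>(e := a)) e (b - a)" using F.mgf_bounds(1)[of e] e ab by simp
  then have "0 \<le> ln (mgf \<rho> (FG c n) (\<xi>(e := a)) e (b - a))" by simp
  moreover have "mgf \<rho> (WG c n) (\<xi>(e := a)) e (b - a) \<le> exp ((b - a) * lam)"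
    using W.mgf_bounds(2)[of e] e ab by simp
  then have "ln (mgf \<rho> (WG c n) (\<xi>(e := a)) e (b - a)) \<le> ln (exp ((b - a) * lam))"
    using W.mgf_pos[of e "\<xi>(e := a)" "b - a"] e by (intro ln_mono) simp_all
  then have "ln (mgf \<rho> (WG c n) (\<xi>(e := a)) e (b - a)) \<le> (b - a) * lam" by (simp only: ln_exp)
  ultimately show "G c n (\<xi>(e := b)) - G c n (\<xi>(e := a)) \<le> (b - a) * lam"
    unfolding G_upd[OF e] by linarith
qed

text \<open>Enlarging the box raises the exponential moment of the free measure and lowers that of
  the wired one, so the gap between their logarithms shrinks from both sides.\<close>

lemma G_diff_antimono:
  assumes e: "e \<in> bonds (box c n)" and ab: "a \<le> b" and sub: "box c n \<subseteq> box c' n'"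
  shows "G c' n' (\<xi>(e := b)) - G c' n' (\<xi>(e := a)) \<le> G c n (\<xi>(e := b)) - G c n (\<xi>(e := a))"
proof -
  interpret F: rc_graph \<rho> lam "FG c n" by (rule rc_free)
  interpret W: rc_graph \<rho> lam "WG c' n'" by (rule rc_wired)
  have e': "e \<in> bonds (box c' n')" using e bonds_mono[OF sub] by auto
  have "mgf \<rho> (FG c n) (\<xi>(e := a)) e (b - a) \<le> mgf \<rho> (FG c' n') (\<xi>(e := a)) e (b - a)"
    using rc_collapse.mgf_mono[OF rc_collapse_free_free[OF sub] e] ab by simp
  then have "ln (mgf \<rho> (FG c n) (\<xi>(e := a)) e (b - a)) \<le> ln (mgf \<rho> (FG c' n') (\<xi>(e := a)) e (b - a))"
    using F.mgf_pos[of e] e by (intro ln_mono) auto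
  moreover have "mgf \<rho> (WG c' n') (\<xi>(e := a)) e (b - a) \<le> mgf \<rho> (WG c n) (\<xi>(e := a)) e (b - a)"
    using rc_collapse.mgf_mono[OF rc_collapse_wired_wired[OF sub] e] ab by simp
  then have "ln (mgf \<rho> (WG c' n') (\<xi>(e := a)) e (b - a)) \<le> ln (mgf \<rho> (WG c n) (\<xi>(e := a)) e (b - a))"
    using W.mgf_pos[of e] e' by (intro ln_mono) auto
  ultimately show ?thesis unfolding G_upd[OF e] G_upd[OF e'] by linarith
qed

lemma G_cong: "(\<And>e. e \<in> bonds (box c n) \<Longrightarrow> \<xi> e = \<xi>' e) \<Longrightarrow> G c n \<xi> = G c n \<xi>'"
  unfolding G_def
  by (intro arg_cong2[where f = "(-)"] arg_cong[where f = ln]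
      rc_graph.partition_fun_cong[OF rc_wired] rc_graph.partition_fun_cong[OF rc_free]) auto

lemma G_measurable:
  assumes "\<And>e. e \<in> bonds (box c n) \<Longrightarrow> (\<lambda>\<omega>. \<xi> \<omega> e) \<in> borel_measurable M"
  shows "(\<lambda>\<omega>. G c n (\<xi> \<omega>)) \<in> borel_measurable M"
  unfolding G_def
  by (intro borel_measurable_diff borel_measurable_ln rc_graph.partition_fun_measurable[OF rc_wired]
      rc_graph.partition_fun_measurable[OF rc_free]) (auto intro: assms)

text \<open>The weight ratio of wired to free is increasing in the conductances and homogeneous of
  degree proportional to the number of identified vertices; comparing the constant configurations at
  the two ends of the support bounds the surface free energy by the size of the boundary.\<close>

lemma G_oscillation: "\<exists>g. \<forall>\<xi>. g \<le> G c n \<xi> \<and> G c n \<xi> \<le> g + 4 * (2 * real n + 1) * ln lam"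
proof -
  interpret C: rc_collapse \<rho> lam "FG c n" "WG c n" "wired_class (box c n)" "bonds (box c n)"
    by (rule rc_collapse_free_wired)
  let ?E = "bonds (box c n)"
  let ?sf = "s_weight (FG c n)" and ?sw = "s_weight (WG c n)"
  define a where "a = (\<lambda>_::bond. inverse lam)"
  define b where "b = (\<lambda>_::bond. lam)"
  define kf where "kf = card (box c n) - 1"
  define kw where "kw = card (verts (WG c n)) - 1"
  have ab: "\<forall>e\<in>?E. a e > 0" "\<forall>e\<in>?E. b e > 0" using lam_pos by (auto simp: a_def b_def)
  \<comment> \<open>For ordered configurations minimum and maximum are the configurations
    themselves, so the lattice inequality says that \<open>?sw / ?sf\<close> is increasing.\<close>
  have mono: "?sf x * ?sw y \<le> ?sf y * ?sw x"
    if "\<forall>e\<in>?E. x e > 0" "\<forall>e\<in>?E. y e > 0" "\<forall>e\<in>?E. y e \<le> x e" for x y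
  proof -
    have "?sf (\<lambda>e. if e \<in> ?E then min (x e) (y e) else x e) = ?sf y"
      by (rule C.G1.s_weight_cong) (use that in auto)
    moreover have "?sw (\<lambda>e. if e \<in> ?E then max (x e) (y e) else y e) = ?sw x"
      by (rule C.G2.s_weight_cong) (use that in \<open>auto simp: max_def\<close>)
    ultimately show ?thesis using C.s_weight_lattice[of x y] that by simp
  qed
  have pf: "?sf x > 0" "?sw x > 0" if "\<forall>e\<in>?E. x e > 0" for x
    using C.G1.s_weight_pos[of x] C.G2.s_weight_pos[of x] that by auto
  define r where "r = ?sw a / ?sf a"
  have r: "r > 0" using pf[OF ab(1)] by (simp add: r_def)
  \<comment> \<open>The upper corner is a multiple of the lower one, so homogeneity with the
    exponents -kf/2 and -kw/2 gives the ratio of the weights at \<open>b\<close> from that at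
    \<open>a\<close>, with the extra factor \<open>lam powr d\<close>.\<close>
  have b_eq: "b = (\<lambda>e. lam\<^sup>2 * a e)" using lam_pos by (simp add: a_def b_def power2_eq_square mult.assoc)
  have sfb: "?sf b = (lam\<^sup>2) powr (- real kf / 2) * ?sf a" "?sw b = (lam\<^sup>2) powr (- real kw / 2) * ?sw a"
    unfolding b_eq using C.G1.s_weight_scale[of "lam\<^sup>2" a] C.G2.s_weight_scale[of "lam\<^sup>2" a] lam_pos
    by (simp_all add: kf_def kw_def)
  have lp: "(lam\<^sup>2) powr (x / 2) = lam powr x" for x
    using lam_pos by (simp add: powr_powr flip: powr_numeral)
  define d where "d = real kf - real kw"
  have rb: "?sw b = lam powr d * r * ?sf b"
  proof -
    have "?sw b = lam powr (- real kw) * ?sw a" "?sf b = lam powr (- real kf) * ?sf a"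
      using sfb lp[of "- real kw"] lp[of "- real kf"] by simp_all
    moreover have "lam powr d * lam powr (- real kf) = lam powr (- real kw)"
      by (simp add: d_def flip: powr_add)
    ultimately show ?thesis using pf[OF ab(1)] by (simp add: r_def)
  qed
  \<comment> \<open>The exponent counts the vertices lost by wiring, hence is at most the number of
    boundary points: linear in n in dimension two.\<close>
  have d: "d \<le> 4 * (2 * real n + 1)"
  proof -
    have "card (box c n) \<le> card (verts (WG c n)) + 4 * (2 * n + 1)"
      using card_verts_wired(1)[OF finite_box, of c n] card_boundary_box[of c n] by linarith
    moreover have "card (verts (WG c n)) > 0" "card (box c n) > 0"
      using C.G2.verts_ne C.G2.finite_verts C.G1.verts_ne C.G1.finite_verts by (auto simp: card_gt_0_iff)
    ultimately have "real kf \<le> real kw + real (4 * (2 * n + 1))"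
      unfolding kf_def kw_def of_nat_add[symmetric] of_nat_le_iff by linarith
    then show ?thesis by (simp add: d_def)
  qed
  have bounds: "r * ?sf x \<le> ?sw x \<and> ?sw x \<le> lam powr d * r * ?sf x" if x: "x \<in> cube ?E" for x
  proof
    have xp: "\<forall>e\<in>?E. x e > 0" by (rule cube_pos[OF x])
    have "?sf x * ?sw a \<le> ?sf a * ?sw x" using mono[of x a] xp ab x by (auto simp: cube_def a_def)
    then show "r * ?sf x \<le> ?sw x" using pf[OF ab(1)] by (simp add: r_def field_simps)
    have "?sf b * ?sw x \<le> ?sf x * ?sw b" using mono[of b x] xp ab x by (auto simp: cube_def b_def)
    then have "?sf b * ?sw x \<le> ?sf b * (lam powr d * r * ?sf x)" unfolding rb by (simp add: mult_ac)
    then show "?sw x \<le> lam powr d * r * ?sf x" using pf[OF ab(2)] by simp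
  qed
  have PE: "C.W1.PE = C.W2.PE" by simp
  show ?thesis
  proof (rule exI[of _ "ln r"], rule allI)
    fix \<xi> :: "bond \<Rightarrow> real"
    let ?Zf = "partition_fun \<rho> (FG c n) \<xi>" and ?Zw = "partition_fun \<rho> (WG c n) \<xi>"
    have Z: "?Zf > 0" "?Zw > 0" using C.W1.partition_fun_pos C.W2.partition_fun_pos by auto
    have gb: "r * gibbs_weight (FG c n) \<xi> x \<le> gibbs_weight (WG c n) \<xi> x \<and>
      gibbs_weight (WG c n) \<xi> x \<le> lam powr d * r * gibbs_weight (FG c n) \<xi> x" if "x \<in> cube ?E" for x
      using bounds[OF that] unfolding C.W1.gibbs_weight_exp C.W2.gibbs_weight_exp
      by (auto simp flip: mult.assoc intro!: mult_right_mono)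
    have if1: "integrable C.W1.PE (gibbs_weight (FG c n) \<xi>)" by (rule C.W1.integrable_gibbs)
    have iw1: "integrable C.W1.PE (gibbs_weight (WG c n) \<xi>)" using C.W2.integrable_gibbs by simp
    have ae: "AE \<kappa> in C.W1.PE. \<kappa> \<in> cube (edges (FG c n))" by (rule AE_cube[OF C.G1.finite_edges])
    have "(\<integral>\<kappa>. r * gibbs_weight (FG c n) \<xi> \<kappa> \<partial>C.W1.PE) \<le> (\<integral>\<kappa>. gibbs_weight (WG c n) \<xi> \<kappa> \<partial>C.W1.PE)"
      by (intro integral_mono_AE integrable_mult_right if1 iw1 eventually_mono[OF ae]) (simp add: gb)
    then have 1: "r * ?Zf \<le> ?Zw" by (simp add: partition_fun_def)
    have "(\<integral>\<kappa>. gibbs_weight (WG c n) \<xi> \<kappa> \<partial>C.W1.PE) \<le> (\<integral>\<kappa>. (lam powr d * r) * gibbs_weight (FG c n) \<xi> \<kappa> \<partial>C.W1.PE)"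
      by (intro integral_mono_AE integrable_mult_right if1 iw1 eventually_mono[OF ae]) (simp add: gb)
    then have 2: "?Zw \<le> (lam powr d * r) * ?Zf" by (simp add: partition_fun_def)
    have "ln (r * ?Zf) \<le> ln ?Zw" using 1 r Z by (intro ln_mono) auto
    then have "ln r \<le> G c n \<xi>" using r Z by (simp add: G_def ln_mult)
    moreover have "ln ?Zw \<le> ln ((lam powr d * r) * ?Zf)" using 2 Z by (intro ln_mono) auto
    then have "G c n \<xi> \<le> ln r + d * ln lam" using r Z lam_pos by (simp add: G_def ln_mult ln_powr)
    moreover have "d * ln lam \<le> 4 * (2 * real n + 1) * ln lam"
      using d lam_ge_1 by (intro mult_right_mono) auto
    ultimately show "ln r \<le> G c n \<xi> \<and> G c n \<xi> \<le> ln r + 4 * (2 * real n + 1) * ln lam" by linarith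
  qed
qed

text \<open>The product reference measure is invariant under relabelling of the edges, so only the
  determinants have to be matched.\<close>

lemma partition_fun_reindex:
  assumes G1: "rc_graph \<rho> lam G1" and G2: "rc_graph \<rho> lam G2"
    and \<psi>: "inj_on \<psi> (edges G1)" "edges G2 = \<psi> ` edges G1"
    and det: "\<And>\<kappa>. lap_det G2 \<kappa> = lap_det G1 (\<kappa> \<circ> \<psi>)"
  shows "partition_fun \<rho> G2 \<xi> = partition_fun \<rho> G1 (\<xi> \<circ> \<psi>)"
proof -
  interpret G1: rc_graph \<rho> lam G1 by fact
  interpret G2: rc_graph \<rho> lam G2 by fact
  let ?t = "\<lambda>\<omega>. \<lambda>e\<in>edges G1. \<omega> (\<psi> e)"
  have d: "distr G2.PE G1.PE ?t = G1.PE"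
    using distr_PiM_reindex[of "edges G2" "\<lambda>_. \<rho>" \<psi> "edges G1"] \<psi> \<rho>.prob_space_axioms by auto
  have t: "?t \<in> measurable G2.PE G1.PE"
    using \<psi>(2) by (intro measurable_restrict measurable_component_singleton) auto
  have g: "gibbs_weight G1 (\<xi> \<circ> \<psi>) (?t \<omega>) = gibbs_weight G2 \<xi> \<omega>" for \<omega>
  proof -
    have "gibbs_weight G1 (\<xi> \<circ> \<psi>) (?t \<omega>) = gibbs_weight G1 (\<xi> \<circ> \<psi>) (\<omega> \<circ> \<psi>)"
      by (rule G1.gibbs_weight_cong) simp
    also have "\<dots> = gibbs_weight G2 \<xi> \<omega>"
      unfolding G1.gibbs_weight_exp G2.gibbs_weight_exp G1.s_weight_eq G2.s_weight_eq det \<psi>(2)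
      by (simp add: sum.reindex[OF \<psi>(1)])
    finally show ?thesis .
  qed
  have "partition_fun \<rho> G1 (\<xi> \<circ> \<psi>) = (\<integral>\<kappa>. gibbs_weight G1 (\<xi> \<circ> \<psi>) \<kappa> \<partial>distr G2.PE G1.PE ?t)"
    by (simp add: d partition_fun_def)
  also have "\<dots> = (\<integral>\<kappa>. gibbs_weight G1 (\<xi> \<circ> \<psi>) (?t \<kappa>) \<partial>G2.PE)"
    by (rule integral_distr[OF t G1.gibbs_weight_measurable])
  finally show ?thesis by (simp add: g partition_fun_def)
qed

lemma G_shift: "G (c + a) n \<xi> = G c n (\<xi> \<circ> shift a)"
proof -
  have i: "inj_on (shift a) A" for A using inj_shift by (rule inj_on_subset) simp
  have "partition_fun \<rho> (FG (c + a) n) \<xi> = partition_fun \<rho> (FG c n) (\<xi> \<circ> shift a)"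
    by (rule partition_fun_reindex[OF rc_free rc_free i]) (simp_all add: box_shift bonds_shift lap_det_free_shift[unfolded box_shift])
  moreover have "partition_fun \<rho> (WG (c + a) n) \<xi> = partition_fun \<rho> (WG c n) (\<xi> \<circ> shift a)"
    by (rule partition_fun_reindex[OF rc_wired rc_wired i]) (simp_all add: box_shift bonds_shift lap_det_wired_shift[unfolded box_shift])
  ultimately show ?thesis by (simp add: G_def)
qed

end


section \<open>Response to the disorder\<close>

text \<open>Nondegeneracy of the single bond law is encoded by two separated rays of positive mass,
  between which mass can be moved upwards.\<close>

locale disorder = bounded_reference +
  fixes \<nu> :: "real measure" and A B :: real
  assumes prob_\<nu>: "prob_space \<nu>" and sets_\<nu>: "sets \<nu> = sets borel" and AB: "A < B"
    and pA: "measure \<nu> {..A} > 0" and pB: "measure \<nu> {B..} > 0"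
begin

sublocale \<nu>: prob_space \<nu> by (rule prob_\<nu>)

lemma space_\<nu>: "space \<nu> = UNIV"
  using sets_eq_imp_space_eq[OF sets_\<nu>] by simp

abbreviation P :: "(bond \<Rightarrow> real) measure" where
  "P \<equiv> \<Pi>\<^sub>M e\<in>lattice_bonds. \<nu>"

sublocale P: prob_space P
  by (rule prob_space_PiM) (rule prob_\<nu>)

text \<open>The bound is required at every configuration and not just almost surely, so that it
  survives prescribing the value of one bond.\<close>

definition bm :: "((bond \<Rightarrow> real) \<Rightarrow> real) \<Rightarrow> bool" where
  "bm Y \<longleftrightarrow> Y \<in> borel_measurable P \<and> (\<exists>K. \<forall>\<xi>. \<bar>Y \<xi>\<bar> \<le> K)"

lemma bm_integrable: "bm Y \<Longrightarrow> integrable P Y"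
proof -
  assume "bm Y"
  then obtain K where "Y \<in> borel_measurable P" "\<forall>\<xi>. \<bar>Y \<xi>\<bar> \<le> K" unfolding bm_def by blast
  then show ?thesis by (intro P.integrable_const_bound[of _ K]) auto
qed

lemma bm_const: "bm (\<lambda>_. c)" unfolding bm_def by auto

lemma bm_add: assumes "bm X" "bm Y" shows "bm (\<lambda>\<xi>. X \<xi> + Y \<xi>)"
proof -
  obtain K K' where "\<forall>\<xi>. \<bar>X \<xi>\<bar> \<le> K" "\<forall>\<xi>. \<bar>Y \<xi>\<bar> \<le> K'" using assms unfolding bm_def by blast
  then have "\<forall>\<xi>. \<bar>X \<xi> + Y \<xi>\<bar> \<le> K + K'" by (meson abs_triangle_ineq add_mono order_trans)
  then show ?thesis using assms unfolding bm_def by auto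
qed

lemma bm_mult: assumes "bm X" "bm Y" shows "bm (\<lambda>\<xi>. X \<xi> * Y \<xi>)"
proof -
  obtain K K' where K: "\<forall>\<xi>. \<bar>X \<xi>\<bar> \<le> K" "\<forall>\<xi>. \<bar>Y \<xi>\<bar> \<le> K'" using assms unfolding bm_def by blast
  have "\<bar>X \<xi> * Y \<xi>\<bar> \<le> K * K'" for \<xi>
  proof -
    have "0 \<le> K" using K(1) abs_ge_zero[of "X \<xi>"] order_trans by blast
    then show ?thesis unfolding abs_mult using K by (intro mult_mono) simp_all
  qed
  then show ?thesis using assms unfolding bm_def by auto
qed

lemma bm_cmult: "bm X \<Longrightarrow> bm (\<lambda>\<xi>. c * X \<xi>)"
  by (rule bm_mult[OF bm_const])

lemma bm_diff: assumes "bm X" "bm Y" shows "bm (\<lambda>\<xi>. X \<xi> - Y \<xi>)"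
  using bm_add[OF assms(1) bm_cmult[OF assms(2), of "-1"]] by simp

lemma bm_power2: "bm X \<Longrightarrow> bm (\<lambda>\<xi>. (X \<xi>)\<^sup>2)"
  unfolding power2_eq_square by (rule bm_mult)

lemma component_P: "e \<in> lattice_bonds \<Longrightarrow> (\<lambda>\<xi>. \<xi> e) \<in> borel_measurable P"
  using measurable_component_singleton[of e lattice_bonds "\<lambda>_. \<nu>"]
  by (simp add: measurable_cong_sets[OF refl sets_\<nu>])

lemma bm_comp:
  assumes "a \<in> borel_measurable borel" "\<And>x. \<bar>a x\<bar> \<le> K" "e \<in> lattice_bonds"
  shows "bm (\<lambda>\<xi>. a (\<xi> e))"
  unfolding bm_def using measurable_compose[OF component_P[OF assms(3)] assms(1)] assms(2) by auto

lemma bm_upd: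
  assumes e: "e \<in> lattice_bonds" and Y: "bm Y"
  shows "bm (\<lambda>\<xi>. Y (\<xi>(e := x)))"
proof -
  have "(\<lambda>\<xi>. \<lambda>i\<in>lattice_bonds. if i = e then x else \<xi> i) \<in> measurable P P"
    by (intro measurable_restrict) (auto simp: space_\<nu> intro: measurable_component_singleton)
  moreover have Ym: "Y \<in> borel_measurable P" using Y by (simp add: bm_def)
  ultimately have m: "(\<lambda>\<xi>. Y (\<lambda>i\<in>lattice_bonds. if i = e then x else \<xi> i)) \<in> borel_measurable P"
    by (rule measurable_compose)
  have "(\<lambda>i\<in>lattice_bonds. if i = e then x else \<xi> i) = \<xi>(e := x)" if "\<xi> \<in> space P" for \<xi>
    using that e by (auto simp: space_PiM PiE_iff extensional_def fun_eq_iff)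
  then have "(\<lambda>\<xi>. Y (\<xi>(e := x))) \<in> borel_measurable P"
    by (intro measurable_cong[THEN iffD1, rotated, OF m]) simp
  then show ?thesis using Y unfolding bm_def by blast
qed

lemma resample:
  assumes e: "e \<in> lattice_bonds" and Y: "bm Y"
  shows "(\<integral>\<xi>. Y \<xi> \<partial>P) = (\<integral>\<xi>. (\<integral>x. Y (\<xi>(e := x)) \<partial>\<nu>) \<partial>P)"
    and "bm (\<lambda>\<xi>. \<integral>x. Y (\<xi>(e := x)) \<partial>\<nu>)"
    and "\<And>\<xi>. \<xi> \<in> space P \<Longrightarrow> integrable \<nu> (\<lambda>x. Y (\<xi>(e := x)))"
proof -
  let ?L = "lattice_bonds - {e}"
  let ?Q = "\<Pi>\<^sub>M i\<in>?L. \<nu>"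
  interpret Q: prob_space ?Q by (rule prob_space_PiM) (rule prob_\<nu>)
  interpret PQ: pair_prob_space \<nu> ?Q ..
  have ins: "insert e ?L = lattice_bonds" using e by auto
  let ?g = "\<lambda>p. (snd p)(e := fst p) :: bond \<Rightarrow> real"
  have d: "distr (\<nu> \<Otimes>\<^sub>M ?Q) P ?g = P"
    using distr_pair_PiM_eq_PiM[of ?L "\<lambda>_. \<nu>" e, OF prob_\<nu> prob_\<nu>] unfolding ins split_def .
  have g: "?g \<in> measurable (\<nu> \<Otimes>\<^sub>M ?Q) P"
  proof -
    have m: "(\<lambda>p. \<lambda>i\<in>lattice_bonds. if i = e then fst p else snd p i) \<in> measurable (\<nu> \<Otimes>\<^sub>M ?Q) P"
    proof (rule measurable_restrict)
      fix i assume i: "i \<in> lattice_bonds"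
      show "(\<lambda>p. if i = e then fst p else snd p i) \<in> measurable (\<nu> \<Otimes>\<^sub>M ?Q) \<nu>"
      proof (cases "i = e")
        case False
        then have "(\<lambda>p. snd p i) \<in> measurable (\<nu> \<Otimes>\<^sub>M ?Q) \<nu>"
          using i by (intro measurable_compose[OF measurable_snd] measurable_component_singleton) auto
        then show ?thesis using False by simp
      qed simp
    qed
    have eq: "(\<lambda>i\<in>lattice_bonds. if i = e then fst p else snd p i) = ?g p"
      if "p \<in> space (\<nu> \<Otimes>\<^sub>M ?Q)" for p
    proof
      fix i
      have "snd p \<in> extensional ?L"
        using that unfolding space_pair_measure space_PiM PiE_def by (simp add: mem_Times_iff)
      then have "snd p i = undefined" if "i \<notin> lattice_bonds"
        using that by (intro extensional_arb[of _ ?L]) simp_all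
      then show "(\<lambda>i\<in>lattice_bonds. if i = e then fst p else snd p i) i = ?g p i"
        using e by (cases "i \<in> lattice_bonds"; cases "i = e") simp_all
    qed
    show ?thesis using measurable_cong[of "\<nu> \<Otimes>\<^sub>M ?Q" _ ?g, OF eq] m by (simp only:)
  qed
  have upd: "(\<lambda>x. \<xi>(e := x)) \<in> measurable \<nu> P" if "\<xi> \<in> space P" for \<xi>
  proof -
    have m: "(\<lambda>x. \<lambda>i\<in>lattice_bonds. if i = e then x else \<xi> i) \<in> measurable \<nu> P"
    proof (rule measurable_restrict)
      fix i show "(\<lambda>x. if i = e then x else \<xi> i) \<in> measurable \<nu> \<nu>"
        by (cases "i = e") (simp_all add: space_\<nu>)
    qed
    have eq: "(\<lambda>i\<in>lattice_bonds. if i = e then x else \<xi> i) = \<xi>(e := x)" for x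
      using that e by (auto simp: space_PiM PiE_iff extensional_def fun_eq_iff)
    show ?thesis using m unfolding eq .
  qed
  obtain K where K: "\<forall>\<xi>. \<bar>Y \<xi>\<bar> \<le> K" and Ym: "Y \<in> borel_measurable P" using Y unfolding bm_def by blast
  show i\<nu>: "integrable \<nu> (\<lambda>x. Y (\<xi>(e := x)))" if "\<xi> \<in> space P" for \<xi>
    by (rule \<nu>.integrable_const_bound[of _ K, OF AE_I2 measurable_compose[OF upd[OF that] Ym]]) (use K in simp)
  have split: "(\<integral>\<xi>. Z \<xi> \<partial>P) = (\<integral>X. (\<integral>x. Z (X(e := x)) \<partial>\<nu>) \<partial>?Q)" if "bm Z" for Z
  proof -
    have Zm: "Z \<in> borel_measurable P" and Zb: "\<exists>K. \<forall>\<xi>. \<bar>Z \<xi>\<bar> \<le> K" using that by (auto simp: bm_def)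
    obtain K where "\<forall>\<xi>. \<bar>Z \<xi>\<bar> \<le> K" using Zb by blast
    then have "integrable (\<nu> \<Otimes>\<^sub>M ?Q) (\<lambda>p. Z (?g p))"
      by (intro PQ.integrable_const_bound[of _ K, OF AE_I2 measurable_compose[OF g Zm]]) simp
    then have int: "integrable (\<nu> \<Otimes>\<^sub>M ?Q) (\<lambda>(x, X). Z (X(e := x)))" by (simp only: split_def)
    have "(\<integral>\<xi>. Z \<xi> \<partial>P) = (\<integral>\<xi>. Z \<xi> \<partial>distr (\<nu> \<Otimes>\<^sub>M ?Q) P ?g)" by (simp only: d)
    also have "\<dots> = (\<integral>p. Z (?g p) \<partial>(\<nu> \<Otimes>\<^sub>M ?Q))" by (rule integral_distr[OF g Zm])
    also have "\<dots> = (\<integral>(x, X). Z (X(e := x)) \<partial>(\<nu> \<Otimes>\<^sub>M ?Q))" by (simp only: split_def)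
    also have "\<dots> = (\<integral>X. (\<integral>x. Z (X(e := x)) \<partial>\<nu>) \<partial>?Q)"
      by (rule PQ.integral_snd[OF int, symmetric])
    finally show ?thesis .
  qed
  have m2: "(\<lambda>p. Y ((fst p)(e := snd p))) \<in> borel_measurable (P \<Otimes>\<^sub>M \<nu>)"
  proof -
    have "(\<lambda>p. \<lambda>i\<in>lattice_bonds. if i = e then snd p else fst p i) \<in> measurable (P \<Otimes>\<^sub>M \<nu>) P"
    proof (rule measurable_restrict)
      fix i assume i: "i \<in> lattice_bonds"
      show "(\<lambda>p. if i = e then snd p else fst p i) \<in> measurable (P \<Otimes>\<^sub>M \<nu>) \<nu>"
      proof (cases "i = e")
        case False
        then have "(\<lambda>p. fst p i) \<in> measurable (P \<Otimes>\<^sub>M \<nu>) \<nu>"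
          using i by (intro measurable_compose[OF measurable_fst] measurable_component_singleton) auto
        then show ?thesis using False by simp
      qed simp
    qed
    from measurable_compose[OF this Ym]
    have m: "(\<lambda>p. Y (\<lambda>i\<in>lattice_bonds. if i = e then snd p else fst p i)) \<in> borel_measurable (P \<Otimes>\<^sub>M \<nu>)" .
    have eq: "(\<lambda>i\<in>lattice_bonds. if i = e then snd p else fst p i) = (fst p)(e := snd p)"
      if "p \<in> space (P \<Otimes>\<^sub>M \<nu>)" for p
      using that e by (auto simp: space_pair_measure space_PiM PiE_iff extensional_def fun_eq_iff)
    show ?thesis by (rule measurable_cong[THEN iffD1, rotated, OF m]) (simp only: eq)
  qed
  have Y2m: "(\<lambda>\<xi>. \<integral>x. Y (\<xi>(e := x)) \<partial>\<nu>) \<in> borel_measurable P"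
    by (rule \<nu>.borel_measurable_lebesgue_integral) (use m2 in \<open>simp only: split_def\<close>)
  \<comment> \<open>Off the product space a section may fail to be integrable; its integral is then
    0 and the bound still holds.\<close>
  have Y2b: "\<bar>\<integral>x. Y (\<xi>(e := x)) \<partial>\<nu>\<bar> \<le> \<bar>K\<bar>" for \<xi>
  proof (cases "integrable \<nu> (\<lambda>x. Y (\<xi>(e := x)))")
    case True
    have "\<bar>\<integral>x. Y (\<xi>(e := x)) \<partial>\<nu>\<bar> \<le> (\<integral>x. \<bar>Y (\<xi>(e := x))\<bar> \<partial>\<nu>)" by (rule integral_abs_bound)
    also have "\<dots> \<le> (\<integral>x. K \<partial>\<nu>)" using True K by (intro integral_mono integrable_abs) simp_all
    also have "\<dots> \<le> \<bar>K\<bar>" by (simp add: \<nu>.prob_space)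
    finally show ?thesis .
  qed (simp add: not_integrable_integral_eq)
  show b2: "bm (\<lambda>\<xi>. \<integral>x. Y (\<xi>(e := x)) \<partial>\<nu>)" unfolding bm_def using Y2m Y2b by blast
  \<comment> \<open>Split both sides. The resampled function no longer depends on the coordinate
    \<open>e\<close>, so its inner integral is that of a constant against a probability
    measure.\<close>
  show "(\<integral>\<xi>. Y \<xi> \<partial>P) = (\<integral>\<xi>. (\<integral>x. Y (\<xi>(e := x)) \<partial>\<nu>) \<partial>P)"
    unfolding split[OF Y] split[OF b2] fun_upd_upd by (simp add: \<nu>.prob_space)
qed

lemma E_factor:
  assumes e: "e \<in> lattice_bonds" and a: "a \<in> borel_measurable borel" "\<And>x. \<bar>a x\<bar> \<le> K"
    and X: "bm X" "\<And>\<xi> x. X (\<xi>(e := x)) = X \<xi>"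
  shows "(\<integral>\<xi>. a (\<xi> e) * X \<xi> \<partial>P) = (\<integral>x. a x \<partial>\<nu>) * (\<integral>\<xi>. X \<xi> \<partial>P)"
proof -
  have "bm (\<lambda>\<xi>. a (\<xi> e) * X \<xi>)" by (intro bm_mult bm_comp[OF a e] X)
  from resample(1)[OF e this] show ?thesis by (simp add: X(2))
qed

text \<open>Multiplying the law of a bond by \<open>1 + \<theta> h\<close> moves mass \<open>\<theta>\<close> from the ray below \<open>A\<close> to the ray above
  \<open>B\<close>; \<open>L\<close> is the density of the disorder tilted in this way on a finite set of bonds.\<close>

definition h :: "real \<Rightarrow> real" where
  "h x = indicator {B..} x / measure \<nu> {B..} - indicator {..A} x / measure \<nu> {..A}"

definition H :: real where "H = 1 / measure \<nu> {B..} + 1 / measure \<nu> {..A}"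

lemma H_pos: "H > 0" using pA pB by (simp add: H_def add_pos_pos)

lemma h_measurable[measurable]: "h \<in> borel_measurable borel" unfolding h_def[abs_def] by measurable

lemma h_bound: "\<bar>h x\<bar> \<le> H"
  using pA pB AB by (auto simp: h_def H_def indicator_def)

lemma sets_rays: "{..A} \<in> sets \<nu>" "{B..} \<in> sets \<nu>" by (simp_all add: sets_\<nu>)

lemma integrable_rays: "integrable \<nu> (indicator {..A} :: real \<Rightarrow> real)" "integrable \<nu> (indicator {B..} :: real \<Rightarrow> real)"
  using sets_rays by (auto simp: integrable_indicator_iff \<nu>.emeasure_finite less_top[symmetric])

lemma integral_rays: "(\<integral>x. b * indicator {B..} x - a * indicator {..A} x \<partial>\<nu>) = b * measure \<nu> {B..} - a * measure \<nu> {..A}"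
  using integrable_rays by (simp add: space_\<nu>)

lemma integral_h: "(\<integral>x. h x \<partial>\<nu>) = 0"
  using integral_rays[of "1 / measure \<nu> {B..}" "1 / measure \<nu> {..A}"] pA pB by (simp add: h_def)

definition L :: "real \<Rightarrow> bond set \<Rightarrow> (bond \<Rightarrow> real) \<Rightarrow> real" where
  "L \<theta> F \<xi> = (\<Prod>e\<in>F. 1 + \<theta> * h (\<xi> e))"

lemma L_insert: "finite F \<Longrightarrow> e \<notin> F \<Longrightarrow> L \<theta> (insert e F) \<xi> = (1 + \<theta> * h (\<xi> e)) * L \<theta> F \<xi>"
  by (simp add: L_def)

lemma L_upd: "e \<notin> F \<Longrightarrow> L \<theta> F (\<xi>(e := x)) = L \<theta> F \<xi>"
  unfolding L_def by (intro prod.cong) auto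

lemma factor_bound: "\<bar>1 + \<theta> * h x\<bar> \<le> 1 + \<bar>\<theta>\<bar> * H"
proof -
  have "\<bar>\<theta> * h x\<bar> \<le> \<bar>\<theta>\<bar> * H" unfolding abs_mult by (intro mult_left_mono h_bound) simp
  then show ?thesis by linarith
qed

lemma factor_measurable: "(\<lambda>x. 1 + \<theta> * h x) \<in> borel_measurable borel" by measurable

lemma bm_L: "finite F \<Longrightarrow> F \<subseteq> lattice_bonds \<Longrightarrow> bm (L \<theta> F)"
proof (induction F rule: finite_induct)
  case empty then show ?case using bm_const[of 1] by (simp add: L_def[abs_def])
next
  case (insert e F)
  have "bm (\<lambda>\<xi>. (1 + \<theta> * h (\<xi> e)) * L \<theta> F \<xi>)"
    using insert by (intro bm_mult bm_comp[OF factor_measurable factor_bound]) auto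
  moreover have "L \<theta> (insert e F) = (\<lambda>\<xi>. (1 + \<theta> * h (\<xi> e)) * L \<theta> F \<xi>)"
    using insert by (intro ext L_insert)
  ultimately show ?case by simp
qed

lemma integral_factor: "(\<integral>x. 1 + \<theta> * h x \<partial>\<nu>) = 1"
proof -
  have "integrable \<nu> h"
    by (rule \<nu>.integrable_const_bound[of _ H]) (use h_bound in \<open>auto simp: measurable_cong_sets[OF sets_\<nu> refl]\<close>)
  then show ?thesis by (simp add: integral_h \<nu>.prob_space)
qed

lemma E_L_free:
  assumes "finite F" "F \<subseteq> lattice_bonds" and X: "bm X" "\<forall>e\<in>F. \<forall>\<xi> x. X (\<xi>(e := x)) = X \<xi>"
  shows "(\<integral>\<xi>. L \<theta> F \<xi> * X \<xi> \<partial>P) = (\<integral>\<xi>. X \<xi> \<partial>P)"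
  using assms
proof (induction F rule: finite_induct)
  case (insert e F)
  have "(\<integral>\<xi>. L \<theta> (insert e F) \<xi> * X \<xi> \<partial>P) = (\<integral>\<xi>. (1 + \<theta> * h (\<xi> e)) * (L \<theta> F \<xi> * X \<xi>) \<partial>P)"
    using insert by (simp add: L_insert mult.assoc)
  also have "\<dots> = (\<integral>x. 1 + \<theta> * h x \<partial>\<nu>) * (\<integral>\<xi>. L \<theta> F \<xi> * X \<xi> \<partial>P)"
    using insert by (intro E_factor[OF _ factor_measurable factor_bound] bm_mult bm_L) (auto simp: L_upd simp del: fun_upd_apply)
  finally show ?case using insert by (simp only: integral_factor) simp
qed (simp add: L_def)

text \<open>Because \<open>h\<close> has mean zero the linear term in \<theta> drops out, and each
  bond costs only a factor 1 + O(\<theta>^2). This is why a tilt of order 1/n on O(n^2) bonds has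
  bounded second moment.\<close>

lemma E_L_square:
  assumes "finite F" "F \<subseteq> lattice_bonds"
  shows "(\<integral>\<xi>. (L \<theta> F \<xi>)\<^sup>2 \<partial>P) \<le> (1 + \<theta>\<^sup>2 * H\<^sup>2) ^ card F"
  using assms
proof (induction F rule: finite_induct)
  case empty then show ?case by (simp add: L_def P.prob_space)
next
  case (insert e F)
  have b: "\<bar>(1 + \<theta> * h x)\<^sup>2\<bar> \<le> (1 + \<bar>\<theta>\<bar> * H)\<^sup>2" for x
    using power_mono[OF factor_bound[of \<theta> x], of 2] by (simp add: power2_abs)
  have ih: "integrable \<nu> h"
    by (rule \<nu>.integrable_const_bound[of _ H]) (use h_bound in \<open>auto simp: measurable_cong_sets[OF sets_\<nu> refl]\<close>)
  have h2: "(h x)\<^sup>2 \<le> H\<^sup>2" for x using power_mono[OF h_bound[of x], of 2] by (simp add: power2_abs)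
  have ih2: "integrable \<nu> (\<lambda>x. (h x)\<^sup>2)"
    by (rule \<nu>.integrable_const_bound[of _ "H\<^sup>2"]) (use h2 in \<open>auto simp: measurable_cong_sets[OF sets_\<nu> refl]\<close>)
  have "(\<integral>x. (1 + \<theta> * h x)\<^sup>2 \<partial>\<nu>) = (\<integral>x. 1 + 2 * \<theta> * h x + \<theta>\<^sup>2 * (h x)\<^sup>2 \<partial>\<nu>)"
    by (simp add: power2_sum power_mult_distrib algebra_simps)
  also have "\<dots> = 1 + \<theta>\<^sup>2 * (\<integral>x. (h x)\<^sup>2 \<partial>\<nu>)" using ih ih2 by (simp add: integral_h \<nu>.prob_space)
  also have "(\<integral>x. (h x)\<^sup>2 \<partial>\<nu>) \<le> (\<integral>x. H\<^sup>2 \<partial>\<nu>)" using ih2 h2 by (intro integral_mono) auto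
  finally have one: "(\<integral>x. (1 + \<theta> * h x)\<^sup>2 \<partial>\<nu>) \<le> 1 + \<theta>\<^sup>2 * H\<^sup>2"
    by (simp add: \<nu>.prob_space mult_left_mono)
  have "(\<integral>\<xi>. (L \<theta> (insert e F) \<xi>)\<^sup>2 \<partial>P) = (\<integral>\<xi>. (1 + \<theta> * h (\<xi> e))\<^sup>2 * (L \<theta> F \<xi>)\<^sup>2 \<partial>P)"
    using insert by (simp add: L_insert power_mult_distrib)
  also have "\<dots> = (\<integral>x. (1 + \<theta> * h x)\<^sup>2 \<partial>\<nu>) * (\<integral>\<xi>. (L \<theta> F \<xi>)\<^sup>2 \<partial>P)"
    using insert by (intro E_factor[OF _ _ b] bm_power2 bm_L) (auto simp: L_upd simp del: fun_upd_apply)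
  also have "\<dots> \<le> (1 + \<theta>\<^sup>2 * H\<^sup>2) * (1 + \<theta>\<^sup>2 * H\<^sup>2) ^ card F"
    using insert one by (intro mult_mono) auto
  finally show ?case using insert by simp
qed

lemma factor_nonneg:
  assumes "0 \<le> \<theta>" "\<theta> * H \<le> 1" shows "1 - \<theta> * H \<le> 1 + \<theta> * h x" "0 \<le> 1 + \<theta> * h x"
proof -
  have "\<theta> * (- H) \<le> \<theta> * h x" using h_bound[of x] assms(1) by (intro mult_left_mono) auto
  then show "1 - \<theta> * H \<le> 1 + \<theta> * h x" by simp
  then show "0 \<le> 1 + \<theta> * h x" using assms(2) by linarith
qed

lemma L_nonneg: "0 \<le> \<theta> \<Longrightarrow> \<theta> * H \<le> 1 \<Longrightarrow> 0 \<le> L \<theta> F \<xi>"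
  unfolding L_def by (intro prod_nonneg) (simp add: factor_nonneg)

text \<open>The factors of bonds outside \<open>S\<close> integrate to one by independence, and each
  factor on \<open>S\<close> is at least 1 - \<theta> H. A local observable thus loses little under
  the tilt, however large \<open>F\<close> is.\<close>

lemma E_L_local:
  assumes F: "finite F" "F \<subseteq> lattice_bonds" and X: "bm X" "\<forall>e\<in>-S. \<forall>\<xi> x. X (\<xi>(e := x)) = X \<xi>"
    and X0: "\<forall>\<xi>. 0 \<le> X \<xi>" and S: "finite S" and \<theta>: "0 \<le> \<theta>" "\<theta> * H \<le> 1"
  shows "(1 - \<theta> * H) ^ card S * (\<integral>\<xi>. X \<xi> \<partial>P) \<le> (\<integral>\<xi>. L \<theta> F \<xi> * X \<xi> \<partial>P)"
proof -
  have t: "0 \<le> 1 - \<theta> * H" "1 - \<theta> * H \<le> 1" using \<theta> H_pos by auto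
  have split: "L \<theta> F \<xi> = L \<theta> (F \<inter> S) \<xi> * L \<theta> (F - S) \<xi>" for \<xi>
  proof -
    have "F = (F \<inter> S) \<union> (F - S)" by auto
    then show ?thesis unfolding L_def using F by (metis Diff_disjoint Int_Diff_disjoint finite_Diff finite_Int prod.union_disjoint)
  qed
  have low: "(1 - \<theta> * H) ^ card S \<le> L \<theta> (F \<inter> S) \<xi>" for \<xi>
  proof -
    have "(1 - \<theta> * H) ^ card S \<le> (1 - \<theta> * H) ^ card (F \<inter> S)"
      using t S by (intro power_decreasing card_mono) auto
    also have "\<dots> \<le> L \<theta> (F \<inter> S) \<xi>"
      unfolding L_def using t factor_nonneg[OF \<theta>] F
        prod_mono[of "F \<inter> S" "\<lambda>_. 1 - \<theta> * H" "\<lambda>e. 1 + \<theta> * h (\<xi> e)"] by simp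
    finally show ?thesis .
  qed
  have bLX: "bm (\<lambda>\<xi>. L \<theta> (F - S) \<xi> * X \<xi>)" using F by (intro bm_mult bm_L X) auto
  have "(1 - \<theta> * H) ^ card S * (\<integral>\<xi>. X \<xi> \<partial>P) = (\<integral>\<xi>. (1 - \<theta> * H) ^ card S * (L \<theta> (F - S) \<xi> * X \<xi>) \<partial>P)"
  proof -
    have "(\<integral>\<xi>. L \<theta> (F - S) \<xi> * X \<xi> \<partial>P) = (\<integral>\<xi>. X \<xi> \<partial>P)"
      by (rule E_L_free) (use F X in auto)
    then show ?thesis by simp
  qed
  also have "\<dots> \<le> (\<integral>\<xi>. L \<theta> F \<xi> * X \<xi> \<partial>P)"
  proof (rule integral_mono)
    show "integrable P (\<lambda>\<xi>. (1 - \<theta> * H) ^ card S * (L \<theta> (F - S) \<xi> * X \<xi>))"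
      by (intro bm_integrable bm_cmult bLX)
    show "integrable P (\<lambda>\<xi>. L \<theta> F \<xi> * X \<xi>)" by (intro bm_integrable bm_mult bm_L F X)
    fix \<xi>
    have "(1 - \<theta> * H) ^ card S * (L \<theta> (F - S) \<xi> * X \<xi>) \<le> L \<theta> (F \<inter> S) \<xi> * (L \<theta> (F - S) \<xi> * X \<xi>)"
      using low L_nonneg[OF \<theta>] X0 by (intro mult_right_mono) auto
    then show "(1 - \<theta> * H) ^ card S * (L \<theta> (F - S) \<xi> * X \<xi>) \<le> L \<theta> F \<xi> * X \<xi>"
      by (simp add: split mult.assoc)
  qed
  finally show ?thesis .
qed

text \<open>Both values of the bond are prescribed, so the response is a function of the disorder on
  the other bonds only.\<close>

definition D :: "site \<Rightarrow> nat \<Rightarrow> bond \<Rightarrow> (bond \<Rightarrow> real) \<Rightarrow> real" where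
  "D c n e \<xi> = G c n (\<xi>(e := B)) - G c n (\<xi>(e := A))"

lemma bonds_lattice: "bonds \<Lambda> \<subseteq> lattice_bonds" by (rule bonds_mono) simp

lemma bm_G: "bm (G c n)"
proof -
  have "G c n \<in> borel_measurable P"
    using bonds_lattice by (intro G_measurable component_P) auto
  moreover obtain g where "\<forall>\<xi>. g \<le> G c n \<xi> \<and> G c n \<xi> \<le> g + 4 * (2 * real n + 1) * ln lam"
    using G_oscillation[of c n] by blast
  then have "\<forall>\<xi>. \<bar>G c n \<xi>\<bar> \<le> \<bar>g\<bar> + \<bar>g + 4 * (2 * real n + 1) * ln lam\<bar>" by (auto simp: abs_le_iff) (smt (verit))+
  ultimately show ?thesis unfolding bm_def by blast
qed

lemma bm_D: "e \<in> lattice_bonds \<Longrightarrow> bm (D c n e)"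
  unfolding D_def by (intro bm_diff bm_upd bm_G)

lemma D_bounds: "e \<in> bonds (box c n) \<Longrightarrow> 0 \<le> D c n e \<xi> \<and> D c n e \<xi> \<le> (B - A) * lam"
  unfolding D_def using G_diff_bounds[of e c n A B \<xi>] AB by simp

lemma D_antimono: "e \<in> bonds (box c n) \<Longrightarrow> box c n \<subseteq> box c' n' \<Longrightarrow> D c' n' e \<xi> \<le> D c n e \<xi>"
  unfolding D_def using G_diff_antimono[of e c n A B c' n' \<xi>] AB by simp

lemma D_upd: "e' \<notin> bonds (box c n) \<Longrightarrow> D c n e (\<xi>(e' := x)) = D c n e \<xi>"
  unfolding D_def by (intro arg_cong2[where f = "(-)"] G_cong) auto

lemma D_shift: "D a n (shift a e) \<xi> = D 0 n e (\<xi> \<circ> shift a)"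
proof -
  have "(\<xi>(shift a e := x)) \<circ> shift a = (\<xi> \<circ> shift a)(e := x)" for x
    using inj_shift[of a] by (auto simp: fun_eq_iff inj_eq)
  then show ?thesis unfolding D_def using G_shift[of 0 a n] by simp
qed

lemma shift_lattice: "e \<in> lattice_bonds \<Longrightarrow> shift a e \<in> lattice_bonds"
  using bonds_shift[of a UNIV] bonds_mono[of "(\<lambda>x. x + a) ` UNIV" UNIV] by blast

lemma E_D_shift:
  assumes e: "e \<in> lattice_bonds"
  shows "(\<integral>\<xi>. D a n (shift a e) \<xi> \<partial>P) = (\<integral>\<xi>. D 0 n e \<xi> \<partial>P)"
proof -
  let ?t = "\<lambda>\<xi>. \<lambda>i\<in>lattice_bonds. \<xi> (shift a i)"
  have d: "distr P P ?t = P"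
    using distr_PiM_reindex[of lattice_bonds "\<lambda>_. \<nu>" "shift a" lattice_bonds] prob_\<nu> shift_lattice
      inj_on_subset[OF inj_shift, of lattice_bonds a] by auto
  have t: "?t \<in> measurable P P"
    by (intro measurable_restrict measurable_component_singleton shift_lattice)
  have "(\<integral>\<xi>. D 0 n e \<xi> \<partial>P) = (\<integral>\<xi>. D 0 n e \<xi> \<partial>distr P P ?t)" by (simp only: d)
  also have "\<dots> = (\<integral>\<xi>. D 0 n e (?t \<xi>) \<partial>P)"
    using bm_D[OF e, of 0 n] by (intro integral_distr[OF t]) (simp add: bm_def)
  also have "\<dots> = (\<integral>\<xi>. D a n (shift a e) \<xi> \<partial>P)"
  proof (rule Bochner_Integration.integral_cong[OF refl])
    fix \<xi>
    have "D 0 n e (?t \<xi>) = D 0 n e (\<xi> \<circ> shift a)"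
      unfolding D_def using bonds_lattice by (intro arg_cong2[where f = "(-)"] G_cong) auto
    then show "D 0 n e (?t \<xi>) = D a n (shift a e) \<xi>" by (simp only: D_shift)
  qed
  finally show ?thesis by simp
qed

text \<open>Integrating G against \<open>h\<close> in the variable of \<open>e\<close> yields its
  average over the upper ray minus its average over the lower one. Since G is increasing in that
  variable, this is at least the difference of its values at B and at A.\<close>

lemma tilt_step:
  assumes F: "finite F" "F \<subseteq> lattice_bonds" and e: "e \<in> bonds (box c n)" "e \<notin> F"
    and \<theta>: "0 \<le> \<theta>" "\<theta> * H \<le> 1"
  shows "(\<integral>\<xi>. L \<theta> F \<xi> * G c n \<xi> \<partial>P) + \<theta> * (\<integral>\<xi>. L \<theta> F \<xi> * D c n e \<xi> \<partial>P)
    \<le> (\<integral>\<xi>. L \<theta> (insert e F) \<xi> * G c n \<xi> \<partial>P)"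
proof -
  have el: "e \<in> lattice_bonds" using e bonds_lattice by blast
  let ?Y = "\<lambda>\<xi>. h (\<xi> e) * (L \<theta> F \<xi> * G c n \<xi>)"
  have bLG: "bm (\<lambda>\<xi>. L \<theta> F \<xi> * G c n \<xi>)" by (intro bm_mult bm_L F bm_G)
  have bY: "bm ?Y" by (intro bm_mult bm_comp[OF h_measurable h_bound el] bm_L F bm_G)
  have bLD: "bm (\<lambda>\<xi>. L \<theta> F \<xi> * D c n e \<xi>)" by (intro bm_mult bm_L F bm_D el)
  have pt: "L \<theta> F \<xi> * D c n e \<xi> \<le> (\<integral>x. ?Y (\<xi>(e := x)) \<partial>\<nu>)" if \<xi>: "\<xi> \<in> space P" for \<xi>
  proof -
    let ?b = "G c n (\<xi>(e := B)) / measure \<nu> {B..}" and ?a = "G c n (\<xi>(e := A)) / measure \<nu> {..A}"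
    have le: "?b * indicator {B..} x - ?a * indicator {..A} x \<le> h x * G c n (\<xi>(e := x))" for x
    proof -
      have "?b * indicator {B..} x \<le> indicator {B..} x / measure \<nu> {B..} * G c n (\<xi>(e := x))"
        using G_incr[OF e(1), of B x \<xi>] pB by (auto simp: indicator_def divide_right_mono)
      moreover have "indicator {..A} x / measure \<nu> {..A} * G c n (\<xi>(e := x)) \<le> ?a * indicator {..A} x"
        using G_incr[OF e(1), of x A \<xi>] pA by (auto simp: indicator_def divide_right_mono)
      ultimately show ?thesis unfolding h_def left_diff_distrib by linarith
    qed
    have int1: "integrable \<nu> (\<lambda>x. ?b * indicator {B..} x - ?a * indicator {..A} x)"
      using integrable_rays by (intro Bochner_Integration.integrable_diff integrable_mult_right)
    have bhG: "bm (\<lambda>\<xi>. h (\<xi> e) * G c n \<xi>)" by (intro bm_mult bm_comp[OF h_measurable h_bound el] bm_G)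
    have int2: "integrable \<nu> (\<lambda>x. h x * G c n (\<xi>(e := x)))"
      using resample(3)[OF el bhG \<xi>] by simp
    have "D c n e \<xi> = (\<integral>x. ?b * indicator {B..} x - ?a * indicator {..A} x \<partial>\<nu>)"
      unfolding integral_rays D_def using pA pB by simp
    also have "\<dots> \<le> (\<integral>x. h x * G c n (\<xi>(e := x)) \<partial>\<nu>)" by (rule integral_mono[OF int1 int2 le])
    finally have "L \<theta> F \<xi> * D c n e \<xi> \<le> L \<theta> F \<xi> * (\<integral>x. h x * G c n (\<xi>(e := x)) \<partial>\<nu>)"
      by (rule mult_left_mono) (rule L_nonneg[OF \<theta>])
    also have "\<dots> = (\<integral>x. L \<theta> F \<xi> * (h x * G c n (\<xi>(e := x))) \<partial>\<nu>)" by simp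
    also have "\<dots> = (\<integral>x. ?Y (\<xi>(e := x)) \<partial>\<nu>)" using e(2) by (simp add: L_upd mult_ac)
    finally show ?thesis .
  qed
  have "(\<integral>\<xi>. L \<theta> F \<xi> * D c n e \<xi> \<partial>P) \<le> (\<integral>\<xi>. (\<integral>x. ?Y (\<xi>(e := x)) \<partial>\<nu>) \<partial>P)"
    by (rule integral_mono[OF bm_integrable[OF bLD] bm_integrable[OF resample(2)[OF el bY]] pt])
  also have "\<dots> = (\<integral>\<xi>. ?Y \<xi> \<partial>P)" by (rule resample(1)[OF el bY, symmetric])
  finally have "\<theta> * (\<integral>\<xi>. L \<theta> F \<xi> * D c n e \<xi> \<partial>P) \<le> \<theta> * (\<integral>\<xi>. ?Y \<xi> \<partial>P)"
    using \<theta>(1) by (rule mult_left_mono)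
  moreover have "(\<integral>\<xi>. L \<theta> (insert e F) \<xi> * G c n \<xi> \<partial>P) = (\<integral>\<xi>. L \<theta> F \<xi> * G c n \<xi> + \<theta> * ?Y \<xi> \<partial>P)"
    using F(1) e(2) by (simp add: L_insert algebra_simps)
  moreover have "\<dots> = (\<integral>\<xi>. L \<theta> F \<xi> * G c n \<xi> \<partial>P) + \<theta> * (\<integral>\<xi>. ?Y \<xi> \<partial>P)"
    using bm_integrable[OF bLG] bm_integrable[OF bY] by simp
  ultimately show ?thesis by linarith
qed

text \<open>Bonds are tilted one at a time, so the response of the next bond must be bounded below
  under every partial tilt \<open>F'\<close>.\<close>

lemma tilt_lower_bound:
  assumes F: "finite F" "F \<subseteq> bonds (box c n)" and \<theta>: "0 \<le> \<theta>" "\<theta> * H \<le> 1"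
    and low: "\<And>F' e. F' \<subseteq> F \<Longrightarrow> e \<in> F - F' \<Longrightarrow> q \<le> (\<integral>\<xi>. L \<theta> F' \<xi> * D c n e \<xi> \<partial>P)"
  shows "(\<integral>\<xi>. G c n \<xi> \<partial>P) + \<theta> * real (card F) * q \<le> (\<integral>\<xi>. L \<theta> F \<xi> * G c n \<xi> \<partial>P)"
  using F low
proof (induction F rule: finite_induct)
  case empty then show ?case by (simp add: L_def)
next
  case (insert e F)
  have "(\<integral>\<xi>. G c n \<xi> \<partial>P) + \<theta> * real (card F) * q \<le> (\<integral>\<xi>. L \<theta> F \<xi> * G c n \<xi> \<partial>P)"
    using insert.prems by (intro insert.IH) auto
  moreover have "\<theta> * q \<le> \<theta> * (\<integral>\<xi>. L \<theta> F \<xi> * D c n e \<xi> \<partial>P)"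
    using insert.hyps \<theta>(1) by (intro mult_left_mono insert.prems(2)) auto
  moreover have "(\<integral>\<xi>. L \<theta> F \<xi> * G c n \<xi> \<partial>P) + \<theta> * (\<integral>\<xi>. L \<theta> F \<xi> * D c n e \<xi> \<partial>P)
    \<le> (\<integral>\<xi>. L \<theta> (insert e F) \<xi> * G c n \<xi> \<partial>P)"
  proof (rule tilt_step)
    show "F \<subseteq> lattice_bonds" using insert.prems(1) bonds_lattice by blast
  qed (use insert \<theta> in auto)
  ultimately show ?case using insert.hyps by (simp add: algebra_simps)
qed

text \<open>The tilt is a probability density, so it cannot raise a mean by more than the
  oscillation of the function.\<close>

lemma tilt_upper_bound:
  assumes F: "finite F" "F \<subseteq> lattice_bonds" and \<theta>: "0 \<le> \<theta>" "\<theta> * H \<le> 1"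
  shows "(\<integral>\<xi>. L \<theta> F \<xi> * G c n \<xi> \<partial>P) \<le> (\<integral>\<xi>. G c n \<xi> \<partial>P) + 4 * (2 * real n + 1) * ln lam"
proof -
  obtain g where g: "\<forall>\<xi>. g \<le> G c n \<xi> \<and> G c n \<xi> \<le> g + 4 * (2 * real n + 1) * ln lam"
    using G_oscillation[of c n] by blast
  let ?u = "g + 4 * (2 * real n + 1) * ln lam"
  have "(\<integral>\<xi>. L \<theta> F \<xi> * G c n \<xi> \<partial>P) \<le> (\<integral>\<xi>. L \<theta> F \<xi> * ?u \<partial>P)"
    by (intro integral_mono bm_integrable bm_mult bm_L F bm_G bm_const mult_left_mono L_nonneg \<theta>) (use g in auto)
  also have "\<dots> = ?u"
    using E_L_free[OF F bm_const[of ?u], of \<theta>] by (simp add: P.prob_space)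
  also have "g = (\<integral>\<xi>. g \<partial>P)" by (simp add: P.prob_space)
  also have "(\<integral>\<xi>. g \<partial>P) \<le> (\<integral>\<xi>. G c n \<xi> \<partial>P)"
    by (intro integral_mono bm_integrable bm_G bm_const) (use g in auto)
  finally show ?thesis by simp
qed

text \<open>A bond is an unordered pair, so the translation is read off from the least coordinates
  of its endpoints. This makes translates of one bond by different sites distinct.\<close>

lemma shift_eq_site:
  assumes "e \<in> lattice_bonds" "shift a e = shift b e" shows "a = b"
proof -
  have e: "finite e" "e \<noteq> {}" using assms(1) by (auto elim: bondsE)
  have "Min ((\<lambda>z. fst z + fst c) ` e) = Min (fst ` e) + fst c" "Min ((\<lambda>z. snd z + snd c) ` e) = Min (snd ` e) + snd c" for c :: site
    by (rule Min_add_commute[OF e])+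
  moreover have "fst ` shift c e = (\<lambda>z. fst z + fst c) ` e" "snd ` shift c e = (\<lambda>z. snd z + snd c) ` e" for c
    unfolding shift_def image_image by simp_all
  ultimately have "Min (fst ` e) + fst a = Min (fst ` e) + fst b" "Min (snd ` e) + snd a = Min (snd ` e) + snd b"
    using assms(2) by metis+
  then show ?thesis by (simp add: prod_eq_iff)
qed

text \<open>Young's inequality with weight \<alpha>, followed by Y^2 \<le> T Y. The first term is
  controlled by the second moment of the tilt, the second by the mean of Y, which can be made small
  after \<alpha> has been fixed.\<close>

lemma E_L_error:
  assumes F: "finite F" "F \<subseteq> lattice_bonds" and Y: "bm Y" "\<forall>\<xi>. 0 \<le> Y \<xi> \<and> Y \<xi> \<le> T" and \<alpha>: "\<alpha> > 0"
  shows "(\<integral>\<xi>. L \<theta> F \<xi> * Y \<xi> \<partial>P) \<le> \<alpha> / 2 * exp (\<theta>\<^sup>2 * H\<^sup>2 * real (card F)) + T / (2 * \<alpha>) * (\<integral>\<xi>. Y \<xi> \<partial>P)"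
proof -
  have pt: "l * y \<le> \<alpha> / 2 * l\<^sup>2 + T / (2 * \<alpha>) * y" if "0 \<le> y" "y \<le> T" for l y
  proof -
    have "0 \<le> (\<alpha> * l - y)\<^sup>2" by simp
    then have "2 * \<alpha> * (l * y) \<le> \<alpha>\<^sup>2 * l\<^sup>2 + y * y" by (simp add: power2_diff power_mult_distrib power2_eq_square algebra_simps)
    also have "y * y \<le> T * y" using that by (intro mult_right_mono)
    finally have "l * y \<le> (\<alpha>\<^sup>2 * l\<^sup>2 + T * y) / (2 * \<alpha>)" using \<alpha> by (simp add: pos_le_divide_eq mult_ac)
    also have "\<dots> = \<alpha> / 2 * l\<^sup>2 + T / (2 * \<alpha>) * y"
      using \<alpha> by (simp add: add_divide_distrib power2_eq_square)
    finally show ?thesis .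
  qed
  have iL: "integrable P (\<lambda>\<xi>. (L \<theta> F \<xi>)\<^sup>2)" and iY: "integrable P Y"
    by (intro bm_integrable bm_power2 bm_L F Y)+
  have "(\<integral>\<xi>. L \<theta> F \<xi> * Y \<xi> \<partial>P) \<le> (\<integral>\<xi>. \<alpha> / 2 * (L \<theta> F \<xi>)\<^sup>2 + T / (2 * \<alpha>) * Y \<xi> \<partial>P)"
  proof (rule integral_mono)
    show "integrable P (\<lambda>\<xi>. L \<theta> F \<xi> * Y \<xi>)" by (intro bm_integrable bm_mult bm_L F Y)
    show "integrable P (\<lambda>\<xi>. \<alpha> / 2 * (L \<theta> F \<xi>)\<^sup>2 + T / (2 * \<alpha>) * Y \<xi>)"
      by (intro Bochner_Integration.integrable_add integrable_mult_right iL iY)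
  qed (use pt Y in blast)
  also have "\<dots> = \<alpha> / 2 * (\<integral>\<xi>. (L \<theta> F \<xi>)\<^sup>2 \<partial>P) + T / (2 * \<alpha>) * (\<integral>\<xi>. Y \<xi> \<partial>P)"
    using iL iY by (subst Bochner_Integration.integral_add) auto
  also have "(\<integral>\<xi>. (L \<theta> F \<xi>)\<^sup>2 \<partial>P) \<le> exp (\<theta>\<^sup>2 * H\<^sup>2 * real (card F))"
  proof -
    have "(1 + \<theta>\<^sup>2 * H\<^sup>2) ^ card F \<le> exp (\<theta>\<^sup>2 * H\<^sup>2) ^ card F" by (intro power_mono) auto
    also have "\<dots> = exp (\<theta>\<^sup>2 * H\<^sup>2 * real (card F))" by (simp add: exp_of_nat_mult[symmetric] mult.commute)
    finally show ?thesis using E_L_square[OF F, of \<theta>] by linarith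
  qed
  finally show ?thesis using \<alpha> by simp
qed

text \<open>The tilt \<open>\<theta> = K / n\<close> on the \<open>O(n\<^sup>2)\<close> bonds of the box is contiguous to the original disorder, but if
  the mean response \<open>E D\<close> stayed above \<open>\<delta>\<close> it would raise the mean surface free energy by
  \<open>K n \<delta>\<close>, more than its oscillation of order \<open>n\<close> allows. Dimension two enters here only.\<close>

lemma E_D_small:
  assumes e: "e \<in> bonds (box 0 m0)" and \<delta>: "\<delta> > 0"
  shows "\<exists>m\<ge>m0. (\<integral>\<xi>. D 0 m e \<xi> \<partial>P) < \<delta>"
proof (rule ccontr)
  define d where "d m = (\<integral>\<xi>. D 0 m e \<xi> \<partial>P)" for m
  assume "\<not> (\<exists>m\<ge>m0. (\<integral>\<xi>. D 0 m e \<xi> \<partial>P) < \<delta>)"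
  then have d\<delta>: "\<delta> \<le> d m" if "m0 \<le> m" for m using that unfolding d_def by (simp add: not_less)
  have el: "e \<in> lattice_bonds" using e bonds_lattice by blast
  have sub: "box 0 m \<subseteq> box 0 m'" if "m \<le> m'" for m m' using that by (intro box_mono) auto
  have em: "e \<in> bonds (box 0 m)" if "m0 \<le> m" for m using e bonds_mono[OF sub[OF that]] by blast
  have d_anti: "d m' \<le> d m" if "m0 \<le> m" "m \<le> m'" for m m'
    unfolding d_def by (intro integral_mono bm_integrable bm_D el D_antimono em sub that)
  \<comment> \<open>\<open>T\<close> bounds every response. \<open>K\<close> is chosen so that the
    gain K \<delta> n exceeds the oscillation over a box of side O(n), the summand 1 making the
    excess strict. \<open>C1\<close> bounds the second moment of a tilt on at most 9 n^2 bonds.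
    \<open>\<alpha>\<close> and \<open>\<epsilon>\<close> make each of the two error terms equal to
    \<delta>/8.\<close>
  define T where "T = (B - A) * lam"
  define l where "l = ln lam"
  define K where "K = 4 * ((2 * real m0 + 3) * l + 1) / \<delta>"
  define C1 where "C1 = exp (9 * K\<^sup>2 * H\<^sup>2)"
  define \<alpha> where "\<alpha> = \<delta> / (4 * C1)"
  define \<epsilon> where "\<epsilon> = \<delta> * \<alpha> / (4 * T)"
  have T: "T > 0" using AB lam_pos by (simp add: T_def)
  have l: "l \<ge> 0" using lam_ge_1 by (simp add: l_def)
  have K: "K > 0" unfolding K_def using l \<delta> by (intro divide_pos_pos mult_pos_pos add_nonneg_pos mult_nonneg_nonneg) auto
  have C1: "C1 > 0" by (simp add: C1_def)
  have \<alpha>: "\<alpha> > 0" using \<delta> C1 by (simp add: \<alpha>_def)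
  have \<epsilon>: "\<epsilon> > 0" using \<delta> \<alpha> T by (simp add: \<epsilon>_def)
  \<comment> \<open>The mean responses decrease and stay above \<delta>, so beyond some box they
    drop by at most \<epsilon> more.\<close>
  obtain m where m: "m0 \<le> m" "\<And>M. m \<le> M \<Longrightarrow> d m - d M \<le> \<epsilon>"
  proof -
    have dec: "decseq (\<lambda>i. d (m0 + i))" unfolding decseq_def by (intro allI impI d_anti) auto
    obtain lim where lim: "(\<lambda>i. d (m0 + i)) \<longlonglongrightarrow> lim" "\<forall>i. lim \<le> d (m0 + i)"
      by (rule decseq_convergent[OF dec, of \<delta>]) (use d\<delta> in auto)
    have "eventually (\<lambda>i. d (m0 + i) < lim + \<epsilon>) sequentially"
      using lim(1) \<epsilon> by (intro order_tendstoD) auto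
    then obtain i where i: "d (m0 + i) < lim + \<epsilon>" by (auto simp: eventually_sequentially)
    show thesis
    proof (rule that[of "m0 + i"])
      fix M assume "m0 + i \<le> M"
      then have "lim \<le> d M" using lim(2)[rule_format, of "M - m0"] by simp
      then show "d (m0 + i) - d M \<le> \<epsilon>" using i by linarith
    qed simp
  qed
  define s where "s = card (bonds (box 0 m))"
  \<comment> \<open>The box is taken large only after \<open>m\<close>, so the tilt is weak even in
    total over the \<open>s\<close> bonds of the small box: \<theta> H and s \<theta> H are at most
    1/2.\<close>
  obtain n :: nat where n: "real n \<ge> 1 + real m + 2 * K * H + 2 * real s * K * H"
    using real_arch_simple by blast
  have KH: "0 \<le> 2 * K * H" "0 \<le> 2 * real s * K * H" using K H_pos by auto
  have n1: "real n \<ge> 1" "m \<le> n" "2 * K * H \<le> real n" "2 * real s * K * H \<le> real n"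
    using n KH by linarith+
  define \<theta> where "\<theta> = K / real n"
  have \<theta>: "0 \<le> \<theta>" "\<theta> * H \<le> 1 / 2" "real s * (\<theta> * H) \<le> 1 / 2"
    using K n1 by (simp_all add: \<theta>_def divide_le_eq mult_ac)
  have \<theta>1: "\<theta> * H \<le> 1" using \<theta>(2) by simp
  \<comment> \<open>\<open>?N\<close> makes room for all translates of \<open>e\<close> by sites of
    \<open>box 0 n\<close>; \<open>?M\<close> exceeds it by a further n, so that a box of this
    radius around any such site contains the common box.\<close>
  let ?N = "n + m0" and ?M = "2 * n + m0"
  \<comment> \<open>Only translates of one bond are tilted: by translation invariance they have
    equal mean responses, and their number is already quadratic in n.\<close>
  define F where "F = (\<lambda>a. shift a e) ` box 0 n"
  have cF: "card F = (2 * n + 1) * (2 * n + 1)"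
  proof -
    have "card F = card (box 0 n)"
      unfolding F_def by (rule card_image) (auto simp: inj_on_def dest: shift_eq_site[OF el])
    also have "\<dots> = (2 * n + 1) * (2 * n + 1)"
    proof -
      have "nat (2 * int n + 1) = 2 * n + 1" by linarith
      then show ?thesis unfolding box_def card_cartesian_product by (simp add: algebra_simps)
    qed
    finally show ?thesis .
  qed
  have in_box: "box a m0 \<subseteq> box 0 ?N" "box 0 ?N \<subseteq> box a ?M" "box a m \<subseteq> box a ?M" if "a \<in> box 0 n" for a
  proof -
    have ab: "\<bar>fst a\<bar> \<le> int n" "\<bar>snd a\<bar> \<le> int n" using that by (auto simp: box_def mem_Times_iff)
    show "box a m0 \<subseteq> box 0 ?N" by (rule box_mono) (use ab in simp_all)
    show "box 0 ?N \<subseteq> box a ?M" by (rule box_mono) (use ab in simp_all)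
    show "box a m \<subseteq> box a ?M" by (rule box_mono) (use n1(2) in simp_all)
  qed
  have sh: "shift a e \<in> bonds (box a k)" if "m0 \<le> k" for a k
    using em[OF that] box_shift[of 0 a k] by (simp add: bonds_shift)
  have F: "finite F" "F \<subseteq> bonds (box 0 ?N)"
    using finite_box[of 0 n] sh[OF order_refl] in_box(1) bonds_mono by (auto simp: F_def) blast
  have low: "\<delta> / 4 \<le> (\<integral>\<xi>. L \<theta> F' \<xi> * D 0 ?N e' \<xi> \<partial>P)" if F': "F' \<subseteq> F" "e' \<in> F - F'" for F' e'
  proof -
    obtain a where a: "a \<in> box 0 n" "e' = shift a e" using F' by (auto simp: F_def)
    have fF': "finite F'" "F' \<subseteq> lattice_bonds" using F' F finite_subset bonds_lattice by blast+
    have e'l: "e' \<in> lattice_bonds" unfolding a(2) by (rule shift_lattice[OF el])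
    have e'm: "e' \<in> bonds (box a m)" "e' \<in> bonds (box 0 ?N)"
      using sh[OF m(1)] F' F(2) by (auto simp: a(2))
    \<comment> \<open>\<open>?X\<close> is the local response and \<open>?Z\<close> the response in
      a box containing the common one, hence a lower bound for the response sought. The tilted mean
      of \<open>?X\<close> is at least \<delta>/2 by locality; that of \<open>?X - ?Z\<close> is at
      most \<delta>/4, because its original mean is at most \<epsilon>.\<close>
    let ?X = "D a m e'" and ?Z = "D a ?M e'"
    let ?Y = "\<lambda>\<xi>. ?X \<xi> - ?Z \<xi>"
    have b: "bm ?X" "bm ?Z" by (intro bm_D e'l)+
    have bY: "bm ?Y" by (intro bm_diff b)
    have e'M: "e' \<in> bonds (box a ?M)" using e'm(1) bonds_mono[OF in_box(3)[OF a(1)]] by blast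
    have Y: "\<forall>\<xi>. 0 \<le> ?Y \<xi> \<and> ?Y \<xi> \<le> T"
    proof
      fix \<xi>
      have "?Z \<xi> \<le> ?X \<xi>" by (rule D_antimono[OF e'm(1) in_box(3)[OF a(1)]])
      moreover have "?X \<xi> \<le> T" "0 \<le> ?Z \<xi>" using D_bounds[OF e'm(1)] D_bounds[OF e'M] by (auto simp: T_def)
      ultimately show "0 \<le> ?Y \<xi> \<and> ?Y \<xi> \<le> T" by linarith
    qed
    have EY: "(\<integral>\<xi>. ?Y \<xi> \<partial>P) = d m - d ?M"
      using bm_integrable[OF b(1)] bm_integrable[OF b(2)] by (simp add: d_def a(2) E_D_shift[OF el])
    have "(\<integral>\<xi>. L \<theta> F' \<xi> * ?Y \<xi> \<partial>P) \<le> \<alpha> / 2 * exp (\<theta>\<^sup>2 * H\<^sup>2 * real (card F')) + T / (2 * \<alpha>) * (d m - d ?M)"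
      using E_L_error[OF fF' bY Y \<alpha>, of \<theta>] unfolding EY .
    also have "\<dots> \<le> \<alpha> / 2 * C1 + T / (2 * \<alpha>) * \<epsilon>"
    proof (intro add_mono mult_left_mono)
      have "real (card F') \<le> real (card F)" using card_mono[OF F(1) F'(1)] by simp
      also have "\<dots> = (2 * real n + 1) * (2 * real n + 1)" by (simp add: cF algebra_simps)
      also have "\<dots> \<le> (3 * real n) * (3 * real n)" using n1(1) by (intro mult_mono) auto
      finally have "\<theta>\<^sup>2 * H\<^sup>2 * real (card F') \<le> \<theta>\<^sup>2 * H\<^sup>2 * (9 * (real n)\<^sup>2)"
        by (intro mult_left_mono) (auto simp: power2_eq_square)
      also have "\<dots> = 9 * K\<^sup>2 * H\<^sup>2" using n1(1) by (simp add: \<theta>_def power_divide)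
      finally show "exp (\<theta>\<^sup>2 * H\<^sup>2 * real (card F')) \<le> C1" by (simp add: C1_def)
      show "d m - d ?M \<le> \<epsilon>" using n1(2) by (intro m(2)) simp
    qed (use \<alpha> T in auto)
    also have "\<alpha> / 2 * C1 + T / (2 * \<alpha>) * \<epsilon> = \<delta> / 4"
      using \<alpha> T C1 by (simp add: \<epsilon>_def) (simp add: \<alpha>_def)
    finally have err: "(\<integral>\<xi>. L \<theta> F' \<xi> * ?Y \<xi> \<partial>P) \<le> \<delta> / 4" .
    have cs: "card (bonds (box a m)) = s"
    proof -
      have "bonds (box a m) = shift a ` bonds (box 0 m)" using box_shift[of 0 a m] by (simp add: bonds_shift)
      then show ?thesis unfolding s_def using inj_on_subset[OF inj_shift subset_UNIV] by (simp add: card_image)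
    qed
    have "(1 - \<theta> * H) ^ card (bonds (box a m)) * (\<integral>\<xi>. ?X \<xi> \<partial>P) \<le> (\<integral>\<xi>. L \<theta> F' \<xi> * ?X \<xi> \<partial>P)"
    proof (rule E_L_local[OF fF' b(1)])
      show "\<forall>e\<in>- bonds (box a m). \<forall>\<xi> x. ?X (\<xi>(e := x)) = ?X \<xi>" using D_upd by blast
      show "\<forall>\<xi>. 0 \<le> ?X \<xi>" using D_bounds[OF e'm(1)] by blast
    qed (use finite_bonds[OF finite_box] \<theta> \<theta>1 in auto)
    then have "(1 - \<theta> * H) ^ s * d m \<le> (\<integral>\<xi>. L \<theta> F' \<xi> * ?X \<xi> \<partial>P)"
      unfolding cs by (simp add: d_def a(2) E_D_shift[OF el])
    \<comment> \<open>Bernoulli's inequality: the power is at least 1 - s \<theta> H.\<close>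
    moreover have "1 / 2 \<le> (1 - \<theta> * H) ^ s"
      using Bernoulli_inequality[of "- (\<theta> * H)" s] \<theta> \<theta>1 by simp
    then have "1 / 2 * \<delta> \<le> (1 - \<theta> * H) ^ s * d m"
      using d\<delta>[OF m(1)] \<delta> by (intro mult_mono) auto
    ultimately have main: "\<delta> / 2 \<le> (\<integral>\<xi>. L \<theta> F' \<xi> * ?X \<xi> \<partial>P)" by simp
    have iX: "integrable P (\<lambda>\<xi>. L \<theta> F' \<xi> * ?X \<xi>)" and iY: "integrable P (\<lambda>\<xi>. L \<theta> F' \<xi> * ?Y \<xi>)"
      and iZ: "integrable P (\<lambda>\<xi>. L \<theta> F' \<xi> * ?Z \<xi>)"
      by (intro bm_integrable bm_mult bm_L fF' b bY)+
    have "(\<integral>\<xi>. L \<theta> F' \<xi> * ?Z \<xi> \<partial>P) = (\<integral>\<xi>. L \<theta> F' \<xi> * ?X \<xi> - L \<theta> F' \<xi> * ?Y \<xi> \<partial>P)"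
      by (simp add: algebra_simps)
    also have "\<dots> = (\<integral>\<xi>. L \<theta> F' \<xi> * ?X \<xi> \<partial>P) - (\<integral>\<xi>. L \<theta> F' \<xi> * ?Y \<xi> \<partial>P)"
      by (rule Bochner_Integration.integral_diff[OF iX iY])
    finally have "\<delta> / 4 \<le> (\<integral>\<xi>. L \<theta> F' \<xi> * ?Z \<xi> \<partial>P)" using main err by linarith
    also have "\<dots> \<le> (\<integral>\<xi>. L \<theta> F' \<xi> * D 0 ?N e' \<xi> \<partial>P)"
      by (intro integral_mono iZ bm_integrable bm_mult bm_L fF' bm_D e'l mult_left_mono
          D_antimono[OF e'm(2) in_box(2)[OF a(1)]] L_nonneg \<theta>(1) \<theta>1)
    finally show ?thesis .
  qed
  \<comment> \<open>The gain forced by the tilt is at most the oscillation. The left side is at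
    least K \<delta> n, which the choice of \<open>K\<close> makes too large.\<close>
  have "\<theta> * real (card F) * (\<delta> / 4) \<le> 4 * (2 * real ?N + 1) * l"
    using tilt_lower_bound[OF F \<theta>(1) \<theta>1 low] tilt_upper_bound[OF F(1) _ \<theta>(1) \<theta>1, of 0 ?N] F(2) bonds_lattice
    unfolding l_def by fastforce
  moreover have "\<theta> * (4 * real n * real n) * (\<delta> / 4) \<le> \<theta> * real (card F) * (\<delta> / 4)"
  proof -
    have "4 * real n * real n \<le> real (card F)" by (simp add: cF algebra_simps)
    then show ?thesis using \<theta>(1) \<delta> by (intro mult_right_mono mult_left_mono) auto
  qed
  moreover have "\<theta> * (4 * real n * real n) * (\<delta> / 4) = 4 * ((2 * real m0 + 3) * l + 1) * real n"
  proof -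
    have "\<theta> * (4 * real n * real n) * (\<delta> / 4) = K * \<delta> * real n" using n1(1) by (simp add: \<theta>_def)
    also have "K * \<delta> = 4 * ((2 * real m0 + 3) * l + 1)" using \<delta> by (simp add: K_def)
    finally show ?thesis .
  qed
  moreover have "4 * (2 * real ?N + 1) * l \<le> 4 * ((2 * real m0 + 3) * l) * real n"
  proof -
    have "2 * real m0 + 1 \<le> (2 * real m0 + 1) * real n" using n1(1) mult_left_mono[of 1 "real n" "2 * real m0 + 1"] by simp
    then have "2 * real ?N + 1 \<le> (2 * real m0 + 3) * real n" by (simp add: algebra_simps)
    then have "(2 * real ?N + 1) * l \<le> (2 * real m0 + 3) * real n * l" using l by (rule mult_right_mono)
    then have "4 * ((2 * real ?N + 1) * l) \<le> 4 * ((2 * real m0 + 3) * real n * l)" by (rule mult_left_mono) simp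
    then show ?thesis by (simp only: mult_ac)
  qed
  ultimately have "4 * ((2 * real m0 + 3) * l + 1) * real n \<le> 4 * ((2 * real m0 + 3) * l) * real n" by linarith
  then show False using n1(1) by (simp add: algebra_simps)
qed

text \<open>The responses of a bond decrease with the box and so converge at every configuration;
  the limit is nonnegative with mean zero, hence vanishes almost surely.\<close>

lemma AE_D_tendsto:
  assumes e: "e \<in> lattice_bonds"
  shows "AE \<xi> in P. (\<lambda>n. D 0 n e \<xi>) \<longlonglongrightarrow> 0"
proof -
  obtain m0 where m0: "e \<in> bonds (box 0 m0)" using lattice_bond_in_box[of "{e}"] e by auto
  have sub: "box 0 m \<subseteq> box 0 m'" if "m \<le> m'" for m m' using that by (intro box_mono) auto
  have em: "e \<in> bonds (box 0 (m0 + i))" for i using m0 bonds_mono[OF sub[of m0 "m0 + i"]] by auto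
  let ?f = "\<lambda>i. D 0 (m0 + i) e"
  have dec: "decseq (\<lambda>i. ?f i \<xi>)" for \<xi>
    unfolding decseq_def by (intro allI impI D_antimono em sub) simp
  define g where "g \<xi> = lim (\<lambda>i. ?f i \<xi>)" for \<xi>
  have conv: "(\<lambda>i. ?f i \<xi>) \<longlonglongrightarrow> g \<xi>" and le: "g \<xi> \<le> ?f i \<xi>" and g0: "0 \<le> g \<xi>" for \<xi> i
  proof -
    obtain L where L: "(\<lambda>i. ?f i \<xi>) \<longlonglongrightarrow> L" "\<forall>i. L \<le> ?f i \<xi>"
      by (rule decseq_convergent[OF dec, of 0]) (use D_bounds[OF em] in auto)
    have "g \<xi> = L" unfolding g_def using L(1) by (rule limI)
    then show "(\<lambda>i. ?f i \<xi>) \<longlonglongrightarrow> g \<xi>" "g \<xi> \<le> ?f i \<xi>" using L by auto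
    show "0 \<le> g \<xi>"
      using LIMSEQ_le_const[OF L(1), of 0] D_bounds[OF em] \<open>g \<xi> = L\<close> by auto
  qed
  have fm: "?f i \<in> borel_measurable P" for i using bm_D[OF e] by (simp add: bm_def)
  have gm: "g \<in> borel_measurable P"
    by (rule borel_measurable_LIMSEQ_real[OF conv fm])
  have "bm g"
    unfolding bm_def using gm g0 le[of _ 0] D_bounds[OF em[of 0]]
    by (intro conjI exI[of _ "(B - A) * lam"] allI) (auto intro: order_trans)
  then have gi: "integrable P g" by (rule bm_integrable)
  have "(\<integral>\<xi>. g \<xi> \<partial>P) \<le> 0"
  proof (rule field_le_epsilon)
    fix \<delta> :: real assume "\<delta> > 0"
    then obtain m where m: "m \<ge> m0" "(\<integral>\<xi>. D 0 m e \<xi> \<partial>P) < \<delta>" using E_D_small[OF m0] by blast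
    have "(\<integral>\<xi>. g \<xi> \<partial>P) \<le> (\<integral>\<xi>. D 0 m e \<xi> \<partial>P)"
      using le[of _ "m - m0"] m(1) by (intro integral_mono gi bm_integrable bm_D e) simp
    then show "(\<integral>\<xi>. g \<xi> \<partial>P) \<le> 0 + \<delta>" using m(2) by simp
  qed
  then have "(\<integral>\<xi>. g \<xi> \<partial>P) = 0" using g0 by (simp add: antisym)
  then have "AE \<xi> in P. g \<xi> = 0"
    using integral_nonneg_eq_0_iff_AE[OF gi] g0 by simp
  then show ?thesis
  proof (rule eventually_mono)
    fix \<xi> assume "g \<xi> = 0"
    then have "(\<lambda>i. D 0 (i + m0) e \<xi>) \<longlonglongrightarrow> 0" using conv[of \<xi>] by (simp add: add.commute)
    then show "(\<lambda>n. D 0 n e \<xi>) \<longlonglongrightarrow> 0" by (rule LIMSEQ_offset)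
  qed
qed

end


section \<open>Local limits\<close>

text \<open>Domination by a multiple of one measure makes the sequence uniformly absolutely
  continuous. Convergence then passes from the generator to disjoint countable unions, and no mass
  escapes, so the limit is countably additive.\<close>

lemma setwise_limit:
  fixes S :: "'a measure" and N :: "nat \<Rightarrow> 'a measure"
  assumes S: "prob_space S" and N: "\<And>n. prob_space (N n)" "\<And>n. sets (N n) = sets S"
    and bound: "\<And>n A. A \<in> sets S \<Longrightarrow> measure (N n) A \<le> K * measure S A"
    and gen: "sets S = sigma_sets (space S) Gen" "Int_stable Gen" "Gen \<subseteq> Pow (space S)"
    and conv: "\<And>A. A \<in> Gen \<Longrightarrow> convergent (\<lambda>n. measure (N n) A)"
  shows "\<exists>\<mu>. prob_space \<mu> \<and> sets \<mu> = sets S \<and> (\<forall>A\<in>sets S. (\<lambda>n. measure (N n) A) \<longlonglongrightarrow> measure \<mu> A)"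
proof -
  interpret S: prob_space S by fact
  have spN: "space (N n) = space S" for n using N(2) by (rule sets_eq_imp_space_eq)
  have K: "K \<ge> 0"
  proof -
    interpret N0: prob_space "N 0" by (rule N)
    show ?thesis using bound[of "space S" 0] N0.prob_space S.prob_space spN[of 0] by simp
  qed
  \<comment> \<open>Uniform absolute continuity makes tails of disjoint unions uniformly small.\<close>
  have tail: "\<exists>k. \<forall>n. \<bar>measure (N n) (\<Union>i. A i) - (\<Sum>i<k. measure (N n) (A i))\<bar> \<le> \<epsilon>"
    if A: "disjoint_family A" "range A \<subseteq> sets S" and \<epsilon>: "\<epsilon> > 0" for A :: "nat \<Rightarrow> 'a set" and \<epsilon>
  proof -
    have "(\<lambda>i. measure S (A i)) sums measure S (\<Union>i. A i)" by (rule S.finite_measure_UNION[OF A(2,1)])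
    then have "(\<lambda>k. K * (measure S (\<Union>i. A i) - (\<Sum>i<k. measure S (A i)))) \<longlonglongrightarrow> K * (measure S (\<Union>i. A i) - measure S (\<Union>i. A i))"
      unfolding sums_def by (intro tendsto_intros)
    then have "eventually (\<lambda>k. K * (measure S (\<Union>i. A i) - (\<Sum>i<k. measure S (A i))) < \<epsilon>) sequentially"
      using \<epsilon> by (intro order_tendstoD) auto
    then obtain k where k: "K * (measure S (\<Union>i. A i) - (\<Sum>i<k. measure S (A i))) < \<epsilon>"
      by (auto simp: eventually_sequentially)
    have fin: "measure M ((\<Union>i. A i) - (\<Union>i<k. A i)) = measure M (\<Union>i. A i) - (\<Sum>i<k. measure M (A i))"
      if "prob_space M" "sets M = sets S" for M
    proof -
      interpret M: prob_space M by fact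
      have r: "range A \<subseteq> sets M" using A(2) that(2) by simp
      have "measure M ((\<Union>i. A i) - (\<Union>i<k. A i)) = measure M (\<Union>i. A i) - measure M (\<Union>i<k. A i)"
        using r by (intro M.finite_measure_Diff) auto
      also have "measure M (\<Union>i<k. A i) = (\<Sum>i<k. measure M (A i))"
        using r A(1) by (intro M.finite_measure_finite_Union) (auto simp: disjoint_family_on_def)
      finally show ?thesis .
    qed
    have "\<bar>measure (N n) (\<Union>i. A i) - (\<Sum>i<k. measure (N n) (A i))\<bar> \<le> \<epsilon>" for n
    proof -
      have "measure (N n) ((\<Union>i. A i) - (\<Union>i<k. A i)) \<le> K * measure S ((\<Union>i. A i) - (\<Union>i<k. A i))"
        using A(2) by (intro bound) auto
      then have "measure (N n) ((\<Union>i. A i) - (\<Union>i<k. A i)) \<le> \<epsilon>" using k fin[OF S refl] by simp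
      then show ?thesis using fin[OF N(1,2), of n] measure_nonneg[of "N n" "(\<Union>i. A i) - (\<Union>i<k. A i)"] by linarith
    qed
    then show ?thesis by blast
  qed
  have cnv: "convergent (\<lambda>n. measure (N n) A)" if "A \<in> sets S" for A
  proof -
    have "A \<in> sigma_sets (space S) Gen" using that gen(1) by simp
    with gen(2,3) show ?thesis
    proof (induction rule: sigma_sets_induct_disjoint)
      case (compl A)
      have "measure (N n) (space S - A) = 1 - measure (N n) A" for n
      proof -
        interpret Nn: prob_space "N n" by (rule N)
        show ?thesis using Nn.prob_compl[of A] compl(1) gen(1) N(2) spN by simp
      qed
      then show ?case using convergent_diff[OF convergent_const compl(2), of 1] by simp
    next
      case (union A)
      have r: "range A \<subseteq> sets S" using union(2) gen(1) by simp
      have "Cauchy (\<lambda>n. measure (N n) (\<Union>i. A i))"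
      proof (rule metric_CauchyI)
        fix \<epsilon> :: real assume "\<epsilon> > 0"
        then have e3: "\<epsilon> / 3 > 0" by simp
        obtain k where k: "\<forall>n. \<bar>measure (N n) (\<Union>i. A i) - (\<Sum>i<k. measure (N n) (A i))\<bar> \<le> \<epsilon> / 3"
          using tail[OF union(1) r e3] by blast
        have "convergent (\<lambda>n. \<Sum>i<k. measure (N n) (A i))" using union(3) by (intro convergent_sum)
        then have "Cauchy (\<lambda>n. \<Sum>i<k. measure (N n) (A i))" by (rule convergent_Cauchy)
        then obtain M where M: "\<forall>m\<ge>M. \<forall>n\<ge>M. dist (\<Sum>i<k. measure (N m) (A i)) (\<Sum>i<k. measure (N n) (A i)) < \<epsilon> / 3"
          using e3 unfolding Cauchy_def by blast
        have "dist (measure (N m) (\<Union>i. A i)) (measure (N n) (\<Union>i. A i)) < \<epsilon>" if "M \<le> m" "M \<le> n" for m n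
          using M[rule_format, OF that] k[rule_format, of m] k[rule_format, of n] \<open>\<epsilon> > 0\<close>
          unfolding dist_real_def by linarith
        then show "\<exists>M. \<forall>m\<ge>M. \<forall>n\<ge>M. dist (measure (N m) (\<Union>i. A i)) (measure (N n) (\<Union>i. A i)) < \<epsilon>" by blast
      qed
      then show ?case by (rule Cauchy_convergent)
    qed (auto intro: conv convergent_const)
  qed
  define m where "m A = lim (\<lambda>n. measure (N n) A)" for A
  have lim: "(\<lambda>n. measure (N n) A) \<longlonglongrightarrow> m A" if "A \<in> sets S" for A
    using cnv[OF that] by (simp add: m_def convergent_LIMSEQ_iff)
  have m0: "0 \<le> m A" if "A \<in> sets S" for A
    using LIMSEQ_le_const[OF lim[OF that], of 0] by auto
  define \<mu> where "\<mu> = measure_of (space S) (sets S) (\<lambda>A. ennreal (m A))"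
  have sets\<mu>: "sets \<mu> = sets S" by (simp add: \<mu>_def)
  have em: "emeasure \<mu> A = ennreal (m A)" if "A \<in> sets S" for A
    unfolding \<mu>_def
  proof (rule emeasure_measure_of_sigma)
    show "sigma_algebra (space S) (sets S)" by (rule sets.sigma_algebra_axioms)
    show "positive (sets S) (\<lambda>A. ennreal (m A))" by (simp add: positive_def m_def)
    show "countably_additive (sets S) (\<lambda>A. ennreal (m A))"
    proof (rule countably_additiveI)
      fix A :: "nat \<Rightarrow> 'a set" assume A: "range A \<subseteq> sets S" "disjoint_family A" "(\<Union>i. A i) \<in> sets S"
      have Ai: "A i \<in> sets S" for i using A(1) by auto
      have upper: "(\<Sum>i<k. m (A i)) \<le> m (\<Union>i. A i)" for k
      proof (rule LIMSEQ_le[OF tendsto_sum lim[OF A(3)]])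
        show "\<And>i. i \<in> {..<k} \<Longrightarrow> (\<lambda>n. measure (N n) (A i)) \<longlonglongrightarrow> m (A i)" by (rule lim[OF Ai])
        have "(\<Sum>i<k. measure (N n) (A i)) \<le> measure (N n) (\<Union>i. A i)" for n
        proof -
          interpret Nn: prob_space "N n" by (rule N)
          have "(\<lambda>i. measure (N n) (A i)) sums measure (N n) (\<Union>i. A i)"
            using A N(2) by (intro Nn.finite_measure_UNION) auto
          then show ?thesis using sum_le_suminf[of "\<lambda>i. measure (N n) (A i)" "{..<k}"] by (simp add: sums_iff)
        qed
        then show "\<exists>M. \<forall>n\<ge>M. (\<Sum>i<k. measure (N n) (A i)) \<le> measure (N n) (\<Union>i. A i)" by blast
      qed
      \<comment> \<open>This is the direction that uses the uniform tails; the opposite inequality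
        needs only finitely many sets at a time.\<close>
      have lower: "\<exists>k. m (\<Union>i. A i) \<le> (\<Sum>i<k. m (A i)) + \<epsilon>" if e: "\<epsilon> > 0" for \<epsilon>
      proof -
        obtain k where k: "\<forall>n. \<bar>measure (N n) (\<Union>i. A i) - (\<Sum>i<k. measure (N n) (A i))\<bar> \<le> \<epsilon>"
          using tail[OF A(2,1) e] by blast
        have "m (\<Union>i. A i) \<le> (\<Sum>i<k. m (A i)) + \<epsilon>"
        proof (rule LIMSEQ_le[OF lim[OF A(3)]])
          show "(\<lambda>n. (\<Sum>i<k. measure (N n) (A i)) + \<epsilon>) \<longlonglongrightarrow> (\<Sum>i<k. m (A i)) + \<epsilon>"
            by (intro tendsto_add tendsto_sum tendsto_const lim[OF Ai])
          show "\<exists>M. \<forall>n\<ge>M. measure (N n) (\<Union>i. A i) \<le> (\<Sum>i<k. measure (N n) (A i)) + \<epsilon>"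
          proof (intro exI allI impI)
            fix n :: nat assume "0 \<le> n"
            show "measure (N n) (\<Union>i. A i) \<le> (\<Sum>i<k. measure (N n) (A i)) + \<epsilon>"
              using k[rule_format, of n] by linarith
          qed
        qed
        then show ?thesis ..
      qed
      have "(\<lambda>i. m (A i)) sums m (\<Union>i. A i)"
        unfolding sums_def
      proof (rule LIMSEQ_I)
        fix \<epsilon> :: real assume e: "0 < \<epsilon>"
        then obtain k where k: "m (\<Union>i. A i) \<le> (\<Sum>i<k. m (A i)) + \<epsilon> / 2" using lower[of "\<epsilon> / 2"] by auto
        have "norm ((\<Sum>i<n. m (A i)) - m (\<Union>i. A i)) < \<epsilon>" if "k \<le> n" for n
        proof -
          have "(\<Sum>i<k. m (A i)) \<le> (\<Sum>i<n. m (A i))" using that m0[OF Ai] by (intro sum_mono2) auto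
          then show ?thesis using k upper[of n] e by (simp add: abs_less_iff)
        qed
        then show "\<exists>no. \<forall>n\<ge>no. norm ((\<Sum>i<n. m (A i)) - m (\<Union>i. A i)) < \<epsilon>" by blast
      qed
      then show "(\<Sum>i. ennreal (m (A i))) = ennreal (m (\<Union>i. A i))"
        using m0[OF Ai] by (intro suminf_ennreal_eq)
    qed
  qed (rule that)
  have mm: "measure \<mu> A = m A" if "A \<in> sets S" for A
    using em[OF that] m0[OF that] by (simp add: measure_def)
  have "prob_space \<mu>"
  proof (rule prob_spaceI)
    have "measure (N n) (space S) = 1" for n using prob_space.prob_space[OF N(1)] spN by metis
    then have "m (space S) = 1" using LIMSEQ_unique[OF lim[OF sets.top]] by simp
    then show "emeasure \<mu> (space \<mu>) = 1" using em[OF sets.top] by (simp add: sets_eq_imp_space_eq[OF sets\<mu>])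
  qed
  then show ?thesis using sets\<mu> lim mm by (intro exI[of _ \<mu>]) auto
qed

section \<open>Finite-dimensional marginals and extension to all bonds\<close>

context bounded_reference
begin

abbreviation PF :: "'e set \<Rightarrow> ('e \<Rightarrow> real) measure" where "PF F \<equiv> \<Pi>\<^sub>M e\<in>F. \<rho>"

text \<open>Upper orthants are increasing events and also a generator stable under intersection, so
  stochastic order gives information on enough events to determine marginals.\<close>

definition orthant :: "'e set \<Rightarrow> ('e \<Rightarrow> real) \<Rightarrow> ('e \<Rightarrow> real) set" where
  "orthant F a = {x \<in> space (PF F). \<forall>e\<in>F. a e < x e}"

lemma sets_PF: "sets (PF F) = sets (\<Pi>\<^sub>M e\<in>F. pos_borel)"
  by (rule sets_PiM_cong) (simp_all add: sets_\<rho>)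

lemma orthant_sets: "finite F \<Longrightarrow> orthant F a \<in> sets (PF F)"
proof -
  assume F: "finite F"
  have *: "{x \<in> space (PF F). a e < x e} \<in> sets (PF F)" if "e \<in> F" for e
    using component_measurable[OF that] by (rule borel_measurable_less[OF borel_measurable_const])
  show ?thesis unfolding orthant_def by (intro sets.sets_Collect_finite_All * F)
qed

lemma orthant_Int_stable: "Int_stable (range (orthant F))"
proof (rule Int_stableI, elim rangeE)
  fix A B a b assume "A = orthant F a" "B = orthant F b"
  then have "A \<inter> B = orthant F (\<lambda>e. max (a e) (b e))" by (auto simp: orthant_def)
  then show "A \<inter> B \<in> range (orthant F)" by simp
qed

lemma sigma_orthant:
  assumes F: "finite F"
  shows "sets (PF F) = sigma_sets (space (PF F)) (range (orthant F))"
proof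
  let ?S = "sigma (space (PF F)) (range (orthant F))"
  have sub: "range (orthant F) \<subseteq> Pow (space (PF F))" by (auto simp: orthant_def)
  have sp: "space ?S = space (PF F)" by (rule space_measure_of[OF sub])
  have st: "sets ?S = sigma_sets (space (PF F)) (range (orthant F))" by (rule sets_measure_of[OF sub])
  have "(\<lambda>x. x) \<in> measurable ?S (PF F)"
  proof (rule measurable_PiM_single')
    fix e assume e: "e \<in> F"
    have "(\<lambda>x. x e) \<in> borel_measurable ?S"
    proof (subst borel_measurable_iff_greater, intro allI)
      fix b
      \<comment> \<open>The default bound 0 imposes nothing, since all coordinates in this space are
        positive.\<close>
      have "{x \<in> space ?S. b < x e} = orthant F (\<lambda>i. if i = e then b else 0)"
        using e unfolding sp by (auto simp: orthant_def space_PiM space_\<rho>)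
      then show "{x \<in> space ?S. b < x e} \<in> sets ?S" unfolding st by (auto intro: sigma_sets.Basic)
    qed
    then have "(\<lambda>x. x e) \<in> measurable ?S pos_borel"
      unfolding pos_borel_def using e
      by (intro measurable_restrict_space2) (unfold sp, auto simp: space_PiM space_\<rho>)
    then show "(\<lambda>x. x e) \<in> measurable ?S \<rho>" by (simp add: measurable_cong_sets[OF refl sets_\<rho>])
  qed (unfold sp, auto simp: space_PiM)
  then show "sets (PF F) \<subseteq> sigma_sets (space (PF F)) (range (orthant F))"
  proof (intro subsetI)
    fix A assume A: "A \<in> sets (PF F)"
    assume "(\<lambda>x. x) \<in> measurable ?S (PF F)"
    from measurable_sets[OF this A] have "A \<inter> space (PF F) \<in> sets ?S" by (simp add: sp)
    then show "A \<in> sigma_sets (space (PF F)) (range (orthant F))"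
      using sets.sets_into_space[OF A] by (simp add: st Int_absorb2)
  qed
  show "sigma_sets (space (PF F)) (range (orthant F)) \<subseteq> sets (PF F)"
    using orthant_sets[OF F] by (intro sets.sigma_sets_subset) auto
qed

definition cyl :: "('e \<Rightarrow> real) measure \<Rightarrow> 'e set \<Rightarrow> ('e \<Rightarrow> real) set \<Rightarrow> real" where
  "cyl M F A = measure M {\<kappa> \<in> space M. restrict \<kappa> F \<in> A}"

lemma marginal_limit:
  fixes M :: "nat \<Rightarrow> (bond \<Rightarrow> real) measure"
  assumes F: "finite F"
    and M: "eventually (\<lambda>n. prob_space (M n) \<and> (\<lambda>\<kappa>. restrict \<kappa> F) \<in> measurable (M n) (PF F) \<and>
       (\<forall>A\<in>sets (PF F). cyl (M n) F A \<le> K * measure (PF F) A)) sequentially"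
    and conv: "\<And>a. convergent (\<lambda>n. cyl (M n) F (orthant F a))"
  shows "\<exists>\<mu>. prob_space \<mu> \<and> sets \<mu> = sets (PF F) \<and> (\<forall>A\<in>sets (PF F). (\<lambda>n. cyl (M n) F A) \<longlonglongrightarrow> measure \<mu> A)"
proof -
  obtain n0 where n0: "\<And>n. n0 \<le> n \<Longrightarrow> prob_space (M n) \<and> (\<lambda>\<kappa>. restrict \<kappa> F) \<in> measurable (M n) (PF F) \<and>
       (\<forall>A\<in>sets (PF F). cyl (M n) F A \<le> K * measure (PF F) A)"
    using M unfolding eventually_sequentially by blast
  define N where "N n = distr (M (n + n0)) (PF F) (\<lambda>\<kappa>. restrict \<kappa> F)" for n
  have mN: "measure (N n) A = cyl (M (n + n0)) F A" if "A \<in> sets (PF F)" for n A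
  proof -
    have "(\<lambda>\<kappa>. restrict \<kappa> F) -` A \<inter> space (M (n + n0)) = {\<kappa> \<in> space (M (n + n0)). restrict \<kappa> F \<in> A}" by auto
    then show ?thesis unfolding N_def cyl_def using n0[of "n + n0"] that by (simp add: measure_distr)
  qed
  have "\<exists>\<mu>. prob_space \<mu> \<and> sets \<mu> = sets (PF F) \<and> (\<forall>A\<in>sets (PF F). (\<lambda>n. measure (N n) A) \<longlonglongrightarrow> measure \<mu> A)"
  proof (rule setwise_limit[OF \<Pi>.P.prob_space_axioms])
    show "prob_space (N n)" for n unfolding N_def using n0[of "n + n0"] by (intro prob_space.prob_space_distr) auto
    show "sets (N n) = sets (PF F)" for n by (simp add: N_def)
    show "measure (N n) A \<le> K * measure (PF F) A" if "A \<in> sets (PF F)" for n A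
      using mN[OF that] n0[of "n + n0"] that by simp
    show "sets (PF F) = sigma_sets (space (PF F)) (range (orthant F))" by (rule sigma_orthant[OF F])
    show "range (orthant F) \<subseteq> Pow (space (PF F))" by (auto simp: orthant_def)
    show "convergent (\<lambda>n. measure (N n) A)" if A: "A \<in> range (orthant F)" for A
    proof -
      obtain a where a: "A = orthant F a" using A by blast
      show ?thesis using conv[of a] unfolding a mN[OF orthant_sets[OF F]]
        by (rule convergent_ignore_initial_segment[THEN iffD2])
    qed
  qed (rule orthant_Int_stable)
  then obtain \<mu> where \<mu>: "prob_space \<mu>" "sets \<mu> = sets (PF F)" "\<forall>A\<in>sets (PF F). (\<lambda>n. measure (N n) A) \<longlonglongrightarrow> measure \<mu> A"
    by blast
  have "(\<lambda>n. cyl (M n) F A) \<longlonglongrightarrow> measure \<mu> A" if "A \<in> sets (PF F)" for A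
    using \<mu>(3)[rule_format, OF that] unfolding mN[OF that] by (rule LIMSEQ_offset)
  then show ?thesis using \<mu>(1,2) by blast
qed

text \<open>The limits of the marginals form a consistent family. Kolmogorov's extension is carried
  out on the Polish space of reals, and its result is moved back to positive conductances.\<close>

lemma local_limit_exists:
  fixes M :: "nat \<Rightarrow> (bond \<Rightarrow> real) measure"
  assumes M: "\<And>F. finite F \<Longrightarrow> F \<subseteq> lattice_bonds \<Longrightarrow> \<exists>K. eventually (\<lambda>n. prob_space (M n) \<and>
       (\<lambda>\<kappa>. restrict \<kappa> F) \<in> measurable (M n) (PF F) \<and>
       (\<forall>A\<in>sets (PF F). cyl (M n) F A \<le> K * measure (PF F) A)) sequentially"
    and conv: "\<And>F a. finite F \<Longrightarrow> F \<subseteq> lattice_bonds \<Longrightarrow> convergent (\<lambda>n. cyl (M n) F (orthant F a))"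
  shows "\<exists>\<mu>. local_limit M \<mu>"
proof -
  have "\<forall>F. \<exists>\<mu>. finite F \<and> F \<subseteq> lattice_bonds \<longrightarrow> prob_space \<mu> \<and> sets \<mu> = sets (PF F) \<and>
      (\<forall>A\<in>sets (PF F). (\<lambda>n. cyl (M n) F A) \<longlonglongrightarrow> measure \<mu> A)"
  proof
    fix F :: "bond set"
    show "\<exists>\<mu>. finite F \<and> F \<subseteq> lattice_bonds \<longrightarrow> prob_space \<mu> \<and> sets \<mu> = sets (PF F) \<and>
      (\<forall>A\<in>sets (PF F). (\<lambda>n. cyl (M n) F A) \<longlonglongrightarrow> measure \<mu> A)"
    proof (cases "finite F \<and> F \<subseteq> lattice_bonds")
      case True
      then obtain K where "eventually (\<lambda>n. prob_space (M n) \<and> (\<lambda>\<kappa>. restrict \<kappa> F) \<in> measurable (M n) (PF F) \<and>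
         (\<forall>A\<in>sets (PF F). cyl (M n) F A \<le> K * measure (PF F) A)) sequentially" using M by blast
      from marginal_limit[OF _ this conv] True show ?thesis by blast
    qed blast
  qed
  then obtain m where m0: "\<forall>F. finite F \<and> F \<subseteq> lattice_bonds \<longrightarrow> prob_space (m F) \<and> sets (m F) = sets (PF F) \<and>
      (\<forall>A\<in>sets (PF F). (\<lambda>n. cyl (M n) F A) \<longlonglongrightarrow> measure (m F) A)" by (rule choice[THEN exE])
  have m: "prob_space (m F)" "sets (m F) = sets (PF F)"
    and ml: "\<And>A. A \<in> sets (PF F) \<Longrightarrow> (\<lambda>n. cyl (M n) F A) \<longlonglongrightarrow> measure (m F) A"
    if "finite F" "F \<subseteq> lattice_bonds" for F using m0 that by blast+
  have spm: "space (m F) = space (PF F)" if "finite F" "F \<subseteq> lattice_bonds" for F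
    using m(2)[OF that] by (rule sets_eq_imp_space_eq)
  have cons: "m J = distr (m H) (PF J) (\<lambda>\<kappa>. restrict \<kappa> J)" if JH: "J \<subseteq> H" "finite H" "H \<subseteq> lattice_bonds" for J H
  proof -
    have J: "finite J" "J \<subseteq> lattice_bonds" using JH finite_subset by auto
    have r: "(\<lambda>\<kappa>. restrict \<kappa> J) \<in> measurable (m H) (PF J)"
      using measurable_restrict_subset[OF JH(1)] by (simp add: measurable_cong_sets[OF m(2)[OF JH(2,3)] refl])
    interpret mJ: prob_space "m J" by (rule m(1)[OF J])
    interpret mH: prob_space "m H" by (rule m(1)[OF JH(2,3)])
    interpret dH: prob_space "distr (m H) (PF J) (\<lambda>\<kappa>. restrict \<kappa> J)" by (rule mH.prob_space_distr[OF r])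
    show ?thesis
    proof (rule measure_eqI)
      show "sets (m J) = sets (distr (m H) (PF J) (\<lambda>\<kappa>. restrict \<kappa> J))" using m(2)[OF J] by simp
      fix A assume "A \<in> sets (m J)"
      then have A: "A \<in> sets (PF J)" using m(2)[OF J] by simp
      let ?A = "(\<lambda>\<kappa>. restrict \<kappa> J) -` A \<inter> space (PF H)"
      have A': "?A \<in> sets (PF H)" by (rule measurable_sets[OF measurable_restrict_subset[OF JH(1)] A])
      obtain K where K: "eventually (\<lambda>n. prob_space (M n) \<and> (\<lambda>\<kappa>. restrict \<kappa> H) \<in> measurable (M n) (PF H) \<and>
         (\<forall>A\<in>sets (PF H). cyl (M n) H A \<le> K * measure (PF H) A)) sequentially" using M[OF JH(2,3)] by blast
      have "eventually (\<lambda>n. cyl (M n) J A = cyl (M n) H ?A) sequentially"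
        using K
      proof (rule eventually_mono)
        fix n assume "prob_space (M n) \<and> (\<lambda>\<kappa>. restrict \<kappa> H) \<in> measurable (M n) (PF H) \<and>
         (\<forall>A\<in>sets (PF H). cyl (M n) H A \<le> K * measure (PF H) A)"
        then have s: "restrict \<kappa> H \<in> space (PF H)" if "\<kappa> \<in> space (M n)" for \<kappa>
          using that by (auto dest: measurable_space)
        have rr: "restrict (restrict \<kappa> H) J = restrict \<kappa> J" for \<kappa> :: "bond \<Rightarrow> real"
          using JH(1) by (simp add: Int_absorb1)
        show "cyl (M n) J A = cyl (M n) H ?A"
          unfolding cyl_def by (rule arg_cong[where f = "measure (M n)"]) (use s rr in auto)
      qed
      then have "(\<lambda>n. cyl (M n) J A) \<longlonglongrightarrow> measure (m H) ?A"
        using ml[OF JH(2,3) A'] by (simp add: tendsto_cong)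
      then have "measure (m J) A = measure (m H) ?A" using LIMSEQ_unique[OF ml[OF J A]] by blast
      also have "\<dots> = measure (distr (m H) (PF J) (\<lambda>\<kappa>. restrict \<kappa> J)) A"
        using measure_distr[OF r A] spm[OF JH(2,3)] by simp
      finally show "emeasure (m J) A = emeasure (distr (m H) (PF J) (\<lambda>\<kappa>. restrict \<kappa> J)) A"
        by (simp add: mJ.emeasure_eq_measure dH.emeasure_eq_measure)
    qed
  qed
  let ?B = "\<lambda>J. \<Pi>\<^sub>M e\<in>J. (borel :: real measure)"
  define P' where "P' J = distr (m J) (?B J) (\<lambda>\<kappa>. \<kappa>)" for J
  have idm: "(\<lambda>\<kappa>. \<kappa>) \<in> measurable (PF J) (?B J)" for J :: "bond set"
    by (rule measurable_PiM_single') (auto intro: component_measurable simp: space_PiM)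
  have idm': "(\<lambda>\<kappa>. \<kappa>) \<in> measurable (m J) (?B J)" if "finite J" "J \<subseteq> lattice_bonds" for J
    using idm by (simp add: measurable_cong_sets[OF m(2)[OF that] refl])
  interpret pol: polish_projective lattice_bonds P'
  proof (intro polish_projective.intro projective_family.intro)
    fix J H :: "bond set" assume JH: "J \<subseteq> H" "finite H" "H \<subseteq> lattice_bonds"
    have J: "finite J" "J \<subseteq> lattice_bonds" using JH finite_subset by auto
    have r: "(\<lambda>\<kappa>. restrict \<kappa> J) \<in> measurable (m H) (PF J)"
      using measurable_restrict_subset[OF JH(1)] by (simp add: measurable_cong_sets[OF m(2)[OF JH(2,3)] refl])
    have "P' J = distr (m H) (?B J) (\<lambda>\<kappa>. restrict \<kappa> J)"
      unfolding P'_def by (subst cons[OF JH]) (simp add: distr_distr[OF idm r] comp_def)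
    also have "\<dots> = distr (P' H) (?B J) (\<lambda>\<kappa>. restrict \<kappa> J)"
      unfolding P'_def
      by (subst distr_distr[OF measurable_restrict_subset[OF JH(1)] idm'[OF JH(2,3)]]) (simp add: comp_def)
    finally show "P' J = distr (P' H) (?B J) (\<lambda>\<kappa>. restrict \<kappa> J)" .
  next
    fix J :: "bond set" assume J: "finite J" "J \<subseteq> lattice_bonds"
    show "prob_space (P' J)" unfolding P'_def by (rule prob_space.prob_space_distr[OF m(1)[OF J] idm'[OF J]])
  qed
  \<comment> \<open>A measurable retraction onto positive configurations. The value 1 is an
    arbitrary positive default; on the space carrying the marginals the map is the identity.\<close>
  define g where "g J \<kappa> = (\<lambda>e\<in>J. if 0 < \<kappa> e then \<kappa> e else (1::real))" for J :: "bond set" and \<kappa>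
  have gm: "g J \<in> measurable (?B J) (PF J)" for J
    unfolding g_def
  proof (rule measurable_restrict)
    fix e assume "e \<in> J"
    then have [measurable]: "(\<lambda>\<kappa>. \<kappa> e) \<in> borel_measurable (?B J)" by (rule measurable_component_singleton)
    have "(\<lambda>\<kappa>. if 0 < \<kappa> e then \<kappa> e else 1) \<in> borel_measurable (?B J)" by measurable
    then have "(\<lambda>\<kappa>. if 0 < \<kappa> e then \<kappa> e else 1) \<in> measurable (?B J) pos_borel"
      unfolding pos_borel_def by (intro measurable_restrict_space2) auto
    then show "(\<lambda>\<kappa>. if 0 < \<kappa> e then \<kappa> e else 1) \<in> measurable (?B J) \<rho>"
      by (simp add: measurable_cong_sets[OF refl sets_\<rho>])
  qed
  have g_id: "g J \<kappa> = \<kappa>" if "\<kappa> \<in> space (PF J)" for J \<kappa>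
    using that by (auto simp: g_def space_PiM space_\<rho> PiE_iff extensional_def fun_eq_iff)
  define \<mu> where "\<mu> = distr pol.lim (PF lattice_bonds) (g lattice_bonds)"
  have gl: "g lattice_bonds \<in> measurable pol.lim (PF lattice_bonds)"
    using gm by (simp add: measurable_cong_sets[OF pol.sets_lim refl])
  have splim: "space pol.lim = space (?B lattice_bonds)" by (rule sets_eq_imp_space_eq[OF pol.sets_lim])
  have val: "cyl \<mu> F A = measure (m F) A" if F: "finite F" "F \<subseteq> lattice_bonds" and A: "A \<in> sets (PF F)" for F A
  proof -
    have C: "{\<kappa> \<in> space \<mu>. restrict \<kappa> F \<in> A} \<in> sets (PF lattice_bonds)"
      using measurable_sets[OF measurable_restrict_subset[OF F(2)] A] unfolding \<mu>_def space_distr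
      by (simp add: vimage_def Int_def conj_commute)
    have "cyl \<mu> F A = measure pol.lim (g lattice_bonds -` {\<kappa> \<in> space \<mu>. restrict \<kappa> F \<in> A} \<inter> space pol.lim)"
      unfolding cyl_def using C by (subst \<mu>_def) (rule measure_distr[OF gl])
    also have "g lattice_bonds -` {\<kappa> \<in> space \<mu>. restrict \<kappa> F \<in> A} \<inter> space pol.lim =
      prod_emb lattice_bonds (\<lambda>_. borel) F (g F -` A \<inter> space (?B F))"
    proof -
      have "restrict (g lattice_bonds \<kappa>) F = g F (restrict \<kappa> F)" for \<kappa>
        using F(2) by (auto simp: g_def fun_eq_iff)
      moreover have "g lattice_bonds \<kappa> \<in> space \<mu>" if "\<kappa> \<in> space (?B lattice_bonds)" for \<kappa>
        using measurable_space[OF gm that] by (simp add: \<mu>_def)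
      moreover have "restrict \<kappa> F \<in> space (?B F)" for \<kappa> by (simp add: space_PiM)
      ultimately show ?thesis by (auto simp: prod_emb_def splim space_PiM)
    qed
    also have "measure pol.lim \<dots> = measure (P' F) (g F -` A \<inter> space (?B F))"
      by (rule pol.measure_lim_emb[OF F(2,1) measurable_sets[OF gm A]])
    also have "\<dots> = measure (m F) ((\<lambda>\<kappa>. \<kappa>) -` (g F -` A \<inter> space (?B F)) \<inter> space (m F))"
      unfolding P'_def by (rule measure_distr[OF idm'[OF F] measurable_sets[OF gm A]])
    also have "(\<lambda>\<kappa>. \<kappa>) -` (g F -` A \<inter> space (?B F)) \<inter> space (m F) = A"
    proof -
      have "space (PF F) \<subseteq> space (?B F)" by (auto simp: space_PiM)
      then show ?thesis using g_id sets.sets_into_space[OF A] by (auto simp: spm[OF F])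
    qed
    finally show ?thesis .
  qed
  have "local_limit M \<mu>"
    unfolding local_limit_def
  proof (intro conjI allI impI)
    show "prob_space \<mu>" unfolding \<mu>_def by (rule pol.P.prob_space_distr[OF gl])
    show "sets \<mu> = sets (\<Pi>\<^sub>M e\<in>lattice_bonds. pos_borel)" by (simp add: \<mu>_def sets_PF)
    fix F A assume F: "finite F" "F \<subseteq> lattice_bonds" and A: "A \<in> sets (\<Pi>\<^sub>M e\<in>F. pos_borel)"
    then have A': "A \<in> sets (PF F)" by (simp add: sets_PF)
    show "(\<lambda>n. measure (M n) {\<kappa> \<in> space (M n). restrict \<kappa> F \<in> A}) \<longlonglongrightarrow> measure \<mu> {\<kappa> \<in> space \<mu>. restrict \<kappa> F \<in> A}"
      using ml[OF F A'] val[OF F A'] unfolding cyl_def by simp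
  qed
  then show ?thesis by blast
qed

end

text \<open>Local convergence fixes the probabilities of all finite-dimensional rectangles, and
  these determine the measure. This is what gives meaning to the definite descriptions of the
  infinite volume measures.\<close>

lemma local_limit_unique:
  assumes "local_limit M \<mu>" "local_limit M \<mu>'" shows "\<mu> = \<mu>'"
proof (rule measure_eqI_PiM_infinite[where I = lattice_bonds and M = "\<lambda>_. pos_borel"])
  interpret \<mu>: prob_space \<mu> using assms(1) unfolding local_limit_def by blast
  interpret \<mu>': prob_space \<mu>' using assms(2) unfolding local_limit_def by blast
  show s: "sets \<mu> = sets (\<Pi>\<^sub>M e\<in>lattice_bonds. pos_borel)" "sets \<mu>' = sets (\<Pi>\<^sub>M e\<in>lattice_bonds. pos_borel)"
    using assms unfolding local_limit_def by blast+
  show "finite_measure \<mu>" by (rule \<mu>.finite_measure_axioms)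
  fix A J assume J: "finite J" "J \<subseteq> lattice_bonds" and A: "\<And>i. i \<in> J \<Longrightarrow> A i \<in> sets pos_borel"
  have R: "Pi\<^sub>E J A \<in> sets (\<Pi>\<^sub>M e\<in>J. pos_borel)" by (rule sets_PiM_I_finite[OF J(1) A])
  have e: "prod_emb lattice_bonds (\<lambda>_. pos_borel) J (Pi\<^sub>E J A) = {\<kappa> \<in> space \<nu>. restrict \<kappa> J \<in> Pi\<^sub>E J A}"
    if "sets \<nu> = sets (\<Pi>\<^sub>M e\<in>lattice_bonds. pos_borel)" for \<nu>
    unfolding prod_emb_def sets_eq_imp_space_eq[OF that] space_PiM by blast
  have "measure \<mu> {\<kappa> \<in> space \<mu>. restrict \<kappa> J \<in> Pi\<^sub>E J A} = measure \<mu>' {\<kappa> \<in> space \<mu>'. restrict \<kappa> J \<in> Pi\<^sub>E J A}"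
  proof (rule LIMSEQ_unique)
    show "(\<lambda>n. measure (M n) {\<kappa> \<in> space (M n). restrict \<kappa> J \<in> Pi\<^sub>E J A})
        \<longlonglongrightarrow> measure \<mu> {\<kappa> \<in> space \<mu>. restrict \<kappa> J \<in> Pi\<^sub>E J A}"
      using assms(1) J R unfolding local_limit_def by blast
    show "(\<lambda>n. measure (M n) {\<kappa> \<in> space (M n). restrict \<kappa> J \<in> Pi\<^sub>E J A})
        \<longlonglongrightarrow> measure \<mu>' {\<kappa> \<in> space \<mu>'. restrict \<kappa> J \<in> Pi\<^sub>E J A}"
      using assms(2) J R unfolding local_limit_def by blast
  qed
  then have "measure \<mu> (prod_emb lattice_bonds (\<lambda>_. pos_borel) J (Pi\<^sub>E J A)) =
      measure \<mu>' (prod_emb lattice_bonds (\<lambda>_. pos_borel) J (Pi\<^sub>E J A))"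
    by (subst e[OF s(1)], subst e[OF s(2)])
  then show "emeasure \<mu> (prod_emb lattice_bonds (\<lambda>_. pos_borel) J (Pi\<^sub>E J A)) =
      emeasure \<mu>' (prod_emb lattice_bonds (\<lambda>_. pos_borel) J (Pi\<^sub>E J A))"
    by (simp only: \<mu>.emeasure_eq_measure \<mu>'.emeasure_eq_measure)
qed


section \<open>Coincidence of the limits\<close>

text \<open>On nonnegative arguments the derivative of \<open>M / t * exp (t * x)\<close> is at
  least M, so adding or subtracting \<phi> leaves a nondecreasing function.\<close>

lemma exp_dominates:
  fixes \<phi> \<phi>' :: "real \<Rightarrow> real"
  assumes der: "\<And>x. (\<phi> has_real_derivative \<phi>' x) (at x)" and t: "t > 0"
    and M: "\<And>x. 0 \<le> x \<Longrightarrow> x \<le> b \<Longrightarrow> \<bar>\<phi>' x\<bar> \<le> M" and xy: "0 \<le> x" "x \<le> y" "y \<le> b"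
  shows "\<bar>\<phi> y - \<phi> x\<bar> \<le> M / t * (exp (t * y) - exp (t * x))"
proof -
  have mono: "M / t * exp (t * x) + s * \<phi> x \<le> M / t * exp (t * y) + s * \<phi> y" if "\<bar>s\<bar> = 1" for s
  proof (rule DERIV_nonneg_imp_nondecreasing[OF xy(2)])
    fix z assume z: "x \<le> z" "z \<le> y"
    have d: "((\<lambda>z. M / t * exp (t * z) + s * \<phi> z) has_real_derivative (M / t * (exp (t * z) * t) + s * \<phi>' z)) (at z)"
      by (auto intro!: derivative_eq_intros der)
    have "\<bar>s * \<phi>' z\<bar> \<le> M" using M[of z] z xy that by (simp add: abs_mult)
    moreover have "M * 1 \<le> M * exp (t * z)"
      using M[of z] z xy t by (intro mult_left_mono) auto
    ultimately have "0 \<le> M / t * (exp (t * z) * t) + s * \<phi>' z" using t by (simp add: abs_le_iff)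
    with d show "\<exists>y. ((\<lambda>z. M / t * exp (t * z) + s * \<phi> z) has_real_derivative y) (at z) \<and> 0 \<le> y" by blast
  qed
  from mono[of 1] mono[of "-1"] show ?thesis by (simp add: abs_le_iff right_diff_distrib)
qed

context rc_graph
begin

lemma component_bound: "e \<in> edges G \<Longrightarrow> \<kappa> \<in> cube (edges G) \<Longrightarrow> 0 \<le> \<kappa> e \<and> \<kappa> e \<le> lam"
  using cube_pos[of \<kappa> "edges G"] by (auto simp: cube_def less_imp_le)

lemma integrable_component:
  fixes \<phi> :: "real \<Rightarrow> real"
  assumes e: "e \<in> edges G" and \<phi>: "\<phi> \<in> borel_measurable borel" and K: "\<And>x. 0 \<le> x \<Longrightarrow> x \<le> lam \<Longrightarrow> \<bar>\<phi> x\<bar> \<le> K"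
  shows "integrable (CM \<xi>) (\<lambda>\<kappa>. \<phi> (\<kappa> e))" "\<bar>\<integral>\<kappa>. \<phi> (\<kappa> e) \<partial>CM \<xi>\<bar> \<le> K"
proof -
  interpret prob_space "CM \<xi>" by (rule prob_CM)
  have m: "(\<lambda>\<kappa>. \<phi> (\<kappa> e)) \<in> borel_measurable (CM \<xi>)"
    using measurable_compose[OF component_measurable[OF e] \<phi>] by (simp add: measurable_cong_sets[OF sets_CM refl])
  have ae: "AE \<kappa> in CM \<xi>. \<bar>\<phi> (\<kappa> e)\<bar> \<le> K"
    using AE_CM_cube by (rule eventually_mono) (use component_bound[OF e] K in blast)
  show int: "integrable (CM \<xi>) (\<lambda>\<kappa>. \<phi> (\<kappa> e))"
    by (rule integrable_const_bound[OF _ m, of K]) (use ae in simp)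
  have "\<bar>\<integral>\<kappa>. \<phi> (\<kappa> e) \<partial>CM \<xi>\<bar> \<le> (\<integral>\<kappa>. \<bar>\<phi> (\<kappa> e)\<bar> \<partial>CM \<xi>)" by (rule integral_abs_bound)
  also have "\<dots> \<le> (\<integral>\<kappa>. K \<partial>CM \<xi>)" using ae int by (intro integral_mono_AE integrable_abs) simp_all
  finally show "\<bar>\<integral>\<kappa>. \<phi> (\<kappa> e) \<partial>CM \<xi>\<bar> \<le> K" by (simp add: prob_space)
qed

lemma restrict_measurable_CM: "F \<subseteq> edges G \<Longrightarrow> (\<lambda>\<kappa>. restrict \<kappa> F) \<in> measurable (CM \<xi>) (PF F)"
  using measurable_restrict_subset[of F "edges G" "\<lambda>_. \<rho>"] by (simp add: measurable_cong_sets[OF sets_CM refl])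

lemma cyl_CM:
  assumes F: "F \<subseteq> edges G" and A: "A \<in> sets (PF F)"
  shows "cyl (CM \<xi>) F A = (\<integral>\<kappa>. indicator A (restrict \<kappa> F) \<partial>CM \<xi>)"
    and "integrable (CM \<xi>) (\<lambda>\<kappa>. indicator A (restrict \<kappa> F) :: real)"
proof -
  interpret prob_space "CM \<xi>" by (rule prob_CM)
  let ?C = "{\<kappa> \<in> space (CM \<xi>). restrict \<kappa> F \<in> A}"
  have C: "?C \<in> sets (CM \<xi>)"
    using measurable_sets[OF restrict_measurable_CM[OF F] A] by (simp add: vimage_def Int_def conj_commute)
  have "(\<integral>\<kappa>. indicator A (restrict \<kappa> F) \<partial>CM \<xi>) = (\<integral>\<kappa>. indicator ?C \<kappa> \<partial>CM \<xi> :: real)"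
    by (rule Bochner_Integration.integral_cong) (auto simp: indicator_def)
  also have "\<dots> = measure (CM \<xi>) ?C" using C by simp
  finally show "cyl (CM \<xi>) F A = (\<integral>\<kappa>. indicator A (restrict \<kappa> F) \<partial>CM \<xi>)" by (simp add: cyl_def)
  show "integrable (CM \<xi>) (\<lambda>\<kappa>. indicator A (restrict \<kappa> F) :: real)"
  proof (rule integrable_const_bound[of _ 1])
    show "(\<lambda>\<kappa>. indicator A (restrict \<kappa> F) :: real) \<in> borel_measurable (CM \<xi>)"
      using A by (intro measurable_compose[OF restrict_measurable_CM[OF F]]) simp
  qed (simp add: indicator_def)
qed

lemma cyl_bound:
  assumes "F \<subseteq> edges G"
  shows "prob_space (CM \<xi>) \<and> (\<lambda>\<kappa>. restrict \<kappa> F) \<in> measurable (CM \<xi>) (PF F) \<and>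
    (\<forall>A\<in>sets (PF F). cyl (CM \<xi>) F A \<le> change_const F \<xi> * measure (PF F) A)"
  using prob_CM restrict_measurable_CM[OF assms] marginal_density_bound[OF assms] unfolding cyl_def by blast

lemma mean_tilt:
  fixes u :: real
  assumes e: "e \<in> edges G"
  shows "(\<integral>\<kappa>. \<kappa> e \<partial>CM (\<xi>(e := \<xi> e + u))) = (\<integral>\<kappa>. \<kappa> e * exp (u * \<kappa> e) \<partial>CM \<xi>) / mgf \<rho> G \<xi> e u"
  by (rule integral_tilt[OF e component_measurable[OF e]])

lemma mgf_lower:
  assumes e: "e \<in> edges G" shows "exp (- (\<bar>u\<bar> * lam)) \<le> mgf \<rho> G \<xi> e u"
proof -
  interpret prob_space "CM \<xi>" by (rule prob_CM)
  have lo: "- (\<bar>u\<bar> * lam) \<le> u * x" if "0 \<le> x" "x \<le> lam" for x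
  proof -
    have "\<bar>u * x\<bar> \<le> \<bar>u\<bar> * lam" unfolding abs_mult using that by (intro mult_left_mono) auto
    then show ?thesis by linarith
  qed
  have hi: "\<bar>exp (u * x)\<bar> \<le> exp (\<bar>u\<bar> * lam)" if "0 \<le> x" "x \<le> lam" for x
  proof -
    have "\<bar>u * x\<bar> \<le> \<bar>u\<bar> * lam" unfolding abs_mult using that by (intro mult_left_mono) auto
    then have "u * x \<le> \<bar>u\<bar> * lam" by linarith
    then show ?thesis by simp
  qed
  have int: "integrable (CM \<xi>) (\<lambda>\<kappa>. exp (u * \<kappa> e))"
    by (rule integrable_component(1)[OF e, where \<phi> = "\<lambda>x. exp (u * x)" and K = "exp (\<bar>u\<bar> * lam)"]) (simp, rule hi)
  have "(\<integral>\<kappa>. exp (- (\<bar>u\<bar> * lam)) \<partial>CM \<xi>) \<le> mgf \<rho> G \<xi> e u"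
    unfolding mgf_def
  proof (rule integral_mono_AE[OF _ int])
    show "AE \<kappa> in CM \<xi>. exp (- (\<bar>u\<bar> * lam)) \<le> exp (u * \<kappa> e)"
      using AE_CM_cube
    proof (rule eventually_mono)
      fix \<kappa> :: "'e \<Rightarrow> real" assume "\<kappa> \<in> cube (edges G)"
      then have "0 \<le> \<kappa> e" "\<kappa> e \<le> lam" using component_bound[OF e] by blast+
      then show "exp (- (\<bar>u\<bar> * lam)) \<le> exp (u * \<kappa> e)" unfolding exp_le_cancel_iff by (rule lo)
    qed
  qed simp
  then show ?thesis by (simp add: prob_space)
qed

end

section \<open>Gaps between the wired and the free expectations\<close>

context rc_collapse
begin

text \<open>By \<open>C\<close> both C exp (t x) + q and C exp (t x) - q are increasing, so
  stochastic order applied to each bounds the gap of q by that of one exponential moment.\<close>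

lemma lipschitz_gap:
  fixes q :: "real \<Rightarrow> real"
  assumes e: "e \<in> E" and q: "q \<in> borel_measurable borel" and K: "\<And>x. 0 \<le> x \<Longrightarrow> x \<le> lam \<Longrightarrow> \<bar>q x\<bar> \<le> K"
    and t: "t \<ge> 0"
    and C: "\<And>x y. 0 \<le> x \<Longrightarrow> x \<le> y \<Longrightarrow> y \<le> lam \<Longrightarrow> \<bar>q y - q x\<bar> \<le> C * (exp (t * y) - exp (t * x))"
  shows "\<bar>(\<integral>\<kappa>. q (\<kappa> e) \<partial>W2.CM \<xi>) - (\<integral>\<kappa>. q (\<kappa> e) \<partial>W1.CM \<xi>)\<bar> \<le> C * (mgf \<rho> G2 \<xi> e t - mgf \<rho> G1 \<xi> e t)"
proof -
  have ee: "e \<in> edges G1" "e \<in> edges G2" using e E_sub by auto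
  have hi: "\<bar>exp (t * x)\<bar> \<le> exp (t * lam)" if "0 \<le> x" "x \<le> lam" for x using that t by (simp add: mult_left_mono)
  have i: "integrable (W1.CM \<xi>) (\<lambda>\<kappa>. q (\<kappa> e))" "integrable (W2.CM \<xi>) (\<lambda>\<kappa>. q (\<kappa> e))"
    by (rule W1.integrable_component(1)[OF ee(1) q K] W2.integrable_component(1)[OF ee(2) q K]; assumption)+
  have x: "integrable (W1.CM \<xi>) (\<lambda>\<kappa>. exp (t * \<kappa> e))" "integrable (W2.CM \<xi>) (\<lambda>\<kappa>. exp (t * \<kappa> e))"
    by (rule W1.integrable_component(1)[OF ee(1) _ hi] W2.integrable_component(1)[OF ee(2) _ hi]; simp)+
  have m: "C * mgf \<rho> G1 \<xi> e t + s * (\<integral>\<kappa>. q (\<kappa> e) \<partial>W1.CM \<xi>) \<le> C * mgf \<rho> G2 \<xi> e t + s * (\<integral>\<kappa>. q (\<kappa> e) \<partial>W2.CM \<xi>)"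
    if s: "\<bar>s\<bar> = 1" for s
  proof -
    have "incr E (\<lambda>x. C * exp (t * x e) + s * q (x e))"
      unfolding incr_def
    proof (intro conjI ballI impI)
      show "(\<lambda>x. C * exp (t * x e) + s * q (x e)) \<in> borel_measurable (\<Pi>\<^sub>M e\<in>E. \<rho>)"
        using measurable_compose[OF component_measurable[OF e] q] component_measurable[OF e] by measurable
      fix x y assume xy: "x \<in> cube E \<inter> space (\<Pi>\<^sub>M e\<in>E. \<rho>)" "y \<in> cube E \<inter> space (\<Pi>\<^sub>M e\<in>E. \<rho>)" "\<forall>e\<in>E. x e \<le> y e"
      have "0 \<le> x e" "x e \<le> y e" "y e \<le> lam"
        using xy e cube_pos[of x E] by (auto simp: cube_def less_imp_le)
      from C[OF this] have "\<bar>s * (q (y e) - q (x e))\<bar> \<le> C * (exp (t * y e) - exp (t * x e))"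
        using s by (simp add: abs_mult)
      then show "C * exp (t * x e) + s * q (x e) \<le> C * exp (t * y e) + s * q (y e)"
        by (simp add: abs_le_iff algebra_simps)
    qed
    from expectation_mono[OF this, of \<xi>] show ?thesis
      using i x e by (simp add: mgf_def)
  qed
  from m[of 1] m[of "-1"] show ?thesis by (simp add: abs_le_iff right_diff_distrib)
qed

text \<open>The response controls exponential moments at the disorder with \<open>\<xi> e\<close>
  reset to A, while means are wanted at the actual value; \<open>u\<close> is the difference. The
  mean at the shifted disorder is a quotient of two expectations at \<open>\<xi>\<close>, each of
  them covered by \<open>lipschitz_gap\<close>.\<close>

lemma mean_gap:
  assumes e: "e \<in> E" and t: "t > 0"
  shows "\<bar>(\<integral>\<kappa>. \<kappa> e \<partial>W2.CM (\<xi>(e := \<xi> e + u))) - (\<integral>\<kappa>. \<kappa> e \<partial>W1.CM (\<xi>(e := \<xi> e + u)))\<bar>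
    \<le> exp (\<bar>u\<bar> * lam) ^ 2 * ((1 + lam * \<bar>u\<bar>) / t) * (mgf \<rho> G2 \<xi> e t - mgf \<rho> G1 \<xi> e t)
      + exp (\<bar>u\<bar> * lam) ^ 4 * (lam * (\<bar>u\<bar> / t)) * (mgf \<rho> G2 \<xi> e t - mgf \<rho> G1 \<xi> e t)"
proof -
  have ee: "e \<in> edges G1" "e \<in> edges G2" using e E_sub by auto
  define X where "X = exp (\<bar>u\<bar> * lam)"
  define \<Delta> where "\<Delta> = mgf \<rho> G2 \<xi> e t - mgf \<rho> G1 \<xi> e t"
  have X: "X \<ge> 1" using lam_pos by (simp add: X_def)
  have hi: "exp (u * x) \<le> X" if "0 \<le> x" "x \<le> lam" for x
  proof -
    have "\<bar>u * x\<bar> \<le> \<bar>u\<bar> * lam" unfolding abs_mult using that by (intro mult_left_mono) auto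
    then have "u * x \<le> \<bar>u\<bar> * lam" by linarith
    then show ?thesis by (simp add: X_def)
  qed
  have K1: "\<bar>exp (u * x)\<bar> \<le> X" if "0 \<le> x" "x \<le> lam" for x using hi[OF that] by simp
  have K2: "\<bar>x * exp (u * x)\<bar> \<le> lam * X" if "0 \<le> x" "x \<le> lam" for x
    unfolding abs_mult using hi[OF that] that by (intro mult_mono) auto
  have L1: "\<bar>exp (u * y) - exp (u * x)\<bar> \<le> (\<bar>u\<bar> * X) / t * (exp (t * y) - exp (t * x))"
    if "0 \<le> x" "x \<le> y" "y \<le> lam" for x y
  proof (rule exp_dominates[where \<phi>' = "\<lambda>x. exp (u * x) * u", OF _ t _ that])
    show "((\<lambda>x. exp (u * x)) has_real_derivative exp (u * x) * u) (at x)" for x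
      by (auto intro!: derivative_eq_intros)
    show "\<bar>exp (u * x) * u\<bar> \<le> \<bar>u\<bar> * X" if "0 \<le> x" "x \<le> lam" for x
      using mult_right_mono[OF hi[OF that], of "\<bar>u\<bar>"] by (simp add: abs_mult mult.commute)
  qed
  have L2: "\<bar>y * exp (u * y) - x * exp (u * x)\<bar> \<le> ((1 + lam * \<bar>u\<bar>) * X) / t * (exp (t * y) - exp (t * x))"
    if "0 \<le> x" "x \<le> y" "y \<le> lam" for x y
  proof (rule exp_dominates[where \<phi>' = "\<lambda>x. (1 + x * u) * exp (u * x)", OF _ t _ that])
    show "((\<lambda>x. x * exp (u * x)) has_real_derivative (1 + x * u) * exp (u * x)) (at x)" for x
      by (auto intro!: derivative_eq_intros simp: algebra_simps)
    show "\<bar>(1 + x * u) * exp (u * x)\<bar> \<le> (1 + lam * \<bar>u\<bar>) * X" if "0 \<le> x" "x \<le> lam" for x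
    proof -
      have "\<bar>x * u\<bar> \<le> lam * \<bar>u\<bar>" unfolding abs_mult using that by (intro mult_right_mono) auto
      then have "\<bar>1 + x * u\<bar> \<le> 1 + lam * \<bar>u\<bar>" by linarith
      then show ?thesis unfolding abs_mult using hi[OF that] by (intro mult_mono) auto
    qed
  qed
  define a1 where "a1 = (\<integral>\<kappa>. \<kappa> e * exp (u * \<kappa> e) \<partial>W1.CM \<xi>)"
  define a2 where "a2 = (\<integral>\<kappa>. \<kappa> e * exp (u * \<kappa> e) \<partial>W2.CM \<xi>)"
  define b1 where "b1 = mgf \<rho> G1 \<xi> e u"
  define b2 where "b2 = mgf \<rho> G2 \<xi> e u"
  have t0: "t \<ge> 0" using t by simp
  have B: "\<bar>b2 - b1\<bar> \<le> (\<bar>u\<bar> * X) / t * \<Delta>"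
    using lipschitz_gap[OF e _ K1 t0 L1, of \<xi>] by (simp add: b1_def b2_def mgf_def[of _ _ _ _ u] \<Delta>_def)
  have A: "\<bar>a2 - a1\<bar> \<le> ((1 + lam * \<bar>u\<bar>) * X) / t * \<Delta>"
    using lipschitz_gap[OF e _ K2 t0 L2, of \<xi>] by (simp add: a1_def a2_def \<Delta>_def)
  have bl: "1 / X \<le> b1" "1 / X \<le> b2"
    using W1.mgf_lower[OF ee(1), of u \<xi>] W2.mgf_lower[OF ee(2), of u \<xi>]
    by (simp_all add: b1_def b2_def X_def exp_minus inverse_eq_divide)
  have Xp: "0 < 1 / X" using X by simp
  have bp: "0 < b1" "0 < b2" using bl Xp by linarith+
  have inv: "1 / b1 \<le> X" "1 / b2 \<le> X"
    using bl bp X by (simp_all add: divide_le_eq mult.commute)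
  have a1b: "\<bar>a1\<bar> \<le> lam * X"
    unfolding a1_def by (rule W1.integrable_component(2)[OF ee(1) _ K2]) simp_all
  \<comment> \<open>Difference of quotients. Each inverse denominator and each exponential is at
    most X, which accounts for the powers X^2 and X^4.\<close>
  have "a2 / b2 - a1 / b1 = (a2 - a1) * (1 / b2) + a1 * (1 / b1) * (1 / b2) * (b1 - b2)"
    using bp by (simp add: field_simps)
  then have "\<bar>a2 / b2 - a1 / b1\<bar> \<le> \<bar>(a2 - a1) * (1 / b2)\<bar> + \<bar>a1 * (1 / b1) * (1 / b2) * (b1 - b2)\<bar>"
    by (simp only: abs_triangle_ineq)
  also have "\<bar>(a2 - a1) * (1 / b2)\<bar> \<le> (((1 + lam * \<bar>u\<bar>) * X) / t * \<Delta>) * X"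
    unfolding abs_mult using A inv bp by (intro mult_mono) auto
  also have "\<bar>a1 * (1 / b1) * (1 / b2) * (b1 - b2)\<bar> \<le> (lam * X) * X * X * ((\<bar>u\<bar> * X) / t * \<Delta>)"
    unfolding abs_mult using a1b B inv bp lam_pos X by (intro mult_mono) auto
  finally have "\<bar>a2 / b2 - a1 / b1\<bar> \<le> X ^ 2 * ((1 + lam * \<bar>u\<bar>) / t) * \<Delta> + X ^ 4 * (lam * (\<bar>u\<bar> / t)) * \<Delta>"
    by (simp add: power2_eq_square power4_eq_xxxx mult_ac)
  then show ?thesis
    unfolding W1.mean_tilt[OF ee(1)] W2.mean_tilt[OF ee(2)] a1_def[symmetric] a2_def[symmetric]
      b1_def[symmetric] b2_def[symmetric] X_def[symmetric] \<Delta>_def[symmetric] .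
qed

lemma cyl_orthant_mono:
  assumes F: "F \<subseteq> E"
  shows "cyl (W1.CM \<xi>) F (orthant F a) \<le> cyl (W2.CM \<xi>) F (orthant F a)"
proof -
  have F12: "F \<subseteq> edges G1" "F \<subseteq> edges G2" using F E_sub by simp_all
  have fF: "finite F" by (rule finite_subset[OF F12(1) G1.finite_edges])
  let ?f = "\<lambda>x. indicator (orthant F a) (restrict x F) :: real"
  have "incr E ?f"
    unfolding incr_def
  proof (intro conjI ballI impI)
    show "?f \<in> borel_measurable (\<Pi>\<^sub>M e\<in>E. \<rho>)"
      using orthant_sets[OF fF, of a] by (intro measurable_compose[OF measurable_restrict_subset[OF F]]) simp
    fix x y assume xy: "x \<in> cube E \<inter> space (\<Pi>\<^sub>M e\<in>E. \<rho>)" "y \<in> cube E \<inter> space (\<Pi>\<^sub>M e\<in>E. \<rho>)" "\<forall>e\<in>E. x e \<le> y e"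
    have "restrict y F \<in> orthant F a" if x: "restrict x F \<in> orthant F a"
    proof -
      have "restrict y F \<in> space (PF F)"
        using measurable_space[OF measurable_restrict_subset[OF F]] xy(2) by blast
      moreover have "a e < y e" if e: "e \<in> F" for e
      proof -
        have "a e < x e" using x e by (simp add: orthant_def)
        also have "x e \<le> y e" using xy(3) F e by blast
        finally show ?thesis .
      qed
      ultimately show ?thesis by (simp add: orthant_def)
    qed
    then show "?f x \<le> ?f y" by (simp add: indicator_def)
  qed
  moreover have "restrict (restrict \<kappa> E) F = restrict \<kappa> F" for \<kappa> :: "'e \<Rightarrow> real" using F by (simp add: Int_absorb1)
  ultimately show ?thesis
    using expectation_mono[of ?f \<xi>]
    by (simp only: W1.cyl_CM(1)[OF F12(1) orthant_sets[OF fF]] W2.cyl_CM(1)[OF F12(2) orthant_sets[OF fF]])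
qed

text \<open>The indicator of an orthant is approximated by an increasing function with Lipschitz constant \<open>k\<close> in
  each coordinate; adding it with a minus sign to \<open>k \<Sum> \<kappa> e\<close> keeps the latter increasing.\<close>

lemma cyl_orthant_gap:
  fixes k :: real
  assumes F: "F \<subseteq> E" and k: "k > 0"
  shows "cyl (W2.CM \<xi>) F (orthant F a) - cyl (W1.CM \<xi>) F (orthant F a) \<le>
    k * (\<Sum>e\<in>F. (\<integral>\<kappa>. \<kappa> e \<partial>W2.CM \<xi>) - (\<integral>\<kappa>. \<kappa> e \<partial>W1.CM \<xi>)) +
    change_const F \<xi> * measure (PF F) (orthant F a - orthant F (\<lambda>e. a e + 1 / k))"
proof -
  have F12: "F \<subseteq> edges G1" "F \<subseteq> edges G2" using F E_sub by simp_all
  have fF: "finite F" by (rule finite_subset[OF F12(1) G1.finite_edges])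
  \<comment> \<open>A ramp rising from 0 at \<open>a e\<close> to 1 at \<open>a e + 1 / k\<close>.
    The product \<open>p\<close> of the ramps lies below the indicator of the orthant and equals 1
    on the orthant with corner raised by 1/k, so only the shell between them costs.\<close>
  define \<psi> where "\<psi> e s = min 1 (k * max 0 (s - a e))" for e and s :: real
  define p where "p x = (\<Prod>e\<in>F. \<psi> e (x e))" for x
  let ?A = "orthant F a" and ?A' = "orthant F (\<lambda>e. a e + 1 / k)"
  have sA: "?A \<in> sets (PF F)" "?A' \<in> sets (PF F)" "?A - ?A' \<in> sets (PF F)"
    using orthant_sets[OF fF] by auto
  have \<psi>: "0 \<le> \<psi> e s" "\<psi> e s \<le> 1" for e s using k by (auto simp: \<psi>_def)
  have p01: "0 \<le> p x" "p x \<le> 1" for x unfolding p_def using \<psi> by (auto intro: prod_nonneg prod_le_1)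
  have \<psi>lip: "\<bar>\<psi> e s - \<psi> e s'\<bar> \<le> k * \<bar>s - s'\<bar>" for e s s'
  proof -
    have "\<bar>min 1 p - min 1 q\<bar> \<le> \<bar>p - q\<bar>" for p q :: real by linarith
    then have "\<bar>\<psi> e s - \<psi> e s'\<bar> \<le> \<bar>k * max 0 (s - a e) - k * max 0 (s' - a e)\<bar>" unfolding \<psi>_def .
    also have "\<dots> = k * \<bar>max 0 (s - a e) - max 0 (s' - a e)\<bar>" using k by (simp add: abs_mult flip: right_diff_distrib)
    also have "\<dots> \<le> k * \<bar>s - s'\<bar>" using k by (intro mult_left_mono) linarith+
    finally show ?thesis .
  qed
  have plip: "\<bar>p y - p x\<bar> \<le> k * (\<Sum>e\<in>F. y e - x e)" if "\<forall>e\<in>F. x e \<le> y e" for x y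
  proof -
    have "\<bar>p y - p x\<bar> \<le> (\<Sum>e\<in>F. \<bar>\<psi> e (y e) - \<psi> e (x e)\<bar>)"
      unfolding p_def using norm_prod_diff[of F "\<lambda>e. \<psi> e (y e)" "\<lambda>e. \<psi> e (x e)"] \<psi> by simp
    also have "\<dots> \<le> (\<Sum>e\<in>F. k * (y e - x e))"
    proof (rule sum_mono)
      fix e assume "e \<in> F"
      then show "\<bar>\<psi> e (y e) - \<psi> e (x e)\<bar> \<le> k * (y e - x e)" using \<psi>lip[of e "y e" "x e"] that by simp
    qed
    finally show ?thesis by (simp add: sum_distrib_left)
  qed
  have comp: "(\<lambda>x. x e) \<in> borel_measurable (\<Pi>\<^sub>M e\<in>E. \<rho>)" if "e \<in> F" for e using component_measurable[of e E] F that by blast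
  have pm: "p \<in> borel_measurable (\<Pi>\<^sub>M e\<in>E. \<rho>)"
  proof -
    have "(\<lambda>x. \<psi> e (x e)) \<in> borel_measurable (\<Pi>\<^sub>M e\<in>E. \<rho>)" if "e \<in> F" for e
      unfolding \<psi>_def using comp[OF that] by measurable
    then show ?thesis unfolding p_def[abs_def] by (rule borel_measurable_prod)
  qed
  have pr: "p (restrict \<kappa> E) = p \<kappa>" for \<kappa>
    unfolding p_def by (rule prod.cong) (use F in auto)
  have sr: "(\<Sum>e\<in>F. restrict \<kappa> E e) = (\<Sum>e\<in>F. \<kappa> e)" for \<kappa> :: "'e \<Rightarrow> real" by (rule sum.cong) (use F in auto)
  have inc: "incr E (\<lambda>x. k * (\<Sum>e\<in>F. x e) - p x)"
    unfolding incr_def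
  proof (intro conjI ballI impI)
    show "(\<lambda>x. k * (\<Sum>e\<in>F. x e) - p x) \<in> borel_measurable (\<Pi>\<^sub>M e\<in>E. \<rho>)"
      using comp pm by (intro borel_measurable_diff borel_measurable_times borel_measurable_sum borel_measurable_const)
    fix x y :: "'e \<Rightarrow> real" assume "\<forall>e\<in>E. x e \<le> y e"
    then have "\<forall>e\<in>F. x e \<le> y e" using F by blast
    from plip[OF this] show "k * (\<Sum>e\<in>F. x e) - p x \<le> k * (\<Sum>e\<in>F. y e) - p y"
      by (simp add: sum_subtractf right_diff_distrib abs_le_iff)
  qed
  have pt: "p \<kappa> \<le> indicator ?A (restrict \<kappa> F)" "indicator ?A (restrict \<kappa> F) \<le> p \<kappa> + indicator (?A - ?A') (restrict \<kappa> F)"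
    if sp: "restrict \<kappa> F \<in> space (PF F)" for \<kappa>
  proof -
    show "p \<kappa> \<le> indicator ?A (restrict \<kappa> F)"
    proof (cases "restrict \<kappa> F \<in> ?A")
      case False
      then have "\<exists>e\<in>F. \<kappa> e \<le> a e" using sp by (auto simp: orthant_def not_less)
      then obtain e where "e \<in> F" "\<kappa> e \<le> a e" by blast
      then have "\<psi> e (\<kappa> e) = 0" by (simp add: \<psi>_def)
      then have "p \<kappa> = 0" unfolding p_def using fF \<open>e \<in> F\<close> by (intro prod_zero) auto
      then show ?thesis using False by simp
    qed (use p01 in simp)
    show "indicator ?A (restrict \<kappa> F) \<le> p \<kappa> + indicator (?A - ?A') (restrict \<kappa> F)"
    proof (cases "restrict \<kappa> F \<in> ?A'")
      case True
      have "\<psi> e (\<kappa> e) = 1" if "e \<in> F" for e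
      proof -
        have lt: "1 / k < \<kappa> e - a e" using True that by (simp add: orthant_def less_diff_eq add.commute)
        moreover have "0 < 1 / k" using k by simp
        ultimately have "0 < \<kappa> e - a e" by linarith
        then have "max 0 (\<kappa> e - a e) = \<kappa> e - a e" by simp
        moreover have "1 \<le> k * (\<kappa> e - a e)" using lt k by (simp add: pos_divide_less_eq mult.commute)
        ultimately show ?thesis by (simp add: \<psi>_def)
      qed
      then have "p \<kappa> = 1" by (simp add: p_def)
      then show ?thesis by (simp add: indicator_def)
    qed (use p01(1)[of \<kappa>] in \<open>simp add: indicator_def\<close>)
  qed
  have int1: "integrable (W1.CM \<xi>) (\<lambda>\<kappa>. \<kappa> e)" and int2: "integrable (W2.CM \<xi>) (\<lambda>\<kappa>. \<kappa> e)" if "e \<in> F" for e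
    using W1.integrable_component(1)[of e "\<lambda>x. x" lam \<xi>] W2.integrable_component(1)[of e "\<lambda>x. x" lam \<xi>] that F12 by auto
  have b: "\<forall>x\<in>cube E \<inter> space (\<Pi>\<^sub>M e\<in>E. \<rho>). \<bar>p x\<bar> \<le> 1" using p01 by simp
  have ip1: "integrable (W1.CM \<xi>) p" and ip2: "integrable (W2.CM \<xi>) p"
    using W1.integrable_CM_bounded[OF E_sub(1) pm b, of \<xi>] W2.integrable_CM_bounded[OF E_sub(2) pm b, of \<xi>]
    by (simp_all add: pr)
  have "(\<integral>\<kappa>. k * (\<Sum>e\<in>F. \<kappa> e) - p \<kappa> \<partial>W1.CM \<xi>) \<le> (\<integral>\<kappa>. k * (\<Sum>e\<in>F. \<kappa> e) - p \<kappa> \<partial>W2.CM \<xi>)"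
    using expectation_mono[OF inc, of \<xi>] unfolding pr sr .
  then have 1: "(\<integral>\<kappa>. p \<kappa> \<partial>W2.CM \<xi>) - (\<integral>\<kappa>. p \<kappa> \<partial>W1.CM \<xi>) \<le>
      k * (\<Sum>e\<in>F. (\<integral>\<kappa>. \<kappa> e \<partial>W2.CM \<xi>) - (\<integral>\<kappa>. \<kappa> e \<partial>W1.CM \<xi>))"
    using int1 int2 ip1 ip2 by (simp add: sum_subtractf right_diff_distrib)
  have ae1: "AE \<kappa> in W1.CM \<xi>. restrict \<kappa> F \<in> space (PF F)" using W1.AE_CM_restrict[OF F12(1), of \<xi>] by (rule eventually_mono) blast
  have ae2: "AE \<kappa> in W2.CM \<xi>. restrict \<kappa> F \<in> space (PF F)" using W2.AE_CM_restrict[OF F12(2), of \<xi>] by (rule eventually_mono) blast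
  have 2: "(\<integral>\<kappa>. p \<kappa> \<partial>W1.CM \<xi>) \<le> cyl (W1.CM \<xi>) F ?A"
    unfolding W1.cyl_CM(1)[OF F12(1) sA(1)]
    by (rule integral_mono_AE[OF ip1 W1.cyl_CM(2)[OF F12(1) sA(1)]]) (use ae1 in \<open>rule eventually_mono\<close>, rule pt(1))
  have "cyl (W2.CM \<xi>) F ?A \<le> (\<integral>\<kappa>. p \<kappa> + indicator (?A - ?A') (restrict \<kappa> F) \<partial>W2.CM \<xi>)"
    unfolding W2.cyl_CM(1)[OF F12(2) sA(1)]
    by (rule integral_mono_AE[OF W2.cyl_CM(2)[OF F12(2) sA(1)]
        Bochner_Integration.integrable_add[OF ip2 W2.cyl_CM(2)[OF F12(2) sA(3)]]])
      (use ae2 in \<open>rule eventually_mono\<close>, rule pt(2))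
  also have "\<dots> = (\<integral>\<kappa>. p \<kappa> \<partial>W2.CM \<xi>) + cyl (W2.CM \<xi>) F (?A - ?A')"
    unfolding W2.cyl_CM(1)[OF F12(2) sA(3)]
    by (rule Bochner_Integration.integral_add[OF ip2 W2.cyl_CM(2)[OF F12(2) sA(3)]])
  also have "cyl (W2.CM \<xi>) F (?A - ?A') \<le> change_const F \<xi> * measure (PF F) (?A - ?A')"
    using W2.cyl_bound[OF F12(2)] sA(3) by blast
  finally show ?thesis using 1 2 by linarith
qed

end

section \<open>Passage to infinite volume\<close>

context disorder
begin

lemma mean_gap_tendsto:
  assumes e: "e \<in> lattice_bonds" and D: "(\<lambda>n. D 0 n e \<xi>) \<longlonglongrightarrow> 0"
  shows "(\<lambda>n. (\<integral>\<kappa>. \<kappa> e \<partial>conductance_measure \<rho> (WG 0 n) \<xi>) - (\<integral>\<kappa>. \<kappa> e \<partial>conductance_measure \<rho> (FG 0 n) \<xi>)) \<longlonglongrightarrow> 0"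
proof -
  define t where "t = B - A"
  have t: "t > 0" using AB by (simp add: t_def)
  define \<zeta> where "\<zeta> = \<xi>(e := A)"
  define u where "u = \<xi> e - A"
  have \<xi>: "\<xi> = \<zeta>(e := \<zeta> e + u)" by (simp add: \<zeta>_def u_def)
  define C where "C = exp (\<bar>u\<bar> * lam) ^ 2 * ((1 + lam * \<bar>u\<bar>) / t) + exp (\<bar>u\<bar> * lam) ^ 4 * (lam * (\<bar>u\<bar> / t))"
  have C: "C \<ge> 0" unfolding C_def using t lam_pos by (intro add_nonneg_nonneg mult_nonneg_nonneg divide_nonneg_nonneg) auto
  obtain n0 where n0: "\<forall>n\<ge>n0. {e} \<subseteq> bonds (box 0 n)" using lattice_bond_in_box[of "{e}"] e by auto
  have bound: "norm ((\<integral>\<kappa>. \<kappa> e \<partial>conductance_measure \<rho> (WG 0 n) \<xi>) - (\<integral>\<kappa>. \<kappa> e \<partial>conductance_measure \<rho> (FG 0 n) \<xi>))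
    \<le> C * (exp (t * lam) * D 0 n e \<xi>)" if "n \<ge> n0" for n
  proof -
    have en: "e \<in> bonds (box 0 n)" using n0 that by auto
    interpret R: rc_collapse \<rho> lam "FG 0 n" "WG 0 n" "wired_class (box 0 n)" "bonds (box 0 n)"
      by (rule rc_collapse_free_wired)
    let ?x = "mgf \<rho> (WG 0 n) \<zeta> e t" and ?y = "mgf \<rho> (FG 0 n) \<zeta> e t"
    have p: "0 < ?x" "0 < ?y" "?x \<le> exp (t * lam)"
      using R.W2.mgf_pos[of e] R.W1.mgf_pos[of e] R.W2.mgf_bounds(2)[of e t \<zeta>] en t by auto
    \<comment> \<open>The inequality ln z \<le> z - 1 converts the difference of logarithms, which
      is the response, into a bound on the difference of the moments themselves.\<close>
    have "ln (?y / ?x) \<le> ?y / ?x - 1" using p by (intro ln_le_minus_one) simp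
    then have "1 - ?y / ?x \<le> ln ?x - ln ?y" using p by (simp add: ln_div)
    also have "\<dots> = D 0 n e \<xi>" unfolding D_def G_upd[OF en] \<zeta>_def t_def ..
    finally have "?x * (1 - ?y / ?x) \<le> ?x * D 0 n e \<xi>" using p by (intro mult_left_mono) auto
    then have "?x - ?y \<le> ?x * D 0 n e \<xi>" using p by (simp add: right_diff_distrib)
    also have "\<dots> \<le> exp (t * lam) * D 0 n e \<xi>" using p D_bounds[OF en] by (intro mult_right_mono) auto
    finally have "C * (?x - ?y) \<le> C * (exp (t * lam) * D 0 n e \<xi>)" using C by (rule mult_left_mono)
    moreover have "norm ((\<integral>\<kappa>. \<kappa> e \<partial>conductance_measure \<rho> (WG 0 n) \<xi>) - (\<integral>\<kappa>. \<kappa> e \<partial>conductance_measure \<rho> (FG 0 n) \<xi>))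
      \<le> C * (?x - ?y)"
      using R.mean_gap[OF en t, of \<zeta> u] unfolding \<xi>[symmetric] C_def distrib_right real_norm_def .
    ultimately show ?thesis by linarith
  qed
  have "(\<lambda>n. C * (exp (t * lam) * D 0 n e \<xi>)) \<longlonglongrightarrow> C * (exp (t * lam) * 0)" by (intro tendsto_intros D)
  then have "(\<lambda>n. C * (exp (t * lam) * D 0 n e \<xi>)) \<longlonglongrightarrow> 0" by simp
  then show ?thesis
    by (rule Lim_null_comparison[rotated]) (use bound in \<open>auto simp: eventually_sequentially\<close>)
qed

text \<open>The steepness of the ramp is fixed first, so that the shell has small mass, uniformly in
  the box by the density bound. The gap of the means, multiplied by that fixed slope, then vanishes
  as the box grows.\<close>

lemma cyl_gap_tendsto:
  assumes F: "finite F" "F \<subseteq> lattice_bonds" and D: "\<And>e. e \<in> lattice_bonds \<Longrightarrow> (\<lambda>n. D 0 n e \<xi>) \<longlonglongrightarrow> 0"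
  shows "(\<lambda>n. cyl (conductance_measure \<rho> (WG 0 n) \<xi>) F (orthant F a) -
    cyl (conductance_measure \<rho> (FG 0 n) \<xi>) F (orthant F a)) \<longlonglongrightarrow> 0"
proof (rule LIMSEQ_I)
  fix \<epsilon> :: real assume \<epsilon>: "0 < \<epsilon>"
  let ?d = "\<lambda>n. cyl (conductance_measure \<rho> (WG 0 n) \<xi>) F (orthant F a) - cyl (conductance_measure \<rho> (FG 0 n) \<xi>) F (orthant F a)"
  let ?S = "\<lambda>j::nat. orthant F a - orthant F (\<lambda>e. a e + 1 / real (Suc j))"
  have sS: "range ?S \<subseteq> sets (PF F)" using orthant_sets[OF F(1)] by auto
  have dS: "decseq ?S"
  proof (rule decseq_SucI)
    fix j
    have le: "1 / real (Suc (Suc j)) \<le> 1 / real (Suc j)" by (intro divide_left_mono) auto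
    have "orthant F (\<lambda>e. a e + 1 / real (Suc j)) \<subseteq> orthant F (\<lambda>e. a e + 1 / real (Suc (Suc j)))"
    proof
      fix x assume x: "x \<in> orthant F (\<lambda>e. a e + 1 / real (Suc j))"
      have "a e + 1 / real (Suc (Suc j)) < x e" if "e \<in> F" for e
      proof -
        have "a e + 1 / real (Suc j) < x e" using x that unfolding orthant_def by blast
        then show ?thesis using le by linarith
      qed
      then show "x \<in> orthant F (\<lambda>e. a e + 1 / real (Suc (Suc j)))" using x unfolding orthant_def by blast
    qed
    then show "?S (Suc j) \<subseteq> ?S j" by blast
  qed
  have iS: "(\<Inter>j. ?S j) = {}"
  proof -
    have "\<exists>j. x \<in> orthant F (\<lambda>e. a e + 1 / real (Suc j))" if x: "x \<in> orthant F a" for x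
    proof -
      have "\<exists>j. \<forall>i\<ge>j. \<forall>e\<in>F. a e + 1 / real (Suc i) < x e"
      proof -
        have "eventually (\<lambda>i. \<forall>e\<in>F. a e + 1 / real (Suc i) < x e) sequentially"
        proof (rule eventually_ball_finite[OF F(1)], rule ballI)
          fix e assume "e \<in> F"
          then have "a e < x e" using x by (simp add: orthant_def)
          have "(\<lambda>i. a e + 1 / real (Suc i)) \<longlonglongrightarrow> a e + 0" by (intro tendsto_add tendsto_const LIMSEQ_Suc lim_1_over_n)
          then show "eventually (\<lambda>i. a e + 1 / real (Suc i) < x e) sequentially"
            using \<open>a e < x e\<close> by (intro order_tendstoD) auto
        qed
        then show ?thesis by (simp add: eventually_sequentially)
      qed
      then obtain j where "\<forall>e\<in>F. a e + 1 / real (Suc j) < x e" by blast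
      then have "x \<in> orthant F (\<lambda>e. a e + 1 / real (Suc j))" using x by (simp add: orthant_def)
      then show ?thesis ..
    qed
    then show ?thesis by blast
  qed
  have "(\<lambda>j. change_const F \<xi> * measure (PF F) (?S j)) \<longlonglongrightarrow> change_const F \<xi> * measure (PF F) (\<Inter>j. ?S j)"
    by (intro tendsto_mult tendsto_const \<Pi>.P.finite_Lim_measure_decseq[OF sS dS])
  then have "(\<lambda>j. change_const F \<xi> * measure (PF F) (?S j)) \<longlonglongrightarrow> 0" unfolding iS by simp
  then have "eventually (\<lambda>j. change_const F \<xi> * measure (PF F) (?S j) < \<epsilon> / 2) sequentially"
    using \<epsilon> by (intro order_tendstoD) auto
  then obtain j where j: "change_const F \<xi> * measure (PF F) (?S j) < \<epsilon> / 2" by (auto simp: eventually_sequentially)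
  let ?m = "\<lambda>n. real (Suc j) * (\<Sum>e\<in>F. (\<integral>\<kappa>. \<kappa> e \<partial>conductance_measure \<rho> (WG 0 n) \<xi>) - (\<integral>\<kappa>. \<kappa> e \<partial>conductance_measure \<rho> (FG 0 n) \<xi>))"
  have "?m \<longlonglongrightarrow> real (Suc j) * (\<Sum>e\<in>F. 0)"
    by (intro tendsto_mult tendsto_const tendsto_sum mean_gap_tendsto D) (use F in auto)
  moreover have "real (Suc j) * (\<Sum>e\<in>F. 0) = 0" by simp
  ultimately have m0: "?m \<longlonglongrightarrow> 0" by (simp only:)
  have "eventually (\<lambda>n. ?m n < \<epsilon> / 2) sequentially" by (rule order_tendstoD(2)[OF m0]) (use \<epsilon> in simp)
  moreover obtain n0 where "\<forall>n\<ge>n0. F \<subseteq> bonds (box 0 n)" using lattice_bond_in_box[OF F] by blast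
  then have "eventually (\<lambda>n. F \<subseteq> bonds (box 0 n)) sequentially" by (auto simp: eventually_sequentially)
  ultimately have "eventually (\<lambda>n. norm (?d n - 0) < \<epsilon>) sequentially"
  proof eventually_elim
    case (elim n)
    interpret R: rc_collapse \<rho> lam "FG 0 n" "WG 0 n" "wired_class (box 0 n)" "bonds (box 0 n)"
      by (rule rc_collapse_free_wired)
    have "0 \<le> ?d n" using R.cyl_orthant_mono[OF elim(2), of \<xi> a] by simp
    moreover have "?d n \<le> ?m n + change_const F \<xi> * measure (PF F) (?S j)"
      by (rule R.cyl_orthant_gap[OF elim(2)]) simp
    ultimately show ?case using elim(1) j by simp
  qed
  then show "\<exists>no. \<forall>n\<ge>no. norm (?d n - 0) < \<epsilon>" by (simp add: eventually_sequentially)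
qed

lemma common_local_limit:
  assumes D: "\<And>e. e \<in> lattice_bonds \<Longrightarrow> (\<lambda>n. D 0 n e \<xi>) \<longlonglongrightarrow> 0"
  shows "\<exists>\<mu>. local_limit (free_box_measure \<rho> \<xi>) \<mu> \<and> local_limit (wired_box_measure \<rho> \<xi>) \<mu>"
proof -
  let ?f = "\<lambda>n. conductance_measure \<rho> (FG 0 n) \<xi>" and ?w = "\<lambda>n. conductance_measure \<rho> (WG 0 n) \<xi>"
  have fb: "free_box_measure \<rho> \<xi> = ?f" "wired_box_measure \<rho> \<xi> = ?w"
    by (simp_all add: fun_eq_iff free_box_measure_def wired_box_measure_def lattice_box_eq)
  \<comment> \<open>The alternating sequence: its local limit is inherited by the even and the odd
    terms, hence common to the free and the wired measures.\<close>
  define M where "M k = (if even k then ?f (k div 2) else ?w (k div 2))" for k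
  have "\<exists>\<mu>. local_limit M \<mu>"
  proof (rule local_limit_exists)
    fix F :: "bond set" assume F: "finite F" "F \<subseteq> lattice_bonds"
    obtain n0 where n0: "\<forall>n\<ge>n0. F \<subseteq> bonds (box 0 n)" using lattice_bond_in_box[OF F] by blast
    have "prob_space (M k) \<and> (\<lambda>\<kappa>. restrict \<kappa> F) \<in> measurable (M k) (PF F) \<and>
       (\<forall>A\<in>sets (PF F). cyl (M k) F A \<le> change_const F \<xi> * measure (PF F) A)" if "k \<ge> 2 * n0" for k
    proof -
      have "F \<subseteq> bonds (box 0 (k div 2))" using n0 that by simp
      then show ?thesis
        using rc_graph.cyl_bound[OF rc_free, of F 0 "k div 2" \<xi>] rc_graph.cyl_bound[OF rc_wired, of F 0 "k div 2" \<xi>]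
        by (simp add: M_def)
    qed
    then show "\<exists>K. eventually (\<lambda>k. prob_space (M k) \<and> (\<lambda>\<kappa>. restrict \<kappa> F) \<in> measurable (M k) (PF F) \<and>
       (\<forall>A\<in>sets (PF F). cyl (M k) F A \<le> K * measure (PF F) A)) sequentially"
      unfolding eventually_sequentially by blast
    fix a :: "bond \<Rightarrow> real"
    let ?q = "\<lambda>n. cyl (?f n) F (orthant F a)"
    \<comment> \<open>Free orthant probabilities increase with the box and so converge; the wired
      ones follow because the gap vanishes.\<close>
    have inc: "incseq (\<lambda>i. ?q (n0 + i))"
    proof (rule incseq_SucI)
      fix i
      have "box 0 (n0 + i) \<subseteq> box 0 (n0 + Suc i)" by (intro box_mono) auto
      from rc_collapse.cyl_orthant_mono[OF rc_collapse_free_free[OF this], of F \<xi> a]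
      show "?q (n0 + i) \<le> ?q (n0 + Suc i)" using n0 by simp
    qed
    have le: "\<forall>i. ?q (n0 + i) \<le> 1"
      unfolding cyl_def by (intro allI prob_space.prob_le_1[OF rc_graph.prob_CM[OF rc_free]])
    obtain c where "(\<lambda>i. ?q (n0 + i)) \<longlonglongrightarrow> c" using incseq_convergent[OF inc le] .
    then have "(\<lambda>i. ?q (i + n0)) \<longlonglongrightarrow> c" by (simp add: add.commute)
    then have f: "?q \<longlonglongrightarrow> c" by (rule LIMSEQ_offset)
    have w: "(\<lambda>n. cyl (?w n) F (orthant F a)) \<longlonglongrightarrow> c"
      using tendsto_add[OF cyl_gap_tendsto[OF F D, of a] f] by simp
    have half: "filterlim (\<lambda>k::nat. k div 2) sequentially sequentially"
      unfolding filterlim_at_top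
    proof
      fix Z :: nat show "eventually (\<lambda>k. Z \<le> k div 2) sequentially"
        by (rule eventually_sequentiallyI[of "2 * Z"]) simp
    qed
    have "(\<lambda>k. if even k then ?q (k div 2) else cyl (?w (k div 2)) F (orthant F a)) \<longlonglongrightarrow> c"
      by (rule filterlim_If) (auto intro!: tendsto_mono[OF inf_le1] filterlim_compose[OF f half] filterlim_compose[OF w half])
    then have "(\<lambda>k. cyl (M k) F (orthant F a)) \<longlonglongrightarrow> c"
      by (rule Lim_transform_eventually) (simp add: M_def)
    then show "convergent (\<lambda>k. cyl (M k) F (orthant F a))" by (rule convergentI)
  qed
  then obtain \<mu> where \<mu>: "local_limit M \<mu>" by blast
  have sub: "local_limit (\<lambda>n. M (r n)) \<mu>" if "strict_mono r" for r
    unfolding local_limit_def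
  proof (intro conjI allI impI)
    show "prob_space \<mu>" "sets \<mu> = sets (\<Pi>\<^sub>M e\<in>lattice_bonds. pos_borel)" using \<mu> unfolding local_limit_def by blast+
    fix F A assume FA: "finite F" "F \<subseteq> lattice_bonds" "A \<in> sets (\<Pi>\<^sub>M e\<in>F. pos_borel)"
    have "(\<lambda>k. measure (M k) {\<kappa> \<in> space (M k). restrict \<kappa> F \<in> A}) \<longlonglongrightarrow> measure \<mu> {\<kappa> \<in> space \<mu>. restrict \<kappa> F \<in> A}"
      using \<mu> FA unfolding local_limit_def by blast
    from LIMSEQ_subseq_LIMSEQ[OF this that]
    show "(\<lambda>n. measure (M (r n)) {\<kappa> \<in> space (M (r n)). restrict \<kappa> F \<in> A}) \<longlonglongrightarrow> measure \<mu> {\<kappa> \<in> space \<mu>. restrict \<kappa> F \<in> A}"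
      by (simp add: comp_def)
  qed
  have "(\<lambda>n. M (2 * n)) = ?f" "(\<lambda>n. M (2 * n + 1)) = ?w" by (simp_all add: M_def)
  then show ?thesis
    using sub[of "\<lambda>n. 2 * n"] sub[of "\<lambda>n. 2 * n + 1"] unfolding fb by (auto simp: strict_mono_def)
qed

lemma AE_free_eq_wired:
  "AE \<xi> in P. local_limit (free_box_measure \<rho> \<xi>) (free_measure \<rho> \<xi>) \<and>
    local_limit (wired_box_measure \<rho> \<xi>) (wired_measure \<rho> \<xi>) \<and> free_measure \<rho> \<xi> = wired_measure \<rho> \<xi>"
proof -
  have "AE \<xi> in P. \<forall>e\<in>lattice_bonds. (\<lambda>n. D 0 n e \<xi>) \<longlonglongrightarrow> 0"
    using AE_D_tendsto by (subst AE_ball_countable[OF countable_lattice_bonds]) blast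
  then show ?thesis
  proof (rule eventually_mono)
    fix \<xi> assume "\<forall>e\<in>lattice_bonds. (\<lambda>n. D 0 n e \<xi>) \<longlonglongrightarrow> 0"
    then obtain \<mu> where \<mu>: "local_limit (free_box_measure \<rho> \<xi>) \<mu>" "local_limit (wired_box_measure \<rho> \<xi>) \<mu>"
      using common_local_limit[of \<xi>] by blast
    have "free_measure \<rho> \<xi> = \<mu>" "wired_measure \<rho> \<xi> = \<mu>"
      unfolding free_measure_def wired_measure_def using \<mu> local_limit_unique by (blast intro: the_equality)+
    then show "local_limit (free_box_measure \<rho> \<xi>) (free_measure \<rho> \<xi>) \<and>
      local_limit (wired_box_measure \<rho> \<xi>) (wired_measure \<rho> \<xi>) \<and> free_measure \<rho> \<xi> = wired_measure \<rho> \<xi>"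
      using \<mu> by simp
  qed
qed

end

text \<open>If no such pair of rays existed, a ray below a point would have mass zero or carry
  everything, since positive mass there leaves none strictly above. Almost every point then makes
  the same cut in the rationals, which pins it down to one constant.\<close>

lemma nonconstant_two_rays:
  fixes \<nu> :: "real measure"
  assumes \<nu>: "prob_space \<nu>" and s: "sets \<nu> = sets borel" and nc: "\<not> (\<exists>c. AE x in \<nu>. x = c)"
  obtains a b where "a < b" "measure \<nu> {..a} > 0" "measure \<nu> {b..} > 0"
proof (rule ccontr)
  interpret prob_space \<nu> by fact
  assume *: "\<not> thesis"
  have sets: "{..x} \<in> events" "{x..} \<in> events" "{x<..} \<in> events" for x by (simp_all add: s)
  have dich: "prob {..a} = 0 \<or> (AE x in \<nu>. x \<le> a)" for a
  proof (cases "prob {..a} = 0")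
    case False
    then have pa: "prob {..a} > 0" using measure_nonneg[of \<nu> "{..a}"] by linarith
    have "AE x in \<nu>. \<not> a + 1 / real (Suc i) \<le> x" for i
    proof -
      have "\<not> prob {a + 1 / real (Suc i)..} > 0" using that[of a "a + 1 / real (Suc i)"] pa * by auto
      then have "prob {a + 1 / real (Suc i)..} = 0" using measure_nonneg[of \<nu> "{a + 1 / real (Suc i)..}"] by linarith
      then have "{a + 1 / real (Suc i)..} \<in> null_sets \<nu>" using sets by (simp add: null_sets_def emeasure_eq_measure)
      then show ?thesis using AE_not_in[of "{a + 1 / real (Suc i)..}" \<nu>] by simp
    qed
    then have "AE x in \<nu>. \<forall>i. \<not> a + 1 / real (Suc i) \<le> x" by (subst AE_all_countable) blast
    then have "AE x in \<nu>. x \<le> a"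
    proof (rule eventually_mono)
      fix x assume x: "\<forall>i. \<not> a + 1 / real (Suc i) \<le> x"
      show "x \<le> a"
      proof (rule ccontr)
        assume "\<not> x \<le> a"
        then obtain i where "inverse (real (Suc i)) < x - a" using reals_Archimedean[of "x - a"] by auto
        then show False using x[rule_format, of i] by (simp add: inverse_eq_divide)
      qed
    qed
    then show ?thesis ..
  qed simp
  have ae: "AE x in \<nu>. \<forall>q::rat. (x \<le> of_rat q) = (prob {..of_rat q} \<noteq> 0)"
  proof (subst AE_all_countable, rule allI)
    fix q :: rat
    show "AE x in \<nu>. (x \<le> of_rat q) = (prob {..of_rat q} \<noteq> 0)"
    proof (cases "prob {..of_rat q} = 0")
      case True
      then have "{..of_rat q} \<in> null_sets \<nu>" using sets by (simp add: null_sets_def emeasure_eq_measure)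
      then show ?thesis using AE_not_in[of "{..of_rat q}" \<nu>] True by simp
    next
      case False
      then show ?thesis using dich[of "of_rat q"] by simp
    qed
  qed
  \<comment> \<open>Any typical point can serve as \<open>c\<close>; without one, an almost sure
    event would be empty.\<close>
  have "\<exists>c::real. \<forall>q::rat. (c \<le> of_rat q) = (prob {..of_rat q} \<noteq> 0)"
  proof (rule ccontr)
    assume no: "\<nexists>c::real. \<forall>q::rat. (c \<le> of_rat q) = (prob {..of_rat q} \<noteq> 0)"
    have "AE x in \<nu>. False"
      using ae
    proof (rule eventually_mono)
      fix x :: real assume "\<forall>q::rat. (x \<le> of_rat q) = (prob {..of_rat q} \<noteq> 0)"
      then have "\<exists>c::real. \<forall>q::rat. (c \<le> of_rat q) = (prob {..of_rat q} \<noteq> 0)" by (rule exI)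
      with no show False by (rule notE)
    qed
    then show False by (simp add: AE_False)
  qed
  then obtain c :: real where c: "\<forall>q::rat. (c \<le> of_rat q) = (prob {..of_rat q} \<noteq> 0)" ..
  have "AE x in \<nu>. x = c"
    using ae
  proof (rule eventually_mono)
    fix x :: real assume x: "\<forall>q::rat. (x \<le> of_rat q) = (prob {..of_rat q} \<noteq> 0)"
    show "x = c"
    proof (rule ccontr)
      assume "x \<noteq> c"
      then obtain q :: rat where "min x c < of_rat q" "of_rat q < max x c"
        using of_rat_dense[of "min x c" "max x c"] by fastforce
      moreover have "(x \<le> of_rat q) = (c \<le> of_rat q)" using x c by blast
      ultimately show False by (cases "x \<le> c") (simp_all add: min_def max_def)
    qed
  qed
  then show False using nc by blast
qed

text \<open>The two \<open>local_limit\<close> conjuncts give the equality its content: without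
  existing limits, the definite descriptions would denote unspecified measures.\<close>

theorem theorem4p1:
  fixes \<rho> :: "real measure" and lam :: real
    and \<nu> :: "real measure" and P :: "(bond \<Rightarrow> real) measure"
  assumes "sets \<rho> = sets pos_borel"
    and "emeasure \<rho> (space \<rho>) = 1"
    and "lam > 0"
    and "msupport \<rho> \<subseteq> {inverse lam..lam}"
    and "prob_space \<nu>"
    and "sets \<nu> = sets borel"
    and "P = (\<Pi>\<^sub>M e\<in>lattice_bonds. \<nu>)"
    and "\<And>e. e \<in> lattice_bonds \<Longrightarrow> \<not> (\<exists>c. AE \<xi> in P. \<xi> e = c)"
  shows "AE \<xi> in P.
    local_limit (free_box_measure \<rho> \<xi>) (free_measure \<rho> \<xi>) \<and>
    local_limit (wired_box_measure \<rho> \<xi>) (wired_measure \<rho> \<xi>) \<and>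
    free_measure \<rho> \<xi> = wired_measure \<rho> \<xi>"
proof -
  interpret \<nu>: prob_space \<nu> by fact
  interpret pp: product_prob_space "\<lambda>_::bond. \<nu>" lattice_bonds ..
  \<comment> \<open>One bond is enough to transfer nondegeneracy to \<nu>, the law of each
    coordinate.\<close>
  have "neighbours (0, 0) (1, 0)" by (simp add: neighbours_def)
  then have e: "{(0, 0), (1, 0)} \<in> lattice_bonds" by (rule bondsI[OF UNIV_I UNIV_I])
  have "\<not> (\<exists>c. AE x in \<nu>. x = c)"
  proof
    assume "\<exists>c. AE x in \<nu>. x = c"
    then obtain c where "AE x in \<nu>. x = c" ..
    from pp.AE_component[OF e this] show False using assms(8)[OF e] unfolding assms(7) by blast
  qed
  then obtain A B where "A < B" "measure \<nu> {..A} > 0" "measure \<nu> {B..} > 0"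
    using nonconstant_two_rays[OF assms(5,6)] by blast
  then interpret disorder \<rho> lam \<nu> A B
    using assms by unfold_locales
  show ?thesis unfolding assms(7) by (rule AE_free_eq_wired)
qed

end
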